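(* Let $N\ge1$, $s\in(0,\frac12)$, $\frac{1}{1-s}<p<2$, $R>0$, and let $B_R\subset\mathbb{R}^N$ be the Euclidean ball of radius $R$ centered at the origin. Suppose that $f\in C^{0,1}_{loc}(\mathbb{R})$ satisfies, for some constant $C$, $$|f(t)|\le C\left(1+|t|^{\frac{Np}{N-sp}-1}\right)\qquad\text{for all } t\in\mathbb{R}.$$ If $u\in W_0^{s,p}(B_R)$ is a nontrivial non-negative weak solution of $$\begin{cases}(-\Delta)_p^su=f(u) & \text{in }B_R,\\ u=0 & \text{in }\mathbb{R}^N\setminus B_R,\end{cases}$$ then $u$ is positive in $B_R$, radially symmetric, and strictly decreasing with respect to the radius.
   Context: $C^{0,1}_{loc}$ denotes locally Lipschitz functions. Function spaces: $[u]_{s,p}=\left(\int_{\mathbb{R}^N}\int_{\mathbb{R}^N}\frac{|u(x)-u(y)|^p}{|x-y|^{N+sp}}\,dx\,dy\right)^{1/p}$; $W^{s,p}(\mathbb{R}^N)=\{u\in L^p(\mathbb{R}^N):[u]_{s,p}<\infty\}$ with norm $\|u\|_{L^p(\mathbb{R}^N)}+[u]_{s,p}$; for $\Omega$ open, $W^{s,p}_0(\Omega)=\{u\in W^{s,p}(\mathbb{R}^N): u=0 \text{ a.e. in } \mathbb{R}^N\setminus\Omega\}$, with dual space $W_0^{s,p}(\Omega)'$. Weak solution (with $\Omega=B_R$): $u\in W_0^{s,p}(\Omega)$ is a weak solution if $f(u)\in W_0^{s,p}(\Omega)'$ and $$\int_{\mathbb{R}^N}\int_{\mathbb{R}^N}\frac{|u(x)-u(y)|^{p-2}(u(x)-u(y))(\varphi(x)-\varphi(y))}{|x-y|^{N+sp}}\,dx\,dy=\langle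 f(u),\varphi\rangle\qquad\forall\,\varphi\in W_0^{s,p}(\Omega),$$ where $f(u)$ acts by $\langle f(u),\varphi\rangle=\int_\Omega f(u)\varphi\,dx$. Functions are identified up to a.e. equality, so the pointwise conclusions refer to the (continuous) representative of $u$. *)

theory Defs
  imports "HOL-Analysis.Analysis"
begin

text \<open>The Euclidean space \<open>\<real>\<^sup>N\<close> is a type \<open>'a::euclidean_space\<close> with \<open>N = DIM('a)\<close>; double integrals
  are taken with respect to the Lebesgue measure of \<open>'a \<times> 'a\<close>. On the diagonal the quotients below
  are \<open>0\<close> (as \<open>0 powr a = 0\<close> and \<open>x / 0 = 0\<close>); the diagonal is a null set.\<close>

text \<open>This is \<open>[u]\<^sub>s\<^sub>,\<^sub>p\<close> to the power \<open>p\<close>, possibly infinite.\<close>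

definition gagliardo_energy :: "real \<Rightarrow> real \<Rightarrow> ('a::euclidean_space \<Rightarrow> real) \<Rightarrow> ennreal" where
  "gagliardo_energy s p u =
     (\<integral>\<^sup>+ (x, y). ennreal (\<bar>u x - u y\<bar> powr p / norm (x - y) powr (real DIM('a) + s * p))
        \<partial>(lebesgue :: ('a \<times> 'a) measure))"

text \<open>Real-valued, hence only meaningful if the energy is finite.\<close>

definition gagliardo_seminorm :: "real \<Rightarrow> real \<Rightarrow> ('a::euclidean_space \<Rightarrow> real) \<Rightarrow> real" where
  "gagliardo_seminorm s p u = enn2real (gagliardo_energy s p u) powr (1 / p)"

definition Lp_space :: "real \<Rightarrow> ('a::euclidean_space \<Rightarrow> real) set" where
  "Lp_space p = {u \<in> borel_measurable lebesgue. integrable lebesgue (\<lambda>x. \<bar>u x\<bar> powr p)}"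

definition Lp_norm :: "real \<Rightarrow> ('a::euclidean_space \<Rightarrow> real) \<Rightarrow> real" where
  "Lp_norm p u = (LINT x|lebesgue. \<bar>u x\<bar> powr p) powr (1 / p)"

text \<open>Elements of the spaces are functions rather than almost-everywhere classes.\<close>

definition Wsp :: "real \<Rightarrow> real \<Rightarrow> ('a::euclidean_space \<Rightarrow> real) set" where
  "Wsp s p = {u \<in> Lp_space p. gagliardo_energy s p u < \<infinity>}"

definition Wsp_norm :: "real \<Rightarrow> real \<Rightarrow> ('a::euclidean_space \<Rightarrow> real) \<Rightarrow> real" where
  "Wsp_norm s p u = Lp_norm p u + gagliardo_seminorm s p u"

definition Wsp0 :: "real \<Rightarrow> real \<Rightarrow> 'a::euclidean_space set \<Rightarrow> ('a \<Rightarrow> real) set" where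
  "Wsp0 s p \<Omega> = {u \<in> Wsp s p. AE x in lebesgue. x \<notin> \<Omega> \<longrightarrow> u x = 0}"

text \<open>The functional \<open>\<phi> \<mapsto> \<integral>\<^sub>\<Omega> g \<phi>\<close> is well defined and bounded on \<open>W\<^sub>0\<^sup>s\<^sup>,\<^sup>p(\<Omega>)\<close>.
  Integrability is required explicitly because non-integrable functions have integral \<open>0\<close>.\<close>

definition in_Wsp0_dual :: "real \<Rightarrow> real \<Rightarrow> 'a::euclidean_space set \<Rightarrow> ('a \<Rightarrow> real) \<Rightarrow> bool" where
  "in_Wsp0_dual s p \<Omega> g \<longleftrightarrow>
     (\<forall>\<phi>\<in>Wsp0 s p \<Omega>. set_integrable lebesgue \<Omega> (\<lambda>x. g x * \<phi> x)) \<and>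
     (\<exists>K. \<forall>\<phi>\<in>Wsp0 s p \<Omega>. \<bar>LINT x:\<Omega>|lebesgue. g x * \<phi> x\<bar> \<le> K * Wsp_norm s p \<phi>)"

definition frac_p_form ::
  "real \<Rightarrow> real \<Rightarrow> ('a::euclidean_space \<Rightarrow> real) \<Rightarrow> ('a \<Rightarrow> real) \<Rightarrow> real" where
  "frac_p_form s p u \<phi> =
     (\<integral> (x, y). \<bar>u x - u y\<bar> powr (p - 2) * (u x - u y) * (\<phi> x - \<phi> y)
                 / norm (x - y) powr (real DIM('a) + s * p)
        \<partial>(lebesgue :: ('a \<times> 'a) measure))"

definition weak_solution ::
  "real \<Rightarrow> real \<Rightarrow> (real \<Rightarrow> real) \<Rightarrow> 'a::euclidean_space set \<Rightarrow> ('a \<Rightarrow> real) \<Rightarrow> bool" where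
  "weak_solution s p f \<Omega> u \<longleftrightarrow>
     u \<in> Wsp0 s p \<Omega> \<and>
     in_Wsp0_dual s p \<Omega> (\<lambda>x. f (u x)) \<and>
     (\<forall>\<phi>\<in>Wsp0 s p \<Omega>. frac_p_form s p u \<phi> = (LINT x:\<Omega>|lebesgue. f (u x) * \<phi> x))"

text \<open>The parameter of the library's \<open>local_lipschitz\<close> is a dummy here.\<close>

definition locally_lipschitz :: "(real \<Rightarrow> real) \<Rightarrow> bool" where
  "locally_lipschitz f \<longleftrightarrow> local_lipschitz (UNIV :: real set) UNIV (\<lambda>_. f)"

definition radially_symmetric :: "('a::real_normed_vector \<Rightarrow> real) \<Rightarrow> bool" where
  "radially_symmetric v \<longleftrightarrow> (\<forall>x y. norm x = norm y \<longrightarrow> v x = v y)"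

definition strictly_radially_decreasing_on ::
  "'a::real_normed_vector set \<Rightarrow> ('a \<Rightarrow> real) \<Rightarrow> bool" where
  "strictly_radially_decreasing_on S v \<longleftrightarrow> (\<forall>x\<in>S. \<forall>y\<in>S. norm x < norm y \<longrightarrow> v y < v x)"

end

theory Submission
  imports Defs
begin

text \<open>
  Write \<open>\<sigma> = s p\<close>, \<open>N\<close> for the dimension, \<open>J(t) = |t|\<^sup>p\<^sup>-\<^sup>2 t\<close> and \<open>K(z) = |z|\<^sup>-\<^sup>N\<^sup>-\<^sup>\<sigma>\<close>. The proof works with the
  weak formulation throughout and uses regularity of the solution only as an output. Three facts make
  this possible. Because \<open>p < 2\<close>, \<open>J\<close> is strongly monotone on bounded intervals. Because \<open>\<sigma> < 1\<close>,
  Lipschitz cutoffs have finite energy even with exponent one. And off a set that is small compared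
  with a ball of radius \<open>r\<close> the kernel has mass of order \<open>r\<^sup>-\<^sup>\<sigma>\<close> around every point.

  Boundedness. At a point \<open>x\<close>, half of the height \<open>u(x)\<close> is lost on \<open>{u \<le> u(x)/2}\<close>, whose
  complement is small by Chebyshev's inequality. This yields the critical Sobolev inequality
  (\<open>sobolev\<close>), and with the test function \<open>(u - T)\<^sup>+\<close> it shows that \<open>u\<close> is bounded
  (\<open>bounded_of_critical_growth\<close>). On the range of \<open>u\<close> the function \<open>f\<close> is then Lipschitz.

  Moving planes. Let \<open>S\<close> be the reflection in a plane \<open>x \<bullet> e = l\<close> with \<open>l \<ge> 0\<close> and let the gap be
  \<open>u \<circ> S - u\<close> on the side away from the origin. Testing with \<open>\<phi> \<circ> S - \<phi>\<close> and symmetrising over the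
  four images of a pair of points gives the equation for the gap. If the gap is negative on a set of
  small measure only, it is nonnegative (\<open>max_principle_small_set\<close>); a nonnegative gap is positive
  almost everywhere in the cap or vanishes identically (\<open>strong_max_principle\<close>). The second case is
  excluded because the solution vanishes outside the ball but has support reaching the boundary in
  every direction (\<open>support_reaches\<close>). As the gap depends continuously on \<open>l\<close> in measure, the planes
  can be moved from \<open>l = R\<close> down to \<open>l = 0\<close> (\<open>all_planes_good\<close>).

  The representative. Averages over small balls turn the almost-everywhere inequalities into a
  representative that is a nonincreasing function of the radius (\<open>radial_representative\<close>). A jump
  across a sphere would contribute a term \<open>d\<^sup>-\<^sup>\<sigma>\<close>, with \<open>d\<close> the distance to the sphere, to an
  equation whose right-hand side is bounded (\<open>no_jump\<close>), so the representative is continuous;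
  positivity of the gap makes it strictly decreasing, and hence positive, in the ball.
\<close>

section \<open>Invariance of Lebesgue measure under isometries\<close>

lemma nn_integral_lborel_translate:
  fixes F :: "'a::euclidean_space \<Rightarrow> ennreal"
  assumes [measurable]: "F \<in> borel_measurable borel"
  shows "(\<integral>\<^sup>+x. F (x + c) \<partial>lborel) = (\<integral>\<^sup>+x. F x \<partial>lborel)"
proof -
  have "(\<integral>\<^sup>+x. F x \<partial>lborel) = (\<integral>\<^sup>+x. F x \<partial>distr lborel borel ((+) c))"
    by (simp add: lborel_distr_plus)
  also have "\<dots> = (\<integral>\<^sup>+x. F (x + c) \<partial>lborel)"
    by (subst nn_integral_distr) (auto simp: add.commute)
  finally show ?thesis by simp
qed

text \<open>Computing \<open>\<integral>\<integral> 1\<^sub>A(g x) 1\<^sub>B(y)\<close>, with \<open>B\<close> the unit ball, in two orders after translating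
  shows \<open>|g\<^sup>-\<^sup>1 A| |B| = |A| |g\<^sup>-\<^sup>1 B|\<close>, as in the uniqueness proof for Haar measure; and
  \<open>g\<close> maps balls to balls of equal radius.\<close>

lemma lborel_distr_isometry:
  fixes g :: "'a::euclidean_space \<Rightarrow> 'a"
  assumes g: "orthogonal_transformation g"
  shows "distr lborel borel g = lborel"
proof (rule measure_eqI)
  have lin: "linear g" using g by (simp add: orthogonal_transformation_linear)
  have surj: "surj g" using g by (simp add: orthogonal_transformation_surj)
  have [measurable]: "g \<in> borel \<rightarrow>\<^sub>M borel"
    using linear_continuous_on[OF linear_conv_bounded_linear[THEN iffD1, OF lin]]
    by (rule borel_measurable_continuous_onI)
  have iso: "norm (g x - g y) = norm (x - y)" for x y
    using orthogonal_transformation_norm[OF g, of "x - y"] by (simp add: linear_diff[OF lin])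
  fix A assume "A \<in> sets (distr lborel borel g)"
  then have A[measurable]: "A \<in> sets borel" by simp
  define B :: "'a set" where "B = ball 0 1"
  have B[measurable]: "B \<in> sets borel" by (simp add: B_def)
  have inner1: "(\<integral>\<^sup>+x. indicator A (g x + y) \<partial>lborel) = (\<integral>\<^sup>+x. (indicator A (g x) :: ennreal) \<partial>lborel)" for y
  proof -
    obtain d where d: "y = g d" using surj by (metis surjD)
    have "(\<integral>\<^sup>+x. indicator A (g (x + d)) \<partial>lborel) = (\<integral>\<^sup>+x. (indicator A (g x) :: ennreal) \<partial>lborel)"
      by (rule nn_integral_lborel_translate) simp
    then show ?thesis by (simp add: d linear_add[OF lin])
  qed
  have inner2: "(\<integral>\<^sup>+x. indicator B (y - g x) \<partial>lborel) = emeasure lborel B" for y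
  proof -
    obtain d where d: "y = g d" using surj by (metis surjD)
    have "indicator B (y - g x) = (indicator (ball d 1) x :: ennreal)" for x
      unfolding d B_def by (simp add: indicator_def iso dist_norm norm_minus_commute[of x d])
    then have "(\<integral>\<^sup>+x. indicator B (y - g x) \<partial>lborel) = emeasure lborel (ball d 1)"
      by simp
    then show ?thesis by (simp add: B_def emeasure_ball)
  qed
  have "emeasure (distr lborel borel g) A * emeasure lborel B
      = (\<integral>\<^sup>+x. indicator A (g x) \<partial>lborel) * (\<integral>\<^sup>+y. indicator B y \<partial>lborel)"
  proof -
    have "emeasure (distr lborel borel g) A = (\<integral>\<^sup>+x. indicator A x \<partial>distr lborel borel g)" by simp
    also have "\<dots> = (\<integral>\<^sup>+x. indicator A (g x) \<partial>lborel)" by (subst nn_integral_distr) auto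
    finally show ?thesis by simp
  qed
  also have "\<dots> = (\<integral>\<^sup>+y. (\<integral>\<^sup>+x. indicator B y * indicator A (g x + y) \<partial>lborel) \<partial>lborel)"
    by (simp add: nn_integral_cmult inner1 nn_integral_multc mult.commute)
  also have "\<dots> = (\<integral>\<^sup>+x. (\<integral>\<^sup>+y. indicator B y * indicator A (g x + y) \<partial>lborel) \<partial>lborel)"
    by (rule lborel_pair.Fubini') simp
  also have "\<dots> = (\<integral>\<^sup>+x. (\<integral>\<^sup>+y. indicator B (y - g x) * indicator A y \<partial>lborel) \<partial>lborel)"
  proof (rule nn_integral_cong)
    fix x :: 'a
    have "(\<integral>\<^sup>+y. (\<lambda>y. indicator B (y - g x) * indicator A y) (y + g x) \<partial>lborel)
      = (\<integral>\<^sup>+y. indicator B (y - g x) * indicator A y \<partial>lborel)"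
      by (rule nn_integral_lborel_translate) simp
    then show "(\<integral>\<^sup>+y. indicator B y * indicator A (g x + y) \<partial>lborel)
      = (\<integral>\<^sup>+y. indicator B (y - g x) * indicator A y \<partial>lborel)"
      by (simp add: add.commute)
  qed
  also have "\<dots> = (\<integral>\<^sup>+y. (\<integral>\<^sup>+x. indicator B (y - g x) * indicator A y \<partial>lborel) \<partial>lborel)"
    by (rule lborel_pair.Fubini'[symmetric]) simp
  also have "\<dots> = emeasure lborel A * emeasure lborel B"
    by (simp add: nn_integral_multc inner2 nn_integral_cmult mult.commute)
  finally have "emeasure lborel B * emeasure (distr lborel borel g) A = emeasure lborel B * emeasure lborel A"
    by (simp add: mult.commute)
  moreover have "emeasure lborel B \<noteq> 0" "emeasure lborel B \<noteq> top"
    using unit_ball_vol_pos[of "real DIM('a)"] by (simp_all add: B_def emeasure_ball del: unit_ball_vol_pos)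
  ultimately show "emeasure (distr lborel borel g) A = emeasure lborel A"
    by (simp add: ennreal_mult_cancel_left)
qed simp

definition mirror :: "'a::euclidean_space \<Rightarrow> real \<Rightarrow> 'a \<Rightarrow> 'a" where
  "mirror e l x = x - (2 * (x \<bullet> e - l)) *\<^sub>R e"

lemma mirror_measurable[measurable]: "mirror e l \<in> borel \<rightarrow>\<^sub>M borel"
  unfolding mirror_def by (intro borel_measurable_continuous_onI continuous_intros)

lemma mirror_mirror [simp]: "norm e = 1 \<Longrightarrow> mirror e l (mirror e l x) = x"
  by (simp add: mirror_def algebra_simps dot_square_norm)

lemma mirror_inner: "norm e = 1 \<Longrightarrow> mirror e l x \<bullet> e = 2 * l - x \<bullet> e"
  by (simp add: mirror_def algebra_simps dot_square_norm)

lemma mirror_diff_mirror: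
  assumes "norm e = 1"
  shows "norm (mirror e l x - mirror e l y) = norm (x - y)"
proof -
  have "e \<bullet> e = 1" using assms by (simp add: dot_square_norm)
  then have "(norm (mirror e l x - mirror e l y))\<^sup>2 = (norm (x - y))\<^sup>2"
    unfolding power2_norm_eq_inner mirror_def by (simp add: algebra_simps inner_commute)
  then show ?thesis by simp
qed

lemma norm_diff_mirror: "norm e = 1 \<Longrightarrow> norm (mirror e l x - y) = norm (x - mirror e l y)"
  using mirror_diff_mirror[of e l x "mirror e l y"] by simp

lemma norm_diff_mirror_sq:
  assumes "norm e = 1"
  shows "(norm (x - mirror e l y))\<^sup>2 = (norm (x - y))\<^sup>2 + 4 * ((x \<bullet> e - l) * (y \<bullet> e - l))"
proof -
  have "e \<bullet> e = 1" using assms by (simp add: dot_square_norm)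
  then show ?thesis unfolding power2_norm_eq_inner mirror_def
    by (simp add: algebra_simps inner_commute)
qed

lemma norm_mirror_sq:
  assumes "norm e = 1"
  shows "(norm (mirror e l x))\<^sup>2 = (norm x)\<^sup>2 - 4 * l * (x \<bullet> e - l)"
proof -
  have "e \<bullet> e = 1" using assms by (simp add: dot_square_norm)
  then show ?thesis unfolding power2_norm_eq_inner mirror_def
    by (simp add: algebra_simps inner_commute)
qed

lemma lborel_distr_mirror:
  assumes e: "norm e = 1"
  shows "distr lborel borel (mirror e l) = (lborel :: 'a::euclidean_space measure)"
proof -
  have ee: "e \<bullet> e = 1" using e by (simp add: dot_square_norm)
  have orth: "orthogonal_transformation (mirror e 0)"
    unfolding orthogonal_transformation_def
  proof
    show "linear (mirror e 0)" by (rule linearI) (simp_all add: mirror_def algebra_simps)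
    show "\<forall>v w. mirror e 0 v \<bullet> mirror e 0 w = v \<bullet> w"
      using ee by (simp add: mirror_def algebra_simps inner_commute)
  qed
  have "mirror e l = (+) ((2 * l) *\<^sub>R e) \<circ> mirror e 0"
    by (rule ext) (simp add: mirror_def algebra_simps)
  then have "distr lborel borel (mirror e l) = distr (distr lborel borel (mirror e 0)) borel ((+) ((2 * l) *\<^sub>R e))"
    by (subst distr_distr) (auto)
  then show ?thesis by (simp add: lborel_distr_isometry[OF orth] lborel_distr_plus)
qed

lemma nn_integral_mirror:
  assumes e: "norm e = 1" and [measurable]: "F \<in> borel_measurable borel"
  shows "(\<integral>\<^sup>+x. F (mirror e l x) \<partial>lborel) = (\<integral>\<^sup>+x. F x \<partial>(lborel :: 'a::euclidean_space measure))"
  by (subst (2) lborel_distr_mirror[OF e, of l, symmetric]) (subst nn_integral_distr, auto)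

lemma integral_mirror:
  fixes F :: "'a::euclidean_space \<Rightarrow> real"
  assumes e: "norm e = 1" and [measurable]: "F \<in> borel_measurable borel"
  shows "(\<integral>x. F (mirror e l x) \<partial>lborel) = (\<integral>x. F x \<partial>lborel)"
  by (subst (2) lborel_distr_mirror[OF e, of l, symmetric]) (subst integral_distr, auto)

lemma AE_mirror:
  assumes e: "norm e = 1" and P[measurable]: "Measurable.pred borel P"
    and ae: "AE x in (lborel :: 'a::euclidean_space measure). P x"
  shows "AE x in lborel. P (mirror e l x)"
proof -
  have "AE x in distr lborel borel (mirror e l). P x" using ae by (simp only: lborel_distr_mirror[OF e])
  then show ?thesis by (subst (asm) AE_distr_iff) auto
qed

abbreviation lborel2 :: "('a::euclidean_space \<times> 'a) measure" where
  "lborel2 \<equiv> lborel \<Otimes>\<^sub>M lborel"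

lemma lborel_pair_distr:
  fixes f g :: "'a::euclidean_space \<Rightarrow> 'a"
  assumes [measurable]: "f \<in> borel \<rightarrow>\<^sub>M borel" "g \<in> borel \<rightarrow>\<^sub>M borel"
    and f: "distr lborel borel f = lborel" and g: "distr lborel borel g = lborel"
  shows "distr lborel2 (borel \<Otimes>\<^sub>M borel) (\<lambda>(x, y). (f x, g y)) = lborel2"
proof -
  have "distr lborel borel f \<Otimes>\<^sub>M distr lborel borel g
      = distr lborel2 (borel \<Otimes>\<^sub>M borel) (\<lambda>(x, y). (f x, g y))"
    by (rule pair_measure_distr) (auto simp: g sigma_finite_lborel)
  then show ?thesis by (simp add: f g)
qed

section \<open>The singular kernel\<close>

definition kern :: "real \<Rightarrow> 'a::euclidean_space \<Rightarrow> real" where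
  "kern \<sigma> z = 1 / norm z powr (real DIM('a) + \<sigma>)"

lemma kern_nonneg [simp]: "0 \<le> kern \<sigma> z" by (simp add: kern_def)

lemma kern_measurable[measurable]: "kern \<sigma> \<in> borel_measurable borel"
  unfolding kern_def by measurable

lemma kern_commute: "kern \<sigma> (x - y) = kern \<sigma> (y - x)"
  by (simp add: kern_def norm_minus_commute)

lemma kern_cong: "norm x = norm (y :: 'a::euclidean_space) \<Longrightarrow> kern \<sigma> (x :: 'a) = kern \<sigma> y"
  by (simp add: kern_def)

lemma kern_antimono:
  fixes z :: "'a::euclidean_space"
  assumes "0 < \<sigma>" "z \<noteq> 0" "norm z \<le> norm z'"
  shows "kern \<sigma> (z' :: 'a::euclidean_space) \<le> kern \<sigma> z"
  unfolding kern_def using assms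
  by (intro divide_left_mono powr_mono2 mult_pos_pos) (auto)

lemma kern_lower:
  assumes "0 < \<sigma>" "z \<noteq> 0" "norm z \<le> r"
  shows "r powr (- (real DIM('a) + \<sigma>)) \<le> kern \<sigma> (z :: 'a::euclidean_space)"
proof -
  have "1 / r powr (real DIM('a) + \<sigma>) \<le> 1 / norm z powr (real DIM('a) + \<sigma>)"
    using assms by (intro divide_left_mono powr_mono2 mult_pos_pos) (auto)
  then show ?thesis using powr_minus_divide[of r "real DIM('a) + \<sigma>"] by (simp only: kern_def)
qed

lemma emeasure_ball_pow:
  "0 \<le> r \<Longrightarrow> emeasure lborel (ball (c::'a::euclidean_space) r) = ennreal (unit_ball_vol DIM('a) * r ^ DIM('a))"
  by (rule emeasure_ball)

lemma unit_vol_pos: "0 < unit_ball_vol (real DIM('a::euclidean_space))"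
  by (simp add: unit_ball_vol_pos)

text \<open>The kernel has mass at least of order \<open>r\<^sup>-\<^sup>\<sigma>\<close> off any set that fills at most half of a ball
  of radius \<open>r\<close>. All coercivity below (the Sobolev inequality, boundedness, the maximum principle on
  small sets) comes from this.\<close>

lemma kern_mass_off_small_set:
  fixes x :: "'a::euclidean_space"
  assumes \<sigma>: "0 < \<sigma>" and r: "0 < r" and [measurable]: "Q \<in> sets borel"
    and Q: "emeasure lborel Q \<le> ennreal (unit_ball_vol DIM('a) * r ^ DIM('a) / 2)"
  shows "ennreal (unit_ball_vol DIM('a) / 2 * r powr - \<sigma>)
    \<le> (\<integral>\<^sup>+y. indicator (- Q) y * ennreal (kern \<sigma> (x - y)) \<partial>lborel)"
proof -
  let ?w = "unit_ball_vol (real DIM('a))" let ?n = "DIM('a)"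
  have w: "?w > 0" by (rule unit_vol_pos)
  have fin: "emeasure lborel Q \<noteq> \<infinity>" using Q by (auto simp: top_unique)
  have fin': "emeasure lborel (ball x r \<inter> Q) \<noteq> \<infinity>"
    using fin emeasure_mono[of "ball x r \<inter> Q" Q lborel] by (auto simp: top_unique)
  have "ennreal (?w * r ^ ?n) - emeasure lborel (ball x r \<inter> Q) = emeasure lborel (ball x r - ball x r \<inter> Q)"
    using r fin' by (subst emeasure_Diff) (auto simp: emeasure_ball_pow)
  also have "\<dots> = emeasure lborel (ball x r - {x} - Q)"
  proof -
    have "emeasure lborel (ball x r - ball x r \<inter> Q) = emeasure lborel ((ball x r - ball x r \<inter> Q) - {x})"
      by (rule emeasure_Diff_null_set[symmetric]) (auto)
    also have "(ball x r - ball x r \<inter> Q) - {x} = ball x r - {x} - Q" by auto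
    finally show ?thesis .
  qed
  finally have eq: "emeasure lborel (ball x r - {x} - Q) = ennreal (?w * r ^ ?n) - emeasure lborel (ball x r \<inter> Q)" ..
  have "emeasure lborel (ball x r \<inter> Q) \<le> ennreal (?w * r ^ ?n / 2)"
    by (rule order_trans[OF emeasure_mono Q]) auto
  then have "ennreal (?w * r ^ ?n) - ennreal (?w * r ^ ?n / 2) \<le> emeasure lborel (ball x r - {x} - Q)"
    unfolding eq by (rule ennreal_minus_mono[OF order_refl])
  moreover have "ennreal (?w * r ^ ?n) - ennreal (?w * r ^ ?n / 2) = ennreal (?w * r ^ ?n / 2)"
    using r w by (subst ennreal_minus) (auto)
  ultimately have mass: "ennreal (?w * r ^ ?n / 2) \<le> emeasure lborel (ball x r - {x} - Q)" by simp
  have "r powr - (real ?n + \<sigma>) * r ^ ?n = r powr (- (real ?n + \<sigma>) + real ?n)"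
    using r by (simp only: powr_add powr_realpow)
  then have pw: "r ^ ?n * r powr (- real ?n - \<sigma>) = r powr - \<sigma>" by (simp add: mult.commute)
  have "ennreal (?w / 2 * r powr - \<sigma>) = ennreal (r powr - (real ?n + \<sigma>)) * ennreal (?w * r ^ ?n / 2)"
    using r w pw by (subst ennreal_mult[symmetric]) (auto simp: mult_ac)
  also have "\<dots> \<le> ennreal (r powr - (real ?n + \<sigma>)) * emeasure lborel (ball x r - {x} - Q)"
    by (rule mult_left_mono[OF mass]) simp
  also have "\<dots> = (\<integral>\<^sup>+y. ennreal (r powr - (real ?n + \<sigma>)) * indicator (ball x r - {x} - Q) y \<partial>lborel)"
    by (subst nn_integral_cmult_indicator) auto
  also have "\<dots> \<le> (\<integral>\<^sup>+y. indicator (- Q) y * ennreal (kern \<sigma> (x - y)) \<partial>lborel)"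
    by (rule nn_integral_mono)
      (auto simp: indicator_def dist_norm simp del: minus_add_distrib intro!: ennreal_leI kern_lower[OF \<sigma>])
  finally show ?thesis .
qed

lemma ennreal_le_suminf: "F j \<le> (\<Sum>j. F j :: ennreal)"
  using sum_le_suminf[of F "{j}"] by simp

text \<open>Radial integrals are estimated by dyadic shells, with the volumes of balls as the only input from
  geometry.\<close>

lemma nn_integral_dyadic_shells:
  fixes z0 :: "'a::euclidean_space"
  assumes c: "\<And>j. 0 \<le> c j" and r: "\<And>j. 0 \<le> r j"
    and dom: "\<And>z. F z \<le> (\<Sum>j. ennreal (c j) * indicator (ball 0 (r j)) z)"
    and sm: "summable (\<lambda>j. c j * r j ^ DIM('a))"
  shows "(\<integral>\<^sup>+z. F z \<partial>(lborel::'a measure)) < \<infinity>"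
proof -
  let ?w = "unit_ball_vol (real DIM('a))"
  have w: "?w > 0" by (rule unit_vol_pos)
  have "(\<integral>\<^sup>+z. F z \<partial>(lborel::'a measure)) \<le> (\<integral>\<^sup>+z. (\<Sum>j. ennreal (c j) * indicator (ball 0 (r j)) z) \<partial>(lborel::'a measure))"
    by (rule nn_integral_mono) (rule dom)
  also have "\<dots> = (\<Sum>j. \<integral>\<^sup>+z. ennreal (c j) * indicator (ball 0 (r j)) z \<partial>(lborel::'a measure))"
    by (intro nn_integral_suminf borel_measurable_times_ennreal borel_measurable_const borel_measurable_indicator) simp
  also have "\<dots> = (\<Sum>j. ennreal (?w * (c j * r j ^ DIM('a))))"
  proof (rule suminf_cong)
    fix j
    have "(\<integral>\<^sup>+z. ennreal (c j) * indicator (ball 0 (r j)) z \<partial>(lborel::'a measure))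
        = ennreal (c j) * ennreal (?w * r j ^ DIM('a))"
      using r by (subst nn_integral_cmult_indicator) (auto simp: emeasure_ball_pow)
    also have "\<dots> = ennreal (c j * (?w * r j ^ DIM('a)))"
      using c r w by (subst ennreal_mult) auto
    finally show "(\<integral>\<^sup>+z. ennreal (c j) * indicator (ball 0 (r j)) z \<partial>(lborel::'a measure))
        = ennreal (?w * (c j * r j ^ DIM('a)))" by (simp add: mult.left_commute)
  qed
  also have "\<dots> = ennreal (\<Sum>j. ?w * (c j * r j ^ DIM('a)))"
    using c r w by (intro suminf_ennreal2) (auto intro!: summable_mult sm)
  also have "\<dots> < \<infinity>" by simp
  finally show ?thesis .
qed

lemma nn_integral_lborel_affine:
  fixes F :: "'a::euclidean_space \<Rightarrow> ennreal"
  assumes "c \<noteq> 0" and [measurable]: "F \<in> borel_measurable borel"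
  shows "(\<integral>\<^sup>+x. F x \<partial>lborel) = ennreal (\<bar>c\<bar> ^ DIM('a)) * (\<integral>\<^sup>+x. F (t + c *\<^sub>R x) \<partial>lborel)"
  by (subst lborel_affine[OF assms(1), of t])
    (simp add: nn_integral_density nn_integral_distr nn_integral_cmult)

lemma kern_shells_large:
  assumes \<sigma>: "0 < \<sigma>"
  shows "(\<integral>\<^sup>+z. ennreal (indicat_real {z. 1 \<le> norm z} z * kern \<sigma> z) \<partial>(lborel :: 'a::euclidean_space measure)) < \<infinity>"
proof (rule nn_integral_dyadic_shells)
  let ?k = "real DIM('a) + \<sigma>"
  let ?c = "\<lambda>j::nat. (2 ^ j) powr - ?k" and ?r = "\<lambda>j::nat. (2::real) ^ Suc j"
  show "0 \<le> ?c j" for j by simp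
  show "0 \<le> ?r j" for j by simp
  show "ennreal (indicat_real {z. 1 \<le> norm z} z * kern \<sigma> z) \<le> (\<Sum>j. ennreal (?c j) * indicator (ball 0 (?r j)) z)" for z :: 'a
  proof (cases "1 \<le> norm z")
    case True
    obtain m where m: "norm z < 2 ^ m" using real_arch_pow[of 2 "norm z"] by auto
    define n where "n = (LEAST n. norm z < 2 ^ n)"
    have n: "norm z < 2 ^ n" unfolding n_def using m by (rule LeastI)
    have "n \<noteq> 0" using n True by (cases n) auto
    then obtain j where j: "n = Suc j" by (cases n) auto
    have "\<not> norm z < 2 ^ j" unfolding n_def using j n_def by (intro not_less_Least) simp
    then have "kern \<sigma> z \<le> 1 / (2 ^ j) powr ?k"
      unfolding kern_def using \<sigma> True by (intro divide_left_mono powr_mono2 mult_pos_pos) auto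
    then have kj: "kern \<sigma> z \<le> ?c j" by (simp only: powr_minus_divide)
    have "ennreal (indicat_real {z. 1 \<le> norm z} z * kern \<sigma> z) \<le> ennreal (?c j) * indicator (ball 0 (?r j)) z"
      using True n j kj by (auto intro!: ennreal_leI)
    also have "\<dots> \<le> (\<Sum>j. ennreal (?c j) * indicator (ball 0 (?r j)) z)"
      by (rule ennreal_le_suminf)
    finally show ?thesis .
  qed simp
  have "?c j * ?r j ^ DIM('a) = 2 ^ DIM('a) * (2 powr - \<sigma>) ^ j" for j
  proof -
    have "?c j = (2 powr real j) powr - ?k" by (simp add: powr_realpow)
    also have "\<dots> = 2 powr (- real j * ?k)" by (simp add: powr_powr algebra_simps)
    finally have c: "?c j = 2 powr (- real j * ?k)" .
    have "?r j ^ DIM('a) = 2 powr (real (Suc j * DIM('a)))" by (simp only: powr_realpow[OF zero_less_numeral] power_mult[symmetric])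
    then have "?c j * ?r j ^ DIM('a) = 2 powr (- real j * ?k + real (Suc j * DIM('a)))"
      by (simp only: c powr_add)
    also have "\<dots> = 2 powr (real DIM('a) + real j * (- \<sigma>))" by (simp add: algebra_simps)
    also have "\<dots> = 2 ^ DIM('a) * (2 powr - \<sigma>) ^ j"
    proof -
      have "(2 powr - \<sigma>) ^ j = (2 powr - \<sigma>) powr real j" by (simp add: powr_realpow)
      also have "\<dots> = 2 powr (real j * (- \<sigma>))" by (simp add: powr_powr mult.commute)
      finally show ?thesis by (simp only: powr_add powr_realpow[OF zero_less_numeral])
    qed
    finally show ?thesis .
  qed
  moreover have "2 powr - \<sigma> < (1::real)" using \<sigma> powr_less_mono[of "- \<sigma>" 0 2] by simp
  ultimately show "summable (\<lambda>j. ?c j * ?r j ^ DIM('a))"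
    by (simp only:) (intro summable_mult summable_geometric, simp)
qed

lemma kern_shells_small:
  assumes \<sigma>: "0 < \<sigma>" "\<sigma> < 1"
  shows "(\<integral>\<^sup>+z. ennreal (indicat_real {z. norm z < 1} z * (norm z * kern \<sigma> z)) \<partial>(lborel :: 'a::euclidean_space measure)) < \<infinity>"
proof (rule nn_integral_dyadic_shells)
  let ?k = "real DIM('a) + \<sigma>"
  let ?c = "\<lambda>j::nat. (1/2) ^ j * ((1/2) ^ Suc j) powr - ?k" and ?r = "\<lambda>j::nat. (1/2::real) ^ j"
  show "0 \<le> ?c j" for j by simp
  show "0 \<le> ?r j" for j by simp
  show "ennreal (indicat_real {z. norm z < 1} z * (norm z * kern \<sigma> z)) \<le> (\<Sum>j. ennreal (?c j) * indicator (ball 0 (?r j)) z)" for z :: 'a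
  proof (cases "norm z < 1 \<and> z \<noteq> 0")
    case True
    obtain m where m: "(1/2) ^ m \<le> norm z" using real_arch_pow_inv[of "norm z" "1/2"] True by (auto intro: less_imp_le)
    define n where "n = (LEAST n. (1/2) ^ n \<le> norm z)"
    have n: "(1/2) ^ n \<le> norm z" unfolding n_def using m by (rule LeastI)
    have "n \<noteq> 0" using n True by (cases n) auto
    then obtain j where j: "n = Suc j" by (cases n) auto
    have "\<not> (1/2) ^ j \<le> norm z" unfolding n_def using j n_def by (intro not_less_Least) simp
    then have zj: "norm z < (1/2) ^ j" by simp
    have "kern \<sigma> z \<le> 1 / ((1/2) ^ Suc j) powr ?k"
      unfolding kern_def using \<sigma> True n j by (intro divide_left_mono powr_mono2 mult_pos_pos) auto
    then have kj: "kern \<sigma> z \<le> ((1/2) ^ Suc j) powr - ?k" by (simp only: powr_minus_divide)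
    have "norm z * kern \<sigma> z \<le> ?c j"
      using kj zj by (intro mult_mono) auto
    then have "ennreal (indicat_real {z. norm z < 1} z * (norm z * kern \<sigma> z)) \<le> ennreal (?c j) * indicator (ball 0 (?r j)) z"
      using True zj by (auto intro!: ennreal_leI simp: dist_norm)
    also have "\<dots> \<le> (\<Sum>j. ennreal (?c j) * indicator (ball 0 (?r j)) z)"
      by (rule ennreal_le_suminf)
    finally show ?thesis .
  qed auto
  have half: "(1/2::real) ^ j = 2 powr (- real j)" for j :: nat
    by (simp add: powr_minus powr_realpow power_one_over field_simps)
  have "?c j * ?r j ^ DIM('a) = 2 powr ?k * (2 powr (\<sigma> - 1)) ^ j" for j
  proof -
    have "?c j * ?r j ^ DIM('a) = 2 powr (- real j) * (2 powr (- real (Suc j))) powr - ?k * (2 powr (- real j)) powr (real DIM('a))"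
      by (simp only: half powr_realpow[symmetric] powr_gt_zero)
    also have "\<dots> = 2 powr (- real j + real (Suc j) * ?k - real j * real DIM('a))"
      by (simp only: powr_powr powr_add[symmetric]) (simp add: algebra_simps)
    also have "\<dots> = 2 powr (?k + (\<sigma> - 1) * real j)" by (simp add: algebra_simps)
    also have "\<dots> = 2 powr ?k * (2 powr (\<sigma> - 1)) powr real j" by (simp only: powr_add powr_powr)
    also have "\<dots> = 2 powr ?k * (2 powr (\<sigma> - 1)) ^ j" by (simp add: powr_realpow)
    finally show ?thesis .
  qed
  moreover have "2 powr (\<sigma> - 1) < (1::real)" using \<sigma> powr_less_mono[of "\<sigma> - 1" 0 2] by simp
  ultimately show "summable (\<lambda>j. ?c j * ?r j ^ DIM('a))"
    by (simp only:) (intro summable_mult summable_geometric, simp)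
qed

text \<open>Here \<open>\<sigma> < 1\<close> is decisive: Lipschitz functions have finite energy against the kernel already
  with exponent one, so Lipschitz cutoffs never interact with the regularity of the solution.\<close>

lemma kern_min_integral:
  assumes \<sigma>: "0 < \<sigma>" "\<sigma> < 1"
  obtains I where "0 \<le> I"
    and "\<And>h (x::'a::euclidean_space). 0 < h \<Longrightarrow>
      (\<integral>\<^sup>+y. ennreal (min 1 (norm (x - y) / h) * kern \<sigma> (x - y)) \<partial>lborel) \<le> ennreal (I * h powr - \<sigma>)"
proof -
  let ?k = "real DIM('a) + \<sigma>"
  define I where "I = (\<integral>\<^sup>+z. ennreal (min 1 (norm z) * kern \<sigma> z) \<partial>(lborel :: 'a measure))"
  have "I \<le> (\<integral>\<^sup>+z. ennreal (indicat_real {z. 1 \<le> norm z} z * kern \<sigma> z)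
      + ennreal (indicat_real {z. norm z < 1} z * (norm z * kern \<sigma> z)) \<partial>(lborel :: 'a measure))"
    unfolding I_def by (rule nn_integral_mono) (auto simp: indicator_def intro!: ennreal_leI)
  also have "\<dots> = (\<integral>\<^sup>+z. ennreal (indicat_real {z. 1 \<le> norm z} z * kern \<sigma> z) \<partial>(lborel :: 'a measure))
      + (\<integral>\<^sup>+z. ennreal (indicat_real {z. norm z < 1} z * (norm z * kern \<sigma> z)) \<partial>(lborel :: 'a measure))"
    by (rule nn_integral_add) measurable
  also have "\<dots> < \<infinity>" using kern_shells_large[OF \<sigma>(1), where 'a='a] kern_shells_small[OF \<sigma>, where 'a='a] by simp
  finally have fin: "I < \<infinity>" .
  have "(\<integral>\<^sup>+y. ennreal (min 1 (norm (x - y) / h) * kern \<sigma> (x - y)) \<partial>lborel) = ennreal (enn2real I * h powr - \<sigma>)"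
    if h: "0 < h" for h and x :: 'a
  proof -
    have "(\<integral>\<^sup>+y. ennreal (min 1 (norm (x - y) / h) * kern \<sigma> (x - y)) \<partial>lborel)
      = ennreal (\<bar>h\<bar> ^ DIM('a)) * (\<integral>\<^sup>+y. ennreal (min 1 (norm (x - (x + h *\<^sub>R y)) / h) * kern \<sigma> (x - (x + h *\<^sub>R y))) \<partial>(lborel::'a measure))"
      by (rule nn_integral_lborel_affine) (use h in auto)
    also have "(\<integral>\<^sup>+y. ennreal (min 1 (norm (x - (x + h *\<^sub>R y)) / h) * kern \<sigma> (x - (x + h *\<^sub>R y))) \<partial>(lborel::'a measure))
      = (\<integral>\<^sup>+y. ennreal (h powr - ?k) * ennreal (min 1 (norm y) * kern \<sigma> y) \<partial>(lborel::'a measure))"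
    proof (rule nn_integral_cong)
      fix y :: 'a
      have "kern \<sigma> (x - (x + h *\<^sub>R y)) = h powr - ?k * kern \<sigma> y"
        unfolding kern_def using h by (simp only: powr_minus_divide) (simp add: powr_mult)
      then show "ennreal (min 1 (norm (x - (x + h *\<^sub>R y)) / h) * kern \<sigma> (x - (x + h *\<^sub>R y)))
        = ennreal (h powr - ?k) * ennreal (min 1 (norm y) * kern \<sigma> y)"
        using h by (subst ennreal_mult[symmetric]) (auto simp: mult_ac)
    qed
    also have "\<dots> = ennreal (h powr - ?k) * I" unfolding I_def by (rule nn_integral_cmult) measurable
    also have "ennreal (\<bar>h\<bar> ^ DIM('a)) * \<dots> = ennreal (\<bar>h\<bar> ^ DIM('a) * h powr - ?k) * ennreal (enn2real I)"
      using fin h by (simp add: ennreal_mult mult.assoc)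
    also have "\<bar>h\<bar> ^ DIM('a) * h powr - ?k = h powr - \<sigma>"
    proof -
      have "h ^ DIM('a) * h powr - ?k = h powr (real DIM('a) + - ?k)"
        using h by (simp only: powr_add powr_realpow)
      then show ?thesis using h by simp
    qed
    finally show ?thesis by (simp add: ennreal_mult[symmetric] mult.commute)
  qed
  then show ?thesis using that[of "enn2real I"] by simp
qed

section \<open>The odd power nonlinearity\<close>

definition spow :: "real \<Rightarrow> real \<Rightarrow> real" where
  "spow p t = \<bar>t\<bar> powr (p - 2) * t"

lemma spow_measurable[measurable]: "spow p \<in> borel_measurable borel"
  unfolding spow_def by measurable

lemma spow_0 [simp]: "spow p 0 = 0" by (simp add: spow_def)

lemma spow_minus: "spow p (- t) = - spow p t" by (simp add: spow_def)

lemma spow_swap: "spow p (a - b) = - spow p (b - a)"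
  using spow_minus[of p "b - a"] by simp

lemma spow_pos: "0 \<le> t \<Longrightarrow> spow p t = t powr (p - 1)"
  by (cases "t = 0") (auto simp: spow_def powr_mult_base mult.commute)

lemma abs_spow: "\<bar>spow p t\<bar> = \<bar>t\<bar> powr (p - 1)"
  using spow_pos[of "\<bar>t\<bar>" p] by (simp add: spow_def abs_mult)

lemma abs_spow_le:
  assumes "1 < p" "\<bar>t\<bar> \<le> T"
  shows "\<bar>spow p t\<bar> \<le> T powr (p - 1)"
  unfolding abs_spow using assms by (intro powr_mono2) auto

text \<open>For \<open>p < 2\<close> the nonlinearity is uniformly elliptic from below on bounded sets: its derivative
  \<open>(p - 1) |t|\<^sup>p\<^sup>-\<^sup>2\<close> is at least \<open>(p - 1) T\<^sup>p\<^sup>-\<^sup>2\<close> on \<open>[-T, T]\<close>.\<close>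

lemma spow_strongly_mono:
  assumes p: "1 < p" "p < 2" and T: "a \<le> b" "\<bar>a\<bar> \<le> T" "\<bar>b\<bar> \<le> T"
  shows "(p - 1) * T powr (p - 2) * (b - a) \<le> spow p b - spow p a"
proof -
  let ?c = "(p - 1) * T powr (p - 2)"
  have pos: "?c * (y - x) \<le> spow p y - spow p x" if "0 \<le> x" "x \<le> y" "y \<le> T" for x y
  proof -
    have "x powr (p - 1) - ?c * x \<le> y powr (p - 1) - ?c * y"
    proof (rule DERIV_nonneg_imp_increasing_open[of x y "\<lambda>t. t powr (p - 1) - ?c * t"])
      show "x \<le> y" by fact
      show "\<exists>d. ((\<lambda>t. t powr (p - 1) - ?c * t) has_real_derivative d) (at t) \<and> 0 \<le> d"
        if "x < t" "t < y" for t
      proof (intro exI conjI)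
        have t: "0 < t" "t \<le> T" using that \<open>0 \<le> x\<close> \<open>y \<le> T\<close> by auto
        show "((\<lambda>t. t powr (p - 1) - ?c * t) has_real_derivative
            (p - 1) * t powr (p - 1 - 1) - ?c * 1) (at t)"
          using t by (intro derivative_intros has_real_derivative_powr) auto
        have "T powr (p - 2) \<le> t powr (p - 2)"
          using t p by (intro powr_mono2') auto
        then show "0 \<le> (p - 1) * t powr (p - 1 - 1) - ?c * 1"
          using p by (simp add: mult_left_mono)
      qed
      show "continuous_on {x..y} (\<lambda>t. t powr (p - 1) - ?c * t)"
        using p that by (intro continuous_intros continuous_on_powr') auto
    qed
    then show ?thesis using that by (simp add: spow_pos algebra_simps)
  qed
  consider "0 \<le> a" | "b \<le> 0" | "a < 0" "0 < b" by linarith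
  then show ?thesis
  proof cases
    case 1 then show ?thesis using pos[of a b] T by auto
  next
    case 2 then show ?thesis using pos[of "- b" "- a"] T by (simp add: spow_minus)
  next
    case 3
    then have "?c * b \<le> spow p b" "?c * (- a) \<le> - spow p a"
      using pos[of 0 b] pos[of 0 "- a"] T by (auto simp: spow_minus)
    then show ?thesis by (simp add: algebra_simps)
  qed
qed

lemma spow_mono:
  assumes p: "1 < p" "p < 2" and "a \<le> b"
  shows "spow p a \<le> spow p b"
proof -
  have "0 \<le> (p - 1) * (max \<bar>a\<bar> \<bar>b\<bar>) powr (p - 2) * (b - a)" using assms by simp
  then show ?thesis using spow_strongly_mono[OF p \<open>a \<le> b\<close>, of "max \<bar>a\<bar> \<bar>b\<bar>"] by simp
qed

lemma powr_young:
  assumes "1 < p" "0 \<le> a" "0 \<le> b"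
  shows "a powr (p - 1) * b \<le> a powr p + b powr (p :: real)"
proof (cases "a \<le> b")
  case True
  have "a powr (p - 1) * b \<le> b powr (p - 1) * b" using assms True by (intro mult_right_mono powr_mono2) auto
  also have "\<dots> = b powr p" using assms by (cases "b = 0") (auto simp: powr_mult_base mult.commute)
  finally show ?thesis using powr_ge_zero[of a p] by linarith
next
  case False
  then have "a powr (p - 1) * b \<le> a powr (p - 1) * a" using assms by (intro mult_left_mono) auto
  also have "\<dots> = a powr p" using assms by (cases "a = 0") (auto simp: powr_mult_base mult.commute)
  finally show ?thesis using powr_ge_zero[of b p] by linarith
qed

lemma powr_add_le:
  assumes "0 < p" "0 \<le> a" "0 \<le> b"
  shows "(a + b) powr p \<le> 2 powr p * (a powr p + b powr (p :: real))"
proof -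
  have "(a + b) powr p \<le> (2 * max a b) powr p" using assms by (intro powr_mono2) auto
  also have "\<dots> = 2 powr p * (max a b) powr p" using assms by (simp add: powr_mult)
  also have "\<dots> \<le> 2 powr p * (a powr p + b powr p)"
    by (intro mult_left_mono) (auto simp: max_def)
  finally show ?thesis .
qed

section \<open>Energies\<close>

text \<open>The energies are taken over the product measure, where Tonelli's theorem applies directly.\<close>

definition energy :: "real \<Rightarrow> real \<Rightarrow> ('a::euclidean_space \<Rightarrow> real) \<Rightarrow> ennreal" where
  "energy \<sigma> p u = (\<integral>\<^sup>+z. ennreal (\<bar>u (fst z) - u (snd z)\<bar> powr p * kern \<sigma> (fst z - snd z)) \<partial>lborel2)"

definition form_integrand :: "real \<Rightarrow> real \<Rightarrow> ('a::euclidean_space \<Rightarrow> real) \<Rightarrow> ('a \<Rightarrow> real) \<Rightarrow> 'a \<times> 'a \<Rightarrow> real" where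
  "form_integrand \<sigma> p u \<phi> z = spow p (u (fst z) - u (snd z)) * (\<phi> (fst z) - \<phi> (snd z)) * kern \<sigma> (fst z - snd z)"

lemma energy_iterated:
  assumes [measurable]: "u \<in> borel_measurable borel"
  shows "energy \<sigma> p u = (\<integral>\<^sup>+x. \<integral>\<^sup>+y. ennreal (\<bar>u x - u y\<bar> powr p * kern \<sigma> (x - y)) \<partial>lborel \<partial>lborel)"
  unfolding energy_def by (subst lborel.nn_integral_fst[symmetric]) auto

lemma form_measurable[measurable]:
  assumes [measurable]: "u \<in> borel_measurable borel" "\<phi> \<in> borel_measurable borel"
  shows "form_integrand \<sigma> p u \<phi> \<in> borel_measurable lborel2"
  unfolding form_integrand_def by measurable

lemma energy_mono:
  assumes p: "0 \<le> p" and le: "\<And>x y. \<bar>v x - v y\<bar> \<le> \<bar>u x - u y\<bar>"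
  shows "energy \<sigma> p v \<le> energy \<sigma> p u"
  unfolding energy_def using p le
  by (intro nn_integral_mono ennreal_leI mult_right_mono powr_mono2) auto

lemma energy_finite_le_AE:
  fixes u v w :: "'a::euclidean_space \<Rightarrow> real"
  assumes p: "1 < p" and [measurable]: "u \<in> borel_measurable borel" "v \<in> borel_measurable borel"
    and K: "0 \<le> K"
    and le: "AE z in lborel2. \<bar>w (fst z) - w (snd z)\<bar>
      \<le> K * (\<bar>u (fst z) - u (snd z)\<bar> + \<bar>v (fst z) - v (snd z)\<bar>)"
    and fin: "energy \<sigma> p u < \<infinity>" "energy \<sigma> p v < \<infinity>"
  shows "energy \<sigma> p w < \<infinity>"
proof -
  let ?c = "K powr p * 2 powr p"
  let ?u = "\<lambda>z. \<bar>u (fst z) - u (snd z)\<bar> powr p * kern \<sigma> (fst z - snd z)"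
  let ?v = "\<lambda>z. \<bar>v (fst z) - v (snd z)\<bar> powr p * kern \<sigma> (fst z - snd z)"
  have "energy \<sigma> p w \<le> (\<integral>\<^sup>+z. ennreal ?c * (ennreal (?u z) + ennreal (?v z)) \<partial>lborel2)"
    unfolding energy_def
    using le
  proof (intro nn_integral_mono_AE, eventually_elim)
    case (elim z)
    let ?a = "\<bar>u (fst z) - u (snd z)\<bar>" and ?b = "\<bar>v (fst z) - v (snd z)\<bar>"
    have "\<bar>w (fst z) - w (snd z)\<bar> powr p \<le> (K * (?a + ?b)) powr p"
      using p elim by (intro powr_mono2) auto
    also have "\<dots> = K powr p * (?a + ?b) powr p" using K by (simp add: powr_mult)
    also have "\<dots> \<le> K powr p * (2 powr p * (?a powr p + ?b powr p))"
      using p by (intro mult_left_mono powr_add_le) auto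
    finally have "\<bar>w (fst z) - w (snd z)\<bar> powr p * kern \<sigma> (fst z - snd z)
        \<le> K powr p * (2 powr p * (?a powr p + ?b powr p)) * kern \<sigma> (fst z - snd z)"
      by (rule mult_right_mono) simp
    also have "\<dots> = ?c * (?u z + ?v z)" by (simp add: algebra_simps)
    finally have "ennreal (\<bar>w (fst z) - w (snd z)\<bar> powr p * kern \<sigma> (fst z - snd z)) \<le> ennreal (?c * (?u z + ?v z))"
      by (rule ennreal_leI)
    also have "\<dots> = ennreal ?c * (ennreal (?u z) + ennreal (?v z))"
      by (simp only: ennreal_mult[of ?c] ennreal_plus[of "?u z" "?v z"] kern_nonneg powr_ge_zero mult_nonneg_nonneg add_nonneg_nonneg)
    finally show "ennreal (\<bar>w (fst z) - w (snd z)\<bar> powr p * kern \<sigma> (fst z - snd z))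
      \<le> ennreal ?c * (ennreal (?u z) + ennreal (?v z))" .
  qed
  also have "\<dots> = ennreal ?c * (energy \<sigma> p u + energy \<sigma> p v)"
    unfolding energy_def by (subst nn_integral_cmult) (auto simp: nn_integral_add)
  also have "\<dots> < \<infinity>" using fin by (simp add: ennreal_mult_less_top)
  finally show ?thesis .
qed

lemma energy_finite_le:
  fixes u v w :: "'a::euclidean_space \<Rightarrow> real"
  assumes p: "1 < p" and [measurable]: "u \<in> borel_measurable borel" "v \<in> borel_measurable borel"
    and K: "0 \<le> K"
    and le: "\<And>x y. \<bar>w x - w y\<bar> \<le> K * (\<bar>u x - u y\<bar> + \<bar>v x - v y\<bar>)"
    and fin: "energy \<sigma> p u < \<infinity>" "energy \<sigma> p v < \<infinity>"
  shows "energy \<sigma> p w < \<infinity>"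
  by (rule energy_finite_le_AE[OF p assms(2,3) K _ fin]) (intro AE_I2 le)

lemma form_integrable:
  assumes p: "1 < p" and [measurable]: "u \<in> borel_measurable borel" "\<phi> \<in> borel_measurable borel"
    and fin: "energy \<sigma> p u < \<infinity>" "energy \<sigma> p \<phi> < \<infinity>"
  shows "integrable lborel2 (form_integrand \<sigma> p u \<phi>)"
proof (rule integrableI_bounded)
  let ?u = "\<lambda>z. \<bar>u (fst z) - u (snd z)\<bar> powr p * kern \<sigma> (fst z - snd z)"
  let ?v = "\<lambda>z. \<bar>\<phi> (fst z) - \<phi> (snd z)\<bar> powr p * kern \<sigma> (fst z - snd z)"
  have "(\<integral>\<^sup>+z. ennreal (norm (form_integrand \<sigma> p u \<phi> z)) \<partial>lborel2)
    \<le> (\<integral>\<^sup>+z. ennreal (?u z) + ennreal (?v z) \<partial>lborel2)"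
  proof (rule nn_integral_mono)
    fix z
    have "norm (form_integrand \<sigma> p u \<phi> z) = (\<bar>u (fst z) - u (snd z)\<bar> powr (p - 1) * \<bar>\<phi> (fst z) - \<phi> (snd z)\<bar>) * kern \<sigma> (fst z - snd z)"
      by (simp add: form_integrand_def abs_mult abs_spow)
    also have "\<dots> \<le> (\<bar>u (fst z) - u (snd z)\<bar> powr p + \<bar>\<phi> (fst z) - \<phi> (snd z)\<bar> powr p) * kern \<sigma> (fst z - snd z)"
      by (intro mult_right_mono powr_young p) auto
    finally show "ennreal (norm (form_integrand \<sigma> p u \<phi> z)) \<le> ennreal (?u z) + ennreal (?v z)"
      by (simp add: ennreal_plus[symmetric] distrib_right ennreal_leI del: ennreal_plus)
  qed
  also have "\<dots> = energy \<sigma> p u + energy \<sigma> p \<phi>"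
    unfolding energy_def by (rule nn_integral_add) auto
  also have "\<dots> < \<infinity>" using fin by simp
  finally show "(\<integral>\<^sup>+z. ennreal (norm (form_integrand \<sigma> p u \<phi> z)) \<partial>lborel2) < \<infinity>" .
qed simp

text \<open>The exponent \<open>q\<close> with \<open>1 \<le> q\<close> covers both the energy of a cutoff and, for \<open>q = 1\<close>, the
  dominating functions in the limits below.\<close>

lemma lipschitz_cutoff_energy:
  fixes \<eta> :: "'a::euclidean_space \<Rightarrow> real"
  assumes \<sigma>: "0 < \<sigma>" "\<sigma> < 1" and q: "1 \<le> q" and M: "0 \<le> M"
    and [measurable]: "\<eta> \<in> borel_measurable borel"
    and lip: "\<And>x y. \<bar>\<eta> x - \<eta> y\<bar> \<le> M * min 1 (norm (x - y))"
    and supp: "\<And>x. x \<notin> ball 0 R \<Longrightarrow> \<eta> x = 0"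
  shows "energy \<sigma> q \<eta> < \<infinity>"
proof -
  obtain I where I: "0 \<le> I" "\<And>h (x::'a). 0 < h \<Longrightarrow>
      (\<integral>\<^sup>+y. ennreal (min 1 (norm (x - y) / h) * kern \<sigma> (x - y)) \<partial>lborel) \<le> ennreal (I * h powr - \<sigma>)"
    using kern_min_integral[OF \<sigma>] by blast
  define B where "B = ball (0::'a) R"
  have [measurable]: "B \<in> sets borel" by (simp add: B_def)
  let ?k = "\<lambda>x y :: 'a. ennreal (M powr q) * ennreal (min 1 (norm (x - y)) * kern \<sigma> (x - y))"
  have inner: "(\<integral>\<^sup>+y. ?k x y \<partial>lborel) \<le> ennreal (M powr q * I)" for x :: 'a
    using mult_left_mono[OF I(2)[of 1 x], of "ennreal (M powr q)"] I(1)
    by (simp add: nn_integral_cmult ennreal_mult)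
  have "energy \<sigma> q \<eta> = (\<integral>\<^sup>+x. \<integral>\<^sup>+y. ennreal (\<bar>\<eta> x - \<eta> y\<bar> powr q * kern \<sigma> (x - y)) \<partial>lborel \<partial>lborel)"
    by (rule energy_iterated) measurable
  also have "\<dots> \<le> (\<integral>\<^sup>+x. \<integral>\<^sup>+y. indicator B x * ?k x y + indicator B y * ?k x y \<partial>lborel \<partial>lborel)"
  proof (intro nn_integral_mono)
    fix x y :: 'a
    have "\<bar>\<eta> x - \<eta> y\<bar> powr q \<le> (M * min 1 (norm (x - y))) powr q"
      using q lip by (intro powr_mono2) auto
    also have "\<dots> = M powr q * (min 1 (norm (x - y))) powr q" using M by (simp add: powr_mult)
    also have "\<dots> \<le> M powr q * (min 1 (norm (x - y))) powr 1"
      using q by (intro mult_left_mono powr_mono') auto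
    finally have "\<bar>\<eta> x - \<eta> y\<bar> powr q * kern \<sigma> (x - y) \<le> M powr q * (min 1 (norm (x - y))) * kern \<sigma> (x - y)"
      by (intro mult_right_mono) auto
    then have le: "ennreal (\<bar>\<eta> x - \<eta> y\<bar> powr q * kern \<sigma> (x - y)) \<le> ?k x y"
      by (subst ennreal_mult[symmetric]) (auto simp: mult.assoc intro!: ennreal_leI)
    show "ennreal (\<bar>\<eta> x - \<eta> y\<bar> powr q * kern \<sigma> (x - y)) \<le> indicator B x * ?k x y + indicator B y * ?k x y"
    proof (cases "x \<in> B \<or> y \<in> B")
      case True
      then have "?k x y \<le> indicator B x * ?k x y + indicator B y * ?k x y"
        by (auto simp: indicator_def add_increasing add_increasing2)
      with le show ?thesis by (rule order_trans)
    next
      case False then show ?thesis using supp by (simp add: B_def)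
    qed
  qed
  also have "\<dots> = (\<integral>\<^sup>+x. \<integral>\<^sup>+y. indicator B x * ?k x y \<partial>lborel \<partial>lborel)
      + (\<integral>\<^sup>+x. \<integral>\<^sup>+y. indicator B y * ?k x y \<partial>lborel \<partial>lborel)"
  proof -
    have "(\<integral>\<^sup>+y. indicator B x * ?k x y + indicator B y * ?k x y \<partial>lborel)
        = (\<integral>\<^sup>+y. indicator B x * ?k x y \<partial>lborel) + (\<integral>\<^sup>+y. indicator B y * ?k x y \<partial>lborel)" for x
      by (rule nn_integral_add) measurable
    then have "(\<integral>\<^sup>+x. \<integral>\<^sup>+y. indicator B x * ?k x y + indicator B y * ?k x y \<partial>lborel \<partial>lborel)
        = (\<integral>\<^sup>+x. (\<integral>\<^sup>+y. indicator B x * ?k x y \<partial>lborel) + (\<integral>\<^sup>+y. indicator B y * ?k x y \<partial>lborel) \<partial>lborel)"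
      by (intro nn_integral_cong)
    also have "\<dots> = (\<integral>\<^sup>+x. \<integral>\<^sup>+y. indicator B x * ?k x y \<partial>lborel \<partial>lborel)
      + (\<integral>\<^sup>+x. \<integral>\<^sup>+y. indicator B y * ?k x y \<partial>lborel \<partial>lborel)"
      by (rule nn_integral_add) measurable
    finally show ?thesis .
  qed
  also have "(\<integral>\<^sup>+x. \<integral>\<^sup>+y. indicator B y * ?k x y \<partial>lborel \<partial>lborel)
      = (\<integral>\<^sup>+y. \<integral>\<^sup>+x. indicator B y * ?k x y \<partial>lborel \<partial>lborel)"
    by (rule lborel_pair.Fubini') measurable
  also have "\<dots> = (\<integral>\<^sup>+x. \<integral>\<^sup>+y. indicator B x * ?k x y \<partial>lborel \<partial>lborel)"
    by (simp add: kern_commute[of \<sigma> _ "_ :: 'a"] norm_minus_commute)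
  also have "(\<integral>\<^sup>+x. \<integral>\<^sup>+y. indicator B x * ?k x y \<partial>lborel \<partial>lborel) \<le> (\<integral>\<^sup>+x. indicator B x * ennreal (M powr q * I) \<partial>lborel)"
  proof (rule nn_integral_mono)
    fix x :: 'a
    have "(\<integral>\<^sup>+y. indicator B x * ?k x y \<partial>lborel) = indicator B x * (\<integral>\<^sup>+y. ?k x y \<partial>lborel)"
      by (rule nn_integral_cmult) measurable
    then show "(\<integral>\<^sup>+y. indicator B x * ?k x y \<partial>lborel) \<le> indicator B x * ennreal (M powr q * I)"
      using inner by (simp add: mult_left_mono)
  qed
  also have "\<dots> = emeasure lborel B * ennreal (M powr q * I)"
    by (subst nn_integral_multc) auto
  finally have "energy \<sigma> q \<eta> \<le> emeasure lborel B * ennreal (M powr q * I) + emeasure lborel B * ennreal (M powr q * I)"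
    by (meson add_mono order_trans order_refl)
  also have "\<dots> < \<infinity>"
    using emeasure_lborel_ball_finite[of "0::'a" R] by (simp add: ennreal_mult_less_top B_def)
  finally show ?thesis .
qed

section \<open>The Sobolev inequality and boundedness\<close>

text \<open>The constant of \<open>kern_mass_off_small_set\<close> after expressing \<open>r\<close> through the bound \<open>m\<close> on the
  measure of the set.\<close>

definition mass_const :: "'a::euclidean_space itself \<Rightarrow> real \<Rightarrow> real" where
  "mass_const _ \<sigma> = unit_ball_vol (real DIM('a)) / 2 * (2 / unit_ball_vol (real DIM('a))) powr (- \<sigma> / real DIM('a))"

lemma mass_const_pos: "0 < mass_const TYPE('a::euclidean_space) \<sigma>"
proof -
  have "0 < w / 2 * (2 / w) powr e" if "0 < w" for w e :: real using that by simp
  then show ?thesis unfolding mass_const_def using unit_vol_pos[where 'a='a] by blast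
qed

lemma kern_mass_off:
  fixes x :: "'a::euclidean_space" and \<sigma> :: real
  assumes \<sigma>: "0 < \<sigma>" and m: "0 < m" and [measurable]: "Q \<in> sets borel"
    and Q: "emeasure lborel Q \<le> ennreal m"
  shows "ennreal (mass_const TYPE('a) \<sigma> * m powr (- \<sigma> / DIM('a)))
    \<le> (\<integral>\<^sup>+y. indicator (- Q) y * ennreal (kern \<sigma> (x - y)) \<partial>lborel)"
proof -
  let ?w = "unit_ball_vol (real DIM('a))" let ?N = "real DIM('a)"
  have w: "0 < ?w" by (rule unit_vol_pos)
  then have w0: "?w \<noteq> 0" by linarith
  define r where "r = (2 / ?w * m) powr (1 / ?N)"
  have r: "0 < r" using w0 m by (simp add: r_def)
  have "r ^ DIM('a) = r powr ?N" using r by (simp add: powr_realpow)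
  also have "\<dots> = 2 / ?w * m" using w m by (simp add: r_def powr_powr w0)
  finally have rN: "?w * r ^ DIM('a) / 2 = m" using w0 by (simp add: field_simps)
  have "r powr - \<sigma> = (2 / ?w * m) powr (- \<sigma> / ?N)" by (simp add: r_def powr_powr)
  also have "\<dots> = (2 / ?w) powr (- \<sigma> / ?N) * m powr (- \<sigma> / ?N)" by (rule powr_mult)
  finally have "?w / 2 * r powr - \<sigma> = mass_const TYPE('a) \<sigma> * m powr (- \<sigma> / ?N)"
    by (simp add: mass_const_def)
  then show ?thesis using kern_mass_off_small_set[OF \<sigma> r, of Q x] Q rN by simp
qed

lemma chebyshev_powr:
  assumes [measurable]: "u \<in> borel_measurable lborel" and t: "0 < t" and q: "0 \<le> q"
    and X: "(\<integral>\<^sup>+y. indicator {y. t < u y} y * ennreal (u y powr q) \<partial>lborel) \<le> ennreal X"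
  shows "emeasure lborel {y. t < u y} \<le> ennreal (X * t powr - q)"
proof -
  have "emeasure lborel {y. t < u y} = (\<integral>\<^sup>+y. indicator {y. t < u y} y \<partial>lborel)" by simp
  also have "\<dots> \<le> (\<integral>\<^sup>+y. ennreal (t powr - q) * (indicator {y. t < u y} y * ennreal (u y powr q)) \<partial>lborel)"
  proof (rule nn_integral_mono)
    fix y
    have "1 \<le> t powr - q * u y powr q" if "t < u y"
    proof -
      have "1 = t powr - q * t powr q" using t by (simp add: powr_add[symmetric])
      also have "\<dots> \<le> t powr - q * u y powr q" using that t q by (intro mult_left_mono powr_mono2) auto
      finally show ?thesis .
    qed
    then show "indicator {y. t < u y} y \<le> ennreal (t powr - q) * (indicator {y. t < u y} y * ennreal (u y powr q))"
      by (auto simp: indicator_def ennreal_mult[symmetric] simp del: ennreal_1 simp flip: ennreal_1 intro!: ennreal_leI)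
  qed
  also have "\<dots> = ennreal (t powr - q) * (\<integral>\<^sup>+y. indicator {y. t < u y} y * ennreal (u y powr q) \<partial>lborel)"
    by (rule nn_integral_cmult) measurable
  also have "\<dots> \<le> ennreal (t powr - q) * ennreal X" by (rule mult_left_mono[OF X]) simp
  also have "\<dots> = ennreal (X * t powr - q)" by (simp add: ennreal_mult'' mult.commute)
  finally show ?thesis .
qed

lemma sobolev_exponent:
  fixes N \<sigma> p :: real
  assumes "0 < N" "\<sigma> < N" "0 < p"
  defines "q \<equiv> N * p / (N - \<sigma>)"
  shows "q * \<sigma> / N = q - p"
  using assms by (simp add: field_simps)

text \<open>A direct form of the fractional Sobolev inequality. Where the truncation \<open>v\<close> has value
  \<open>v(x)\<close>, half of that height is lost on the set \<open>{v \<le> v(x)/2}\<close>, whose complement has by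
  Chebyshev measure at most \<open>2\<^sup>q X v(x)\<^sup>-\<^sup>q\<close> with \<open>X = \<integral> v\<^sup>q\<close>. So the inner integral of the energy
  is at least \<open>c X\<^sup>-\<^sup>\<sigma>\<^sup>/\<^sup>N v(x)\<^sup>q\<close>; integrating, the energy controls \<open>c X\<^sup>1\<^sup>-\<^sup>\<sigma>\<^sup>/\<^sup>N\<close>.\<close>

lemma sobolev_truncated:
  fixes v :: "'a::euclidean_space \<Rightarrow> real" and \<sigma> p :: real
  assumes \<sigma>: "0 < \<sigma>" "\<sigma> < DIM('a)" and p: "1 < p"
    and [measurable]: "v \<in> borel_measurable borel" and nn: "\<And>x. 0 \<le> v x"
  defines "q \<equiv> real DIM('a) * p / (DIM('a) - \<sigma>)"
  assumes X: "(\<integral>\<^sup>+x. ennreal (v x powr q) \<partial>lborel) = ennreal X" "0 < X"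
  shows "ennreal ((1/2) powr p * mass_const TYPE('a) \<sigma> * (2 powr q) powr (- \<sigma> / DIM('a)) * X powr (1 - \<sigma> / DIM('a)))
    \<le> energy \<sigma> p v"
proof -
  let ?N = "real DIM('a)"
  define c where "c = (1/2) powr p * mass_const TYPE('a) \<sigma> * (2 powr q) powr (- \<sigma> / ?N) * X powr (- \<sigma> / ?N)"
  have q0: "0 < q" using \<sigma> p by (simp add: q_def)
  have qs: "q * \<sigma> / ?N = q - p" unfolding q_def by (rule sobolev_exponent) (use \<sigma> p in auto)
  have c0: "0 \<le> c" unfolding c_def using mass_const_pos[where 'a='a, of \<sigma>] by simp
  have inner: "ennreal (c * v x powr q) \<le> (\<integral>\<^sup>+y. ennreal (\<bar>v x - v y\<bar> powr p * kern \<sigma> (x - y)) \<partial>lborel)" for x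
  proof (cases "v x = 0")
    case True then show ?thesis using q0 by simp
  next
    case False
    then have vx: "0 < v x" using nn[of x] by simp
    define Q where "Q = {y. v x / 2 < v y}"
    have [measurable]: "Q \<in> sets borel" unfolding Q_def by measurable
    define m where "m = X * (v x / 2) powr - q"
    have m: "0 < m" using X(2) vx by (simp add: m_def)
    have "(\<integral>\<^sup>+y. indicator Q y * ennreal (v y powr q) \<partial>lborel) \<le> ennreal X"
      unfolding X(1)[symmetric] by (intro nn_integral_mono) (simp add: indicator_def)
    then have "emeasure lborel Q \<le> ennreal m"
      unfolding m_def Q_def using vx q0 by (intro chebyshev_powr) auto
    from kern_mass_off[OF \<sigma>(1) m _ this, of x]
    have mass: "ennreal (mass_const TYPE('a) \<sigma> * m powr (- \<sigma> / ?N))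
        \<le> (\<integral>\<^sup>+y. indicator (- Q) y * ennreal (kern \<sigma> (x - y)) \<partial>lborel)" by simp
    have "m = X * (2 powr q * v x powr - q)"
      unfolding m_def using vx by (simp add: powr_divide powr_minus field_simps)
    then have "m powr (- \<sigma> / ?N) = X powr (- \<sigma> / ?N) * ((2 powr q) powr (- \<sigma> / ?N) * (v x powr - q) powr (- \<sigma> / ?N))"
      using X(2) vx by (simp only: powr_mult powr_ge_zero mult_nonneg_nonneg less_imp_le)
    moreover have "(v x powr - q) powr (- \<sigma> / ?N) = v x powr (q - p)"
      using qs by (simp add: powr_powr)
    ultimately have mp: "m powr (- \<sigma> / ?N) = X powr (- \<sigma> / ?N) * ((2 powr q) powr (- \<sigma> / ?N) * v x powr (q - p))"
      by simp
    have "v x powr q = v x powr p * v x powr (q - p)" using vx by (simp add: powr_add[symmetric])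
    then have "c * v x powr q = (v x / 2) powr p * (mass_const TYPE('a) \<sigma> * m powr (- \<sigma> / ?N))"
      unfolding mp c_def using vx by (simp add: powr_divide field_simps)
    then have "ennreal (c * v x powr q) = ennreal ((v x / 2) powr p) * ennreal (mass_const TYPE('a) \<sigma> * m powr (- \<sigma> / ?N))"
      using mass_const_pos[where 'a='a, of \<sigma>] by (simp add: ennreal_mult)
    also have "\<dots> \<le> ennreal ((v x / 2) powr p) * (\<integral>\<^sup>+y. indicator (- Q) y * ennreal (kern \<sigma> (x - y)) \<partial>lborel)"
      by (rule mult_left_mono[OF mass]) simp
    also have "\<dots> = (\<integral>\<^sup>+y. ennreal ((v x / 2) powr p) * (indicator (- Q) y * ennreal (kern \<sigma> (x - y))) \<partial>lborel)"
      by (rule nn_integral_cmult[symmetric]) measurable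
    also have "\<dots> \<le> (\<integral>\<^sup>+y. ennreal (\<bar>v x - v y\<bar> powr p * kern \<sigma> (x - y)) \<partial>lborel)"
    proof (rule nn_integral_mono)
      fix y
      show "ennreal ((v x / 2) powr p) * (indicator (- Q) y * ennreal (kern \<sigma> (x - y)))
          \<le> ennreal (\<bar>v x - v y\<bar> powr p * kern \<sigma> (x - y))"
      proof (cases "y \<in> Q")
        case False
        then have "v x / 2 \<le> \<bar>v x - v y\<bar>" using vx by (simp add: Q_def)
        then have "(v x / 2) powr p * kern \<sigma> (x - y) \<le> \<bar>v x - v y\<bar> powr p * kern \<sigma> (x - y)"
          using vx p by (intro mult_right_mono powr_mono2) auto
        then show ?thesis using False by (simp add: ennreal_mult[symmetric] ennreal_leI)
      qed simp
    qed
    finally show ?thesis .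
  qed
  have "ennreal ((1/2) powr p * mass_const TYPE('a) \<sigma> * (2 powr q) powr (- \<sigma> / ?N) * X powr (1 - \<sigma> / ?N))
      = ennreal (c * X)"
  proof -
    have "X powr (1 - \<sigma> / ?N) = X powr (- \<sigma> / ?N) * X" using X(2) powr_add[of X "- \<sigma> / ?N" 1] by simp
    then show ?thesis by (simp add: c_def mult_ac)
  qed
  also have "\<dots> = (\<integral>\<^sup>+x. ennreal (c * v x powr q) \<partial>lborel)"
    using c0 X by (simp add: ennreal_mult nn_integral_cmult)
  also have "\<dots> \<le> (\<integral>\<^sup>+x. \<integral>\<^sup>+y. ennreal (\<bar>v x - v y\<bar> powr p * kern \<sigma> (x - y)) \<partial>lborel \<partial>lborel)"
    by (rule nn_integral_mono) (rule inner)
  also have "\<dots> = energy \<sigma> p v" by (rule energy_iterated[symmetric]) measurable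
  finally show ?thesis .
qed

lemma sobolev:
  fixes u :: "'a::euclidean_space \<Rightarrow> real" and \<sigma> p :: real
  assumes \<sigma>: "0 < \<sigma>" "\<sigma> < DIM('a)" and p: "1 < p"
    and [measurable]: "u \<in> borel_measurable borel" and nn: "\<And>x. 0 \<le> u x"
    and supp: "\<And>x. x \<notin> ball 0 R \<Longrightarrow> u x = 0"
    and fin: "energy \<sigma> p u < \<infinity>"
  shows "(\<integral>\<^sup>+x. ennreal (u x powr (real DIM('a) * p / (DIM('a) - \<sigma>))) \<partial>lborel) < \<infinity>"
proof -
  let ?N = "real DIM('a)"
  define q where "q = ?N * p / (?N - \<sigma>)"
  have q0: "0 < q" using \<sigma> p by (simp add: q_def)
  define v where "v = (\<lambda>n::nat. \<lambda>x. min (u x) (real n))"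
  have [measurable]: "v n \<in> borel_measurable borel" for n unfolding v_def by measurable
  define B where "B = ball (0::'a) R"
  have [measurable]: "B \<in> sets borel" by (simp add: B_def)
  define c where "c = (1/2) powr p * mass_const TYPE('a) \<sigma> * (2 powr q) powr (- \<sigma> / ?N)"
  have c: "0 < c" unfolding c_def using mass_const_pos[where 'a='a, of \<sigma>] by simp
  define E where "E = enn2real (energy \<sigma> p u)"
  have E: "energy \<sigma> p u = ennreal E" "0 \<le> E" using fin by (auto simp: E_def)
  define b where "b = (E / c) powr (1 / (1 - \<sigma> / ?N))"
  have bound: "(\<integral>\<^sup>+x. ennreal (v n x powr q) \<partial>lborel) \<le> ennreal b" for n
  proof -
    have "(\<integral>\<^sup>+x. ennreal (v n x powr q) \<partial>lborel) \<le> (\<integral>\<^sup>+x. ennreal (real n powr q) * indicator B x \<partial>lborel)"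
    proof (rule nn_integral_mono)
      fix x
      show "ennreal (v n x powr q) \<le> ennreal (real n powr q) * indicator B x"
      proof (cases "x \<in> B")
        case True
        then show ?thesis using q0 nn[of x] by (auto simp: v_def intro!: ennreal_leI powr_mono2)
      next
        case False
        then have "u x = 0" using supp by (auto simp: B_def)
        then show ?thesis using q0 by (simp add: v_def)
      qed
    qed
    also have "\<dots> = ennreal (real n powr q) * emeasure lborel B"
      by (rule nn_integral_cmult_indicator) simp
    also have "\<dots> < \<infinity>" using emeasure_lborel_ball_finite[of "0::'a" R] by (simp add: B_def ennreal_mult_less_top)
    finally obtain X where X: "(\<integral>\<^sup>+x. ennreal (v n x powr q) \<partial>lborel) = ennreal X" "0 \<le> X"
      by (cases "(\<integral>\<^sup>+x. ennreal (v n x powr q) \<partial>lborel)") auto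
    have "X \<le> b"
    proof (cases "X = 0")
      case True then show ?thesis by (simp add: b_def)
    next
      case False
      then have Xp: "0 < X" using X by simp
      have "ennreal (c * X powr (1 - \<sigma> / ?N)) \<le> energy \<sigma> p (v n)"
        unfolding c_def q_def using \<sigma> p nn X(1) Xp
        by (intro sobolev_truncated) (auto simp: v_def q_def)
      also have "\<dots> \<le> energy \<sigma> p u"
        using p by (intro energy_mono) (auto simp: v_def)
      finally have "c * X powr (1 - \<sigma> / ?N) \<le> E" using E by (simp add: ennreal_le_iff)
      then have le: "X powr (1 - \<sigma> / ?N) \<le> E / c" using c by (simp add: field_simps)
      have pos: "0 < 1 - \<sigma> / ?N" using \<sigma> by simp
      have "X = (X powr (1 - \<sigma> / ?N)) powr (1 / (1 - \<sigma> / ?N))"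
        using pos Xp by (simp only: powr_powr) simp
      also have "\<dots> \<le> b" unfolding b_def using le pos by (intro powr_mono2) auto
      finally show ?thesis .
    qed
    then show ?thesis unfolding X(1) by (rule ennreal_leI)
  qed
  have "(\<integral>\<^sup>+x. ennreal (u x powr q) \<partial>lborel) = (\<integral>\<^sup>+x. liminf (\<lambda>n. ennreal (v n x powr q)) \<partial>lborel)"
  proof (rule nn_integral_cong)
    fix x
    obtain n0 where n0: "u x \<le> real n0" using real_arch_simple by blast
    have "eventually (\<lambda>n. ennreal (v n x powr q) = ennreal (u x powr q)) sequentially"
      unfolding eventually_sequentially using n0 by (intro exI[of _ n0]) (auto simp: v_def min_def)
    then have "(\<lambda>n. ennreal (v n x powr q)) \<longlonglongrightarrow> ennreal (u x powr q)"
      by (rule tendsto_eventually)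
    then show "ennreal (u x powr q) = liminf (\<lambda>n. ennreal (v n x powr q))"
      by (rule lim_imp_Liminf[OF trivial_limit_sequentially, symmetric])
  qed
  also have "\<dots> \<le> liminf (\<lambda>n. \<integral>\<^sup>+x. ennreal (v n x powr q) \<partial>lborel)"
    by (rule nn_integral_liminf) measurable
  also have "\<dots> \<le> ennreal b"
    by (rule order_trans[OF Liminf_le[OF trivial_limit_sequentially] ]) (auto intro: always_eventually bound)
  also have "\<dots> < \<infinity>" by simp
  finally show ?thesis by (simp add: q_def)
qed

text \<open>Test with \<open>(u - T)\<^sup>+\<close>. Passing from \<open>u\<close> to \<open>u/2\<close> at least halves this function, so the same
  loss of height as in the Sobolev inequality bounds the form from below by
  \<open>D \<integral> u\<^sup>q\<^sup>-\<^sup>1 (u - T)\<^sup>+\<close>; as \<open>t\<^sup>q |{u > t}| \<rightarrow> 0\<close>, \<open>D\<close> is as large as desired once \<open>T\<close> is large.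
  Then it exceeds the critical right-hand side unless \<open>(u - T)\<^sup>+ = 0\<close>. No iteration is involved.\<close>

lemma bounded_of_critical_growth:
  fixes u :: "'a::euclidean_space \<Rightarrow> real" and \<sigma> p C :: real
  defines "q \<equiv> real DIM('a) * p / (DIM('a) - \<sigma>)"
  assumes \<sigma>: "0 < \<sigma>" "\<sigma> < DIM('a)" and p: "1 < p" "p < 2"
    and [measurable]: "u \<in> borel_measurable borel" and nn: "\<And>x. 0 \<le> u x"
    and uq: "(\<integral>\<^sup>+x. ennreal (u x powr q) \<partial>lborel) < \<infinity>"
    and fin: "energy \<sigma> p u < \<infinity>"
    and growth: "\<And>t. \<bar>f t\<bar> \<le> C * (1 + \<bar>t\<bar> powr (q - 1))"
    and test: "\<And>T. 1 \<le> T \<Longrightarrow> integrable lborel (\<lambda>x. f (u x) * max (u x - T) 0)"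
      "\<And>T. 1 \<le> T \<Longrightarrow> (\<integral>z. form_integrand \<sigma> p u (\<lambda>x. max (u x - T) 0) z \<partial>lborel2)
        = (\<integral>x. f (u x) * max (u x - T) 0 \<partial>lborel)"
  obtains T where "1 \<le> T" "AE x in lborel. u x \<le> T"
proof -
  let ?N = "real DIM('a)"
  let ?\<kappa> = "mass_const TYPE('a) \<sigma>"
  have \<kappa>: "0 < ?\<kappa>" by (rule mass_const_pos)
  have qp: "p < q" using \<sigma> p by (simp add: q_def field_simps)
  have q1: "1 < q" using qp p by simp
  have qs: "q * \<sigma> / ?N = q - p" unfolding q_def by (rule sobolev_exponent) (use \<sigma> p in auto)
  have C0: "0 \<le> C" using growth[of 0] q1 by simp
  \<comment> \<open>With this \<open>\<epsilon>\<close> as a bound for \<open>t\<^sup>q |{u > t}|\<close>, the lower bound for the form has the constant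
    \<open>2 C + 1\<close>, which beats the constant \<open>2 C\<close> of the right-hand side.\<close>
  define \<epsilon> where "\<epsilon> = ((2 * C + 1) * 2 powr p / ?\<kappa>) powr (- ?N / \<sigma>) / 2 powr q"
  have \<epsilon>: "0 < \<epsilon>" using C0 \<kappa> by (auto simp: \<epsilon>_def intro!: divide_pos_pos)
  have \<epsilon>D: "?\<kappa> * (2 powr q * \<epsilon>) powr (- \<sigma> / ?N) = (2 * C + 1) * 2 powr p"
  proof -
    have "2 powr q * \<epsilon> = ((2 * C + 1) * 2 powr p / ?\<kappa>) powr (- ?N / \<sigma>)" by (simp add: \<epsilon>_def)
    then have "(2 powr q * \<epsilon>) powr (- \<sigma> / ?N) = (2 * C + 1) * 2 powr p / ?\<kappa>"
      using \<sigma> C0 \<kappa> by (simp add: powr_powr)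
    then show ?thesis using \<kappa> by simp
  qed
  have "(\<lambda>n::nat. \<integral>\<^sup>+x. indicator {x. real n < u x} x * ennreal (u x powr q) \<partial>lborel) \<longlonglongrightarrow> (\<integral>\<^sup>+x. 0 \<partial>(lborel :: 'a measure))"
  proof (rule nn_integral_dominated_convergence)
    show "AE x in lborel. (\<lambda>n::nat. indicator {x. real n < u x} x * ennreal (u x powr q)) \<longlonglongrightarrow> 0"
    proof (rule AE_I2)
      fix x
      obtain n0 where n0: "u x \<le> real n0" using real_arch_simple by blast
      have "eventually (\<lambda>n::nat. indicator {x. real n < u x} x * ennreal (u x powr q) = 0) sequentially"
        unfolding eventually_sequentially using n0 by (intro exI[of _ n0]) (auto simp: indicator_def)
      then show "(\<lambda>n::nat. indicator {x. real n < u x} x * ennreal (u x powr q)) \<longlonglongrightarrow> 0"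
        by (rule tendsto_eventually)
    qed
  qed (use uq in \<open>auto simp: indicator_def\<close>)
  then have "eventually (\<lambda>n::nat. (\<integral>\<^sup>+x. indicator {x. real n < u x} x * ennreal (u x powr q) \<partial>lborel) < ennreal \<epsilon>) sequentially"
    using \<epsilon> by (intro order_tendstoD(2)) auto
  then obtain n :: nat where n: "(\<integral>\<^sup>+x. indicator {x. real n < u x} x * ennreal (u x powr q) \<partial>lborel) < ennreal \<epsilon>"
    unfolding eventually_sequentially by blast
  \<comment> \<open>Levels above \<open>T\<close> stay above \<open>n\<close> when halved.\<close>
  define T where "T = 2 * real n + 1"
  have T1: "1 \<le> T" by (simp add: T_def)
  define \<phi> where "\<phi> = (\<lambda>x. max (u x - T) 0)"
  have [measurable]: "\<phi> \<in> borel_measurable borel" unfolding \<phi>_def by measurable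
  have \<phi>0: "0 \<le> \<phi> x" for x by (simp add: \<phi>_def)
  have form0: "0 \<le> form_integrand \<sigma> p u \<phi> z" for z
  proof -
    have "0 \<le> spow p (u (fst z) - u (snd z)) * (\<phi> (fst z) - \<phi> (snd z))"
      by (cases "u (fst z) \<ge> u (snd z)")
        (auto simp: spow_def \<phi>_def intro!: mult_nonneg_nonneg mult_nonpos_nonpos mult_nonneg_nonpos)
    then show ?thesis by (simp add: form_integrand_def)
  qed
  define Y where "Y = (\<integral>\<^sup>+x. ennreal (u x powr (q - 1) * \<phi> x) \<partial>lborel)"
  have "Y \<le> (\<integral>\<^sup>+x. ennreal (u x powr q) \<partial>lborel)"
    unfolding Y_def
  proof (intro nn_integral_mono ennreal_leI)
    fix x
    have "u x powr (q - 1) * \<phi> x \<le> u x powr (q - 1) * u x"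
      using nn[of x] T1 by (intro mult_left_mono) (auto simp: \<phi>_def)
    also have "\<dots> = u x powr q" using nn[of x] by (cases "u x = 0") (auto simp: powr_mult_base mult.commute)
    finally show "u x powr (q - 1) * \<phi> x \<le> u x powr q" .
  qed
  then have Yfin: "Y < \<infinity>" using uq by (auto intro: le_less_trans)
  have inner: "ennreal ((2 * C + 1) * (u x powr (q - 1) * \<phi> x)) \<le> (\<integral>\<^sup>+y. ennreal (form_integrand \<sigma> p u \<phi> (x, y)) \<partial>lborel)" for x
  proof (cases "T < u x")
    case False then show ?thesis by (simp add: \<phi>_def)
  next
    case True
    then have ux: "0 < u x" using T1 by simp
    define Q where "Q = {y. u x / 2 < u y}"
    have [measurable]: "Q \<in> sets borel" unfolding Q_def by measurable
    define m where "m = \<epsilon> * (u x / 2) powr - q"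
    have m: "0 < m" using \<epsilon> ux by (simp add: m_def)
    have "(\<integral>\<^sup>+y. indicator Q y * ennreal (u y powr q) \<partial>lborel)
        \<le> (\<integral>\<^sup>+y. indicator {y. real n < u y} y * ennreal (u y powr q) \<partial>lborel)"
      using True by (intro nn_integral_mono) (auto simp: indicator_def Q_def T_def)
    then have "(\<integral>\<^sup>+y. indicator Q y * ennreal (u y powr q) \<partial>lborel) \<le> ennreal \<epsilon>" using n by simp
    then have "emeasure lborel Q \<le> ennreal m"
      unfolding m_def Q_def using ux q1 by (intro chebyshev_powr) auto
    from kern_mass_off[OF \<sigma>(1) m _ this, of x]
    have mass: "ennreal (?\<kappa> * m powr (- \<sigma> / ?N))
        \<le> (\<integral>\<^sup>+y. indicator (- Q) y * ennreal (kern \<sigma> (x - y)) \<partial>lborel)" by simp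
    have "m = (2 powr q * \<epsilon>) * u x powr - q"
      unfolding m_def using ux by (simp add: powr_divide powr_minus field_simps)
    then have "m powr (- \<sigma> / ?N) = (2 powr q * \<epsilon>) powr (- \<sigma> / ?N) * (u x powr - q) powr (- \<sigma> / ?N)"
      using \<epsilon> ux by (simp only: powr_mult powr_ge_zero mult_nonneg_nonneg less_imp_le)
    moreover have "(u x powr - q) powr (- \<sigma> / ?N) = u x powr (q - p)"
      using qs by (simp add: powr_powr)
    ultimately have "?\<kappa> * m powr (- \<sigma> / ?N) = ?\<kappa> * (2 powr q * \<epsilon>) powr (- \<sigma> / ?N) * u x powr (q - p)"
      by simp
    then have mp: "?\<kappa> * m powr (- \<sigma> / ?N) = (2 * C + 1) * 2 powr p * u x powr (q - p)"
      unfolding \<epsilon>D .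
    have "u x powr (q - 1) = u x powr (p - 1) * u x powr (q - p)" using ux by (simp add: powr_add[symmetric])
    moreover have "(u x / 2) powr (p - 1) * 2 powr p = 2 * u x powr (p - 1)"
      using ux by (simp add: powr_divide powr_diff field_simps)
    moreover have "((u x / 2) powr (p - 1) * (\<phi> x / 2)) * (?\<kappa> * m powr (- \<sigma> / ?N))
        = ((u x / 2) powr (p - 1) * 2 powr p) * u x powr (q - p) * ((2 * C + 1) * (\<phi> x / 2))"
      unfolding mp by simp
    ultimately have "(2 * C + 1) * (u x powr (q - 1) * \<phi> x)
        = ((u x / 2) powr (p - 1) * (\<phi> x / 2)) * (?\<kappa> * m powr (- \<sigma> / ?N))"
      by (simp only:) (simp add: algebra_simps)
    then have "ennreal ((2 * C + 1) * (u x powr (q - 1) * \<phi> x))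
        = ennreal ((u x / 2) powr (p - 1) * (\<phi> x / 2)) * ennreal (?\<kappa> * m powr (- \<sigma> / ?N))"
      using \<phi>0[of x] \<kappa> by (simp only:) (intro ennreal_mult mult_nonneg_nonneg; simp)
    also have "\<dots> \<le> ennreal ((u x / 2) powr (p - 1) * (\<phi> x / 2)) * (\<integral>\<^sup>+y. indicator (- Q) y * ennreal (kern \<sigma> (x - y)) \<partial>lborel)"
      by (rule mult_left_mono[OF mass]) simp
    also have "\<dots> = (\<integral>\<^sup>+y. ennreal ((u x / 2) powr (p - 1) * (\<phi> x / 2)) * (indicator (- Q) y * ennreal (kern \<sigma> (x - y))) \<partial>lborel)"
      by (rule nn_integral_cmult[symmetric]) measurable
    also have "\<dots> \<le> (\<integral>\<^sup>+y. ennreal (form_integrand \<sigma> p u \<phi> (x, y)) \<partial>lborel)"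
    proof (rule nn_integral_mono)
      fix y
      show "ennreal ((u x / 2) powr (p - 1) * (\<phi> x / 2)) * (indicator (- Q) y * ennreal (kern \<sigma> (x - y)))
          \<le> ennreal (form_integrand \<sigma> p u \<phi> (x, y))"
      proof (cases "y \<in> Q")
        case False
        then have y: "u y \<le> u x / 2" by (simp add: Q_def)
        then have "(u x / 2) powr (p - 1) \<le> spow p (u x - u y)"
          using ux p by (subst spow_pos) (auto intro!: powr_mono2)
        moreover have "\<phi> x / 2 \<le> \<phi> x - \<phi> y" using y True T1 by (simp add: \<phi>_def max_def)
        ultimately have "(u x / 2) powr (p - 1) * (\<phi> x / 2) \<le> spow p (u x - u y) * (\<phi> x - \<phi> y)"
          using \<phi>0[of x] by (intro mult_mono) (auto intro: order_trans[OF powr_ge_zero])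
        then have "(u x / 2) powr (p - 1) * (\<phi> x / 2) * kern \<sigma> (x - y) \<le> form_integrand \<sigma> p u \<phi> (x, y)"
          unfolding form_integrand_def fst_conv snd_conv by (rule mult_right_mono) simp
        then show ?thesis using False \<phi>0[of x] by (simp add: ennreal_mult[symmetric] ennreal_leI)
      qed simp
    qed
    finally show ?thesis .
  qed
  have en\<phi>: "energy \<sigma> p \<phi> < \<infinity>"
    by (rule le_less_trans[OF energy_mono fin]) (use p in \<open>auto simp: \<phi>_def\<close>)
  have "ennreal (2 * C + 1) * Y = (\<integral>\<^sup>+x. ennreal ((2 * C + 1) * (u x powr (q - 1) * \<phi> x)) \<partial>lborel)"
    unfolding Y_def using C0 \<phi>0 by (simp add: ennreal_mult' nn_integral_cmult)
  also have "\<dots> \<le> (\<integral>\<^sup>+x. \<integral>\<^sup>+y. ennreal (form_integrand \<sigma> p u \<phi> (x, y)) \<partial>lborel \<partial>lborel)"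
    by (rule nn_integral_mono) (rule inner)
  also have "\<dots> = (\<integral>\<^sup>+z. ennreal (form_integrand \<sigma> p u \<phi> z) \<partial>lborel2)"
    by (rule lborel.nn_integral_fst) measurable
  also have "\<dots> = ennreal (\<integral>z. form_integrand \<sigma> p u \<phi> z \<partial>lborel2)"
    using form0 p fin en\<phi> by (intro nn_integral_eq_integral form_integrable) auto
  also have "\<dots> = ennreal (\<integral>x. f (u x) * \<phi> x \<partial>lborel)"
    using test(2)[OF T1] by (simp add: \<phi>_def)
  also have "\<dots> \<le> (\<integral>\<^sup>+x. ennreal (norm (f (u x) * \<phi> x)) \<partial>lborel)"
    using integral_norm_bound_ennreal[OF test(1)[OF T1]] unfolding \<phi>_def
    by (rule order_trans[rotated]) (auto intro!: ennreal_leI)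
  also have "\<dots> \<le> (\<integral>\<^sup>+x. ennreal (2 * C) * ennreal (u x powr (q - 1) * \<phi> x) \<partial>lborel)"
  proof (rule nn_integral_mono)
    fix x
    have "norm (f (u x) * \<phi> x) \<le> 2 * C * (u x powr (q - 1) * \<phi> x)"
    proof (cases "T < u x")
      case True
      then have "1 powr (q - 1) \<le> u x powr (q - 1)" using T1 q1 by (intro powr_mono2) auto
      then have "C * (1 + \<bar>u x\<bar> powr (q - 1)) \<le> C * (2 * u x powr (q - 1))"
        using C0 nn[of x] by (intro mult_left_mono) auto
      then have "\<bar>f (u x)\<bar> \<le> 2 * C * u x powr (q - 1)" using growth[of "u x"] by simp
      then have "\<bar>f (u x)\<bar> * \<phi> x \<le> 2 * C * u x powr (q - 1) * \<phi> x" using \<phi>0 by (rule mult_right_mono)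
      then show ?thesis using \<phi>0[of x] by (simp add: abs_mult mult.assoc)
    qed (simp add: \<phi>_def)
    then show "ennreal (norm (f (u x) * \<phi> x)) \<le> ennreal (2 * C) * ennreal (u x powr (q - 1) * \<phi> x)"
      using C0 \<phi>0[of x] by (subst ennreal_mult[symmetric]) (auto intro!: ennreal_leI)
  qed
  also have "\<dots> = ennreal (2 * C) * Y" unfolding Y_def by (rule nn_integral_cmult) measurable
  finally have main: "ennreal (2 * C + 1) * Y \<le> ennreal (2 * C) * Y" .
  obtain y where y: "Y = ennreal y" "0 \<le> y" using Yfin by (cases Y) auto
  have "(2 * C + 1) * y \<le> 2 * C * y"
  proof -
    have "ennreal ((2 * C + 1) * y) = ennreal (2 * C + 1) * Y" "ennreal (2 * C * y) = ennreal (2 * C) * Y"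
      unfolding y(1) using C0 by (auto intro!: ennreal_mult' simp del: ennreal_plus)
    then have "ennreal ((2 * C + 1) * y) \<le> ennreal (2 * C * y)" using main by (simp only:)
    then show ?thesis using C0 y by (subst (asm) ennreal_le_iff) auto
  qed
  then have "Y = 0" using y by (simp add: algebra_simps)
  then have "AE x in lborel. ennreal (u x powr (q - 1) * \<phi> x) = 0"
    unfolding Y_def by (subst (asm) nn_integral_0_iff_AE) auto
  then have "AE x in lborel. u x \<le> T"
  proof eventually_elim
    case (elim x)
    show ?case
    proof (rule ccontr)
      assume "\<not> u x \<le> T"
      then have "0 < u x powr (q - 1) * \<phi> x" using T1 by (auto simp: \<phi>_def intro!: mult_pos_pos)
      then show False using elim by auto
    qed
  qed
  then show ?thesis using that T1 by blast
qed

section \<open>Symmetrisation over a reflection\<close>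

text \<open>The four images of a pair of points under reflecting either entry. In \<open>quad F S\<close> all signs
  of a reflection argument become pointwise statements about points on one side of the plane.\<close>

definition quad :: "('a \<times> 'a \<Rightarrow> real) \<Rightarrow> ('a \<Rightarrow> 'a) \<Rightarrow> 'a \<times> 'a \<Rightarrow> real" where
  "quad F S z = F z + F (S (fst z), S (snd z)) + F (fst z, S (snd z)) + F (S (fst z), snd z)"

text \<open>The image of a point on the closed half-space; by \<open>quad_fold\<close>, statements about \<open>quad\<close> may be
  checked there.\<close>

definition fold_half :: "'a::euclidean_space \<Rightarrow> real \<Rightarrow> 'a \<Rightarrow> 'a" where
  "fold_half e l x = (if l \<le> x \<bullet> e then x else mirror e l x)"

lemma fold_half_side: "norm e = 1 \<Longrightarrow> l \<le> fold_half e l x \<bullet> e"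
  by (simp add: fold_half_def mirror_inner)

lemma fold_half_cases: "fold_half e l x = x \<or> fold_half e l x = mirror e l x"
  by (simp add: fold_half_def)

lemma quad_fold:
  assumes e: "norm e = 1"
  shows "quad F (mirror e l) (fold_half e l x, fold_half e l y) = quad F (mirror e l) (x, y)"
  using fold_half_cases[of e l x] fold_half_cases[of e l y] by (auto simp: quad_def mirror_mirror[OF e])

lemma lborel_pair_distr_mirror:
  fixes e :: "'a::euclidean_space"
  assumes e: "norm e = 1"
    and S: "S = mirror e l \<or> S = (\<lambda>x. x)" and S': "S' = mirror e l \<or> S' = (\<lambda>x. x)"
  shows "distr lborel2 (borel \<Otimes>\<^sub>M borel) (\<lambda>z. (S (fst z), S' (snd z))) = lborel2"
proof -
  have [measurable]: "S \<in> borel \<rightarrow>\<^sub>M borel" "S' \<in> borel \<rightarrow>\<^sub>M borel" using S S' by auto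
  have "(+) (0::'a) = (\<lambda>x. x)" by auto
  then have "distr lborel borel (\<lambda>x. x) = (lborel :: 'a measure)"
    using lborel_distr_plus[of "0::'a"] by simp
  then show ?thesis
    using lborel_pair_distr[of S S'] S S' lborel_distr_mirror[OF e, of l] by (auto simp: case_prod_beta')
qed

lemma integral_mirror_pair:
  fixes e :: "'a::euclidean_space" and F :: "'a \<times> 'a \<Rightarrow> real"
  assumes e: "norm e = 1" and F[measurable]: "F \<in> borel_measurable lborel2"
    and S: "S = mirror e l \<or> S = (\<lambda>x. x)" and S': "S' = mirror e l \<or> S' = (\<lambda>x. x)"
  shows "integrable lborel2 F \<Longrightarrow> integrable lborel2 (\<lambda>z. F (S (fst z), S' (snd z)))"
    and "(\<integral>z. F (S (fst z), S' (snd z)) \<partial>lborel2) = (\<integral>z. F z \<partial>lborel2)"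
proof -
  have [measurable]: "S \<in> borel \<rightarrow>\<^sub>M borel" "S' \<in> borel \<rightarrow>\<^sub>M borel" using S S' by auto
  note eq = lborel_pair_distr_mirror[OF e S S']
  have F': "F \<in> borel_measurable (borel \<Otimes>\<^sub>M borel)" using F by (simp cong: measurable_cong_sets)
  show "integrable lborel2 (\<lambda>z. F (S (fst z), S' (snd z)))" if "integrable lborel2 F"
    using that by (subst (asm) eq[symmetric], subst (asm) integrable_distr_eq) (auto simp: F')
  show "(\<integral>z. F (S (fst z), S' (snd z)) \<partial>lborel2) = (\<integral>z. F z \<partial>lborel2)"
    by (subst (2) eq[symmetric], subst integral_distr) (auto simp: F')
qed

lemma nn_integral_mirror_pair:
  fixes e :: "'a::euclidean_space"
  assumes e: "norm e = 1" and F[measurable]: "F \<in> borel_measurable lborel2"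
    and S: "S = mirror e l \<or> S = (\<lambda>x. x)" and S': "S' = mirror e l \<or> S' = (\<lambda>x. x)"
  shows "(\<integral>\<^sup>+z. F (S (fst z), S' (snd z)) \<partial>lborel2) = (\<integral>\<^sup>+z. F z \<partial>lborel2)"
proof -
  have [measurable]: "S \<in> borel \<rightarrow>\<^sub>M borel" "S' \<in> borel \<rightarrow>\<^sub>M borel" using S S' by auto
  have F': "F \<in> borel_measurable (borel \<Otimes>\<^sub>M borel)" using F by (simp cong: measurable_cong_sets)
  show ?thesis
    by (subst (2) lborel_pair_distr_mirror[OF e S S', symmetric], subst nn_integral_distr) (auto simp: F')
qed

lemma integral_quad:
  fixes e :: "'a::euclidean_space"
  assumes e: "norm e = 1" and F: "integrable lborel2 F"
  shows "integrable lborel2 (quad F (mirror e l))"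
    and "(\<integral>z. quad F (mirror e l) z \<partial>lborel2) = 4 * (\<integral>z. F z \<partial>lborel2)"
proof -
  let ?S = "mirror e l"
  have [measurable]: "F \<in> borel_measurable lborel2" using F by simp
  note i = integral_mirror_pair(1)[OF e _ _ _ F, of _ l] and j = integral_mirror_pair(2)[OF e, of F _ l]
  have I: "integrable lborel2 (\<lambda>z. F (?S (fst z), ?S (snd z)))"
    "integrable lborel2 (\<lambda>z. F (fst z, ?S (snd z)))"
    "integrable lborel2 (\<lambda>z. F (?S (fst z), snd z))"
    using i[of ?S ?S] i[of "\<lambda>x. x" ?S] i[of ?S "\<lambda>x. x"] by auto
  have J: "(\<integral>z. F (?S (fst z), ?S (snd z)) \<partial>lborel2) = (\<integral>z. F z \<partial>lborel2)"
    "(\<integral>z. F (fst z, ?S (snd z)) \<partial>lborel2) = (\<integral>z. F z \<partial>lborel2)"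
    "(\<integral>z. F (?S (fst z), snd z) \<partial>lborel2) = (\<integral>z. F z \<partial>lborel2)"
    using j[of ?S ?S] j[of "\<lambda>x. x" ?S] j[of ?S "\<lambda>x. x"] by auto
  show "integrable lborel2 (quad F ?S)"
    unfolding quad_def using F I by auto
  show "(\<integral>z. quad F ?S z \<partial>lborel2) = 4 * (\<integral>z. F z \<partial>lborel2)"
    unfolding quad_def using F I J by simp
qed

lemma energy_mirror:
  assumes e: "norm e = 1" and [measurable]: "u \<in> borel_measurable borel"
  shows "energy \<sigma> p (\<lambda>x. u (mirror e l x)) = energy \<sigma> p u"
proof -
  have "kern \<sigma> (mirror e l x - mirror e l y) = kern \<sigma> (x - y)" for x y
    by (rule kern_cong) (rule mirror_diff_mirror[OF e])
  then have "energy \<sigma> p (\<lambda>x. u (mirror e l x)) = (\<integral>\<^sup>+z. (\<lambda>z. ennreal (\<bar>u (fst z) - u (snd z)\<bar> powr p * kern \<sigma> (fst z - snd z)))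
      (mirror e l (fst z), mirror e l (snd z)) \<partial>lborel2)"
    unfolding energy_def by simp
  also have "\<dots> = energy \<sigma> p u"
    unfolding energy_def by (rule nn_integral_mirror_pair[OF e]) auto
  finally show ?thesis .
qed

text \<open>For an antisymmetric \<open>w\<close> the negative part restricted to one side of the plane again has finite
  energy: across the plane it is compared with \<open>w\<close> at \<open>y\<close> or at the mirror image of \<open>y\<close>,
  which is closer.\<close>

lemma energy_half_negative_part:
  fixes e :: "'a::euclidean_space"
  assumes e: "norm e = 1" and \<sigma>: "0 < \<sigma>" and p: "1 < p"
    and [measurable]: "w \<in> borel_measurable borel"
    and anti: "\<And>x. w (mirror e l x) = - w x" and fin: "energy \<sigma> p w < \<infinity>"
  shows "energy \<sigma> p (\<lambda>x. if l < x \<bullet> e then max (- w x) 0 else 0) < \<infinity>"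
proof -
  let ?S = "mirror e l"
  let ?\<phi> = "\<lambda>x. if l < x \<bullet> e then max (- w x) 0 else 0"
  define F where "F = (\<lambda>z. ennreal (\<bar>w (fst z) - w (snd z)\<bar> powr p * kern \<sigma> (fst z - snd z)))"
  have [measurable]: "F \<in> borel_measurable lborel2" unfolding F_def by measurable
  have one: "ennreal (\<bar>?\<phi> x - ?\<phi> y\<bar> powr p * kern \<sigma> (x - y)) \<le> F (x, y) + F (x, ?S y)"
    if "l < x \<bullet> e" "\<not> l < y \<bullet> e" for x y
  proof -
    have k: "kern \<sigma> (x - y) \<le> kern \<sigma> (x - ?S y)" if "x \<noteq> ?S y"
    proof (rule kern_antimono[OF \<sigma>])
      have "(x \<bullet> e - l) * (y \<bullet> e - l) \<le> 0"
        using \<open>l < x \<bullet> e\<close> \<open>\<not> l < y \<bullet> e\<close> by (intro mult_nonneg_nonpos) auto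
      then have "(norm (x - ?S y))\<^sup>2 \<le> (norm (x - y))\<^sup>2" using norm_diff_mirror_sq[OF e, of x l y] by linarith
      then show "norm (x - ?S y) \<le> norm (x - y)" by simp
    qed (use that in simp)
    have d: "\<bar>?\<phi> x - ?\<phi> y\<bar> = max (- w x) 0" using that by simp
    show ?thesis
    proof (cases "max (- w x) 0 \<le> \<bar>w x - w y\<bar>")
      case True
      then have "ennreal (\<bar>?\<phi> x - ?\<phi> y\<bar> powr p * kern \<sigma> (x - y)) \<le> F (x, y)"
        unfolding F_def fst_conv snd_conv d using p by (intro ennreal_leI mult_right_mono powr_mono2) auto
      then show ?thesis by (rule order_trans) simp
    next
      case False
      then have le: "max (- w x) 0 \<le> \<bar>w x - w (?S y)\<bar>" by (simp add: anti)
      have "x \<noteq> ?S y"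
      proof
        assume "x = ?S y"
        then have "w x = - w y" by (simp add: anti)
        then show False using False by simp
      qed
      then have "ennreal (\<bar>?\<phi> x - ?\<phi> y\<bar> powr p * kern \<sigma> (x - y)) \<le> F (x, ?S y)"
        unfolding F_def fst_conv snd_conv d using p k le by (intro ennreal_leI mult_mono powr_mono2) auto
      then show ?thesis by (rule order_trans) simp
    qed
  qed
  have Fsym: "F (x, y) = F (y, x)" for x y
    unfolding F_def by (simp add: kern_commute[of \<sigma> x y] abs_minus_commute)
  have "ennreal (\<bar>?\<phi> x - ?\<phi> y\<bar> powr p * kern \<sigma> (x - y)) \<le> F (x, y) + F (x, ?S y) + F (?S x, y)" for x y
  proof -
    consider "l < x \<bullet> e" "l < y \<bullet> e" | "\<not> l < x \<bullet> e" "\<not> l < y \<bullet> e" | "l < x \<bullet> e" "\<not> l < y \<bullet> e" | "\<not> l < x \<bullet> e" "l < y \<bullet> e"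
      by blast
    then show ?thesis
    proof cases
      case 1
      then have "ennreal (\<bar>?\<phi> x - ?\<phi> y\<bar> powr p * kern \<sigma> (x - y)) \<le> F (x, y)"
        unfolding F_def fst_conv snd_conv using p by (intro ennreal_leI mult_right_mono powr_mono2) auto
      then show ?thesis by (simp add: add_increasing2 add.assoc)
    next
      case 2 then show ?thesis by simp
    next
      case 3 then show ?thesis using one[of x y] by (simp add: add_increasing2)
    next
      case 4
      then have "ennreal (\<bar>?\<phi> y - ?\<phi> x\<bar> powr p * kern \<sigma> (y - x)) \<le> F (y, x) + F (y, ?S x)" by (intro one)
      then have "ennreal (\<bar>?\<phi> x - ?\<phi> y\<bar> powr p * kern \<sigma> (x - y)) \<le> F (x, y) + F (?S x, y)"
        by (simp only: abs_minus_commute kern_commute[of \<sigma> x y] Fsym[of x y] Fsym[of "?S x" y])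
      also have "\<dots> \<le> F (x, y) + F (x, ?S y) + F (?S x, y)" by (intro add_right_mono) simp
      finally show ?thesis .
    qed
  qed
  then have "energy \<sigma> p ?\<phi> \<le> (\<integral>\<^sup>+z. F z + F (fst z, ?S (snd z)) + F (?S (fst z), snd z) \<partial>lborel2)"
    unfolding energy_def by (intro nn_integral_mono) (metis prod.collapse)
  also have "\<dots> = (\<integral>\<^sup>+z. F z \<partial>lborel2) + (\<integral>\<^sup>+z. F (fst z, ?S (snd z)) \<partial>lborel2)
      + (\<integral>\<^sup>+z. F (?S (fst z), snd z) \<partial>lborel2)"
    by (simp add: nn_integral_add)
  also have "\<dots> = energy \<sigma> p w + energy \<sigma> p w + energy \<sigma> p w"
  proof -
    have "(\<integral>\<^sup>+z. F (fst z, ?S (snd z)) \<partial>lborel2) = (\<integral>\<^sup>+z. F z \<partial>lborel2)"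
      "(\<integral>\<^sup>+z. F (?S (fst z), snd z) \<partial>lborel2) = (\<integral>\<^sup>+z. F z \<partial>lborel2)"
      using nn_integral_mirror_pair[OF e, of F "\<lambda>x. x" l ?S] nn_integral_mirror_pair[OF e, of F ?S l "\<lambda>x. x"] by auto
    then show ?thesis by (simp add: energy_def F_def)
  qed
  also have "\<dots> < \<infinity>" using fin by simp
  finally show ?thesis .
qed

lemma kern_strict_antimono:
  fixes z z' :: "'a::euclidean_space"
  assumes "0 < \<sigma>" "z \<noteq> 0" "norm z < norm z'"
  shows "kern \<sigma> z' < kern \<sigma> z"
  unfolding kern_def using assms
  by (intro divide_strict_left_mono powr_less_mono2 mult_pos_pos) (auto simp: add_nonneg_pos)

lemma mirror_farther:
  assumes e: "norm e = 1" and "l \<le> x \<bullet> e" "l \<le> y \<bullet> e"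
  shows "norm (x - y) \<le> norm (x - mirror e l y)"
proof -
  have "0 \<le> (x \<bullet> e - l) * (y \<bullet> e - l)" using assms by simp
  then have "(norm (x - y))\<^sup>2 \<le> (norm (x - mirror e l y))\<^sup>2"
    using norm_diff_mirror_sq[OF e, of x l y] by linarith
  then show ?thesis by simp
qed

lemma kern_mirror_le:
  assumes e: "norm e = 1" and "0 < \<sigma>" "l \<le> x \<bullet> e" "l \<le> y \<bullet> e" "x \<noteq> y"
  shows "kern \<sigma> (x - mirror e l y) \<le> kern \<sigma> (x - y)"
  using assms by (intro kern_antimono mirror_farther) auto

lemma kern_mirror_less:
  assumes e: "norm e = 1" and "0 < \<sigma>" "l < x \<bullet> e" "l < y \<bullet> e" "x \<noteq> y"
  shows "kern \<sigma> (x - mirror e l y) < kern \<sigma> (x - y)"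
proof (rule kern_strict_antimono)
  have "0 < (x \<bullet> e - l) * (y \<bullet> e - l)" using assms by simp
  then have "(norm (x - y))\<^sup>2 < (norm (x - mirror e l y))\<^sup>2"
    using norm_diff_mirror_sq[OF e, of x l y] by linarith
  then show "norm (x - y) < norm (x - mirror e l y)" by (simp add: power_less_imp_less_base)
qed (use assms in auto)

lemma kern_fold_cases:
  assumes e: "norm e = 1"
  shows "kern \<sigma> (x - y) = kern \<sigma> (fold_half e l x - fold_half e l y)
    \<or> kern \<sigma> (x - y) = kern \<sigma> (fold_half e l x - mirror e l (fold_half e l y))"
proof -
  have "kern \<sigma> (mirror e l x - mirror e l y) = kern \<sigma> (x - y)"
    by (rule kern_cong[OF mirror_diff_mirror[OF e]])
  moreover have "kern \<sigma> (mirror e l x - mirror e l (mirror e l y)) = kern \<sigma> (x - mirror e l y)"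
    by (rule kern_cong[OF mirror_diff_mirror[OF e]])
  ultimately show ?thesis using e by (auto simp: fold_half_def)
qed

lemma mirror_on_plane: "x \<bullet> e = l \<Longrightarrow> mirror e l x = x"
  by (simp add: mirror_def)

section \<open>Bounded solutions and their reflections\<close>

text \<open>All functions are Borel and all bounds hold everywhere, which spares almost-everywhere side
  conditions; every solution has a version of this kind (\<open>weak_solution_bounded_representative\<close>).
  Only the Lipschitz constant of the nonlinearity on the range of \<open>u\<close> is recorded.\<close>

locale bounded_solution =
  fixes \<sigma> p R T L :: real and f :: "real \<Rightarrow> real" and u :: "'a::euclidean_space \<Rightarrow> real"
  assumes sigma: "0 < \<sigma>" "\<sigma> < 1" and p: "1 < p" "p < 2" and R: "0 < R" and T: "0 < T" and L: "0 \<le> L"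
    and u_measurable[measurable]: "u \<in> borel_measurable borel"
    and f_measurable[measurable]: "f \<in> borel_measurable borel"
    and u_nonneg: "0 \<le> u x" and u_le: "u x \<le> T" and u_outside: "x \<notin> ball 0 R \<Longrightarrow> u x = 0"
    and u_energy: "energy \<sigma> p u < \<infinity>"
    and f_lipschitz: "\<lbrakk>0 \<le> a; a \<le> T; 0 \<le> b; b \<le> T\<rbrakk> \<Longrightarrow> \<bar>f a - f b\<bar> \<le> L * \<bar>a - b\<bar>"
    and weak: "\<lbrakk>\<phi> \<in> borel_measurable borel; \<And>x. \<bar>\<phi> x\<bar> \<le> M; \<And>x. x \<notin> ball 0 R \<Longrightarrow> \<phi> x = 0; energy \<sigma> p \<phi> < \<infinity>\<rbrakk>
      \<Longrightarrow> (\<integral>z. form_integrand \<sigma> p u \<phi> z \<partial>lborel2) = (\<integral>x. f (u x) * \<phi> x \<partial>lborel)"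
begin

text \<open>The ellipticity constant of the nonlinearity on \<open>[-T, T]\<close>.\<close>

definition c0 :: real where "c0 = (p - 1) * T powr (p - 2)"

lemma c0_pos: "0 < c0" using p T by (simp add: c0_def)

lemma spow_diff_lower:
  assumes "a \<in> {-T..T}" "b \<in> {-T..T}" "a \<le> b"
  shows "c0 * (b - a) \<le> spow p b - spow p a"
  unfolding c0_def using assms p by (intro spow_strongly_mono) auto

lemma u_diff_range: "u x - u y \<in> {-T..T}"
  using u_nonneg[of x] u_nonneg[of y] u_le[of x] u_le[of y] by auto

definition gap :: "'a \<Rightarrow> real \<Rightarrow> 'a \<Rightarrow> real" where
  "gap e l x = u (mirror e l x) - u x"

lemma gap_measurable[measurable]: "gap e l \<in> borel_measurable borel"
  unfolding gap_def by measurable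

lemma gap_mirror: "norm e = 1 \<Longrightarrow> gap e l (mirror e l x) = - gap e l x"
  by (simp add: gap_def)

lemma gap_energy: "norm e = 1 \<Longrightarrow> energy \<sigma> p (gap e l) < \<infinity>"
  by (rule energy_finite_le[OF p(1), where u="\<lambda>x. u (mirror e l x)" and v=u and K=1])
    (auto simp: gap_def energy_mirror u_energy intro: u_energy[unfolded infinity_ennreal_def])

lemma abs_gap_le: "\<bar>gap e l x\<bar> \<le> T"
  using u_diff_range[of "mirror e l x" x] by (auto simp: gap_def)

lemma f_u_bound: "\<bar>f (u x)\<bar> \<le> \<bar>f 0\<bar> + L * T"
proof -
  have "\<bar>f (u x) - f 0\<bar> \<le> L * \<bar>u x - 0\<bar>" using u_nonneg u_le T by (intro f_lipschitz) auto
  also have "\<dots> \<le> L * T" using u_nonneg[of x] u_le[of x] L by (intro mult_left_mono) auto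
  finally show ?thesis by linarith
qed

lemma integrable_bounded_support:
  assumes [measurable]: "g \<in> borel_measurable borel" and "\<And>x. \<bar>g x\<bar> \<le> M" and "\<And>x. x \<notin> ball (0::'a) R \<Longrightarrow> g x = 0"
  shows "integrable lborel (g :: 'a \<Rightarrow> real)"
proof (rule Bochner_Integration.integrable_bound)
  show "integrable lborel (\<lambda>x. M * indicator (ball (0::'a) R) x)"
    by (intro integrable_mult_right integrable_real_indicator) (use R in \<open>auto simp: emeasure_ball_pow\<close>)
  show "AE x in lborel. norm (g x) \<le> norm (M * indicator (ball 0 R) x)"
    using assms(2,3) by (intro AE_I2) (auto simp: indicator_def intro: order_trans[OF _ abs_ge_self])
qed simp

definition pair_test :: "'a \<Rightarrow> real \<Rightarrow> ('a \<Rightarrow> real) \<Rightarrow> 'a \<times> 'a \<Rightarrow> real" where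
  "pair_test e l \<phi> = quad (form_integrand \<sigma> p u (\<lambda>x. \<phi> (mirror e l x) - \<phi> x)) (mirror e l)"

text \<open>The reflected solution solves the same equation in the reflected ball, which contains the cap
  cut off by the plane if \<open>0 \<le> l\<close>. Testing the equation for \<open>u\<close> with \<open>\<phi> \<circ> S - \<phi>\<close> subtracts the
  two equations.\<close>

lemma difference_equation:
  assumes e: "norm e = 1" and l: "0 \<le> l"
    and [measurable]: "\<phi> \<in> borel_measurable borel" and M: "\<And>x. \<bar>\<phi> x\<bar> \<le> M"
    and supp: "\<And>x. \<not> (norm x < R \<and> l < x \<bullet> e) \<Longrightarrow> \<phi> x = 0"
    and fin: "energy \<sigma> p \<phi> < \<infinity>"
  shows "integrable lborel2 (pair_test e l \<phi>)"
    and "(\<integral>z. pair_test e l \<phi> z \<partial>lborel2)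
      = 4 * (\<integral>x. (f (u (mirror e l x)) - f (u x)) * \<phi> x \<partial>lborel)"
    and "integrable lborel (\<lambda>x. (f (u (mirror e l x)) - f (u x)) * \<phi> x)"
proof -
  let ?S = "mirror e l"
  let ?\<psi> = "\<lambda>x. \<phi> (?S x) - \<phi> x"
  have \<psi>fin: "energy \<sigma> p ?\<psi> < \<infinity>"
    by (rule energy_finite_le[OF p(1), where u="\<lambda>x. \<phi> (?S x)" and v=\<phi> and K=1])
      (use fin e in \<open>auto simp: energy_mirror\<close>)
  have \<psi>supp: "?\<psi> x = 0" if "x \<notin> ball 0 R" for x
  proof -
    have "\<not> (norm (?S x) < R \<and> l < ?S x \<bullet> e)"
    proof
      assume a: "norm (?S x) < R \<and> l < ?S x \<bullet> e"
      have "(norm x)\<^sup>2 = (norm (?S x))\<^sup>2 - 4 * l * (?S x \<bullet> e - l)"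
        using norm_mirror_sq[OF e, of l "?S x"] e by simp
      then have "(norm x)\<^sup>2 \<le> (norm (?S x))\<^sup>2" using a l by simp
      then show False using a that by simp
    qed
    then show ?thesis using supp[of x] supp[of "?S x"] that by simp
  qed
  have int: "integrable lborel2 (form_integrand \<sigma> p u ?\<psi>)"
    by (rule form_integrable[OF p(1)]) (use u_energy \<psi>fin in auto)
  show "integrable lborel2 (pair_test e l \<phi>)"
    unfolding pair_test_def by (rule integral_quad(1)[OF e int])
  have suppB: "\<phi> x = 0" if "x \<notin> ball 0 R" for x using supp[of x] that by simp
  have M0: "0 \<le> M" using M[of 0] by linarith
  have F0: "0 \<le> \<bar>f 0\<bar> + L * T" using L T by simp
  have b1: "\<bar>f (u x) * \<phi> y\<bar> \<le> (\<bar>f 0\<bar> + L * T) * M" for x y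
    unfolding abs_mult by (intro mult_mono f_u_bound M) (use F0 in auto)
  have i1: "integrable lborel (\<lambda>x. f (u x) * \<phi> x)" "integrable lborel (\<lambda>x. f (u (?S x)) * \<phi> x)"
    using b1 suppB by (auto intro!: integrable_bounded_support[where M="(\<bar>f 0\<bar> + L * T) * M"])
  then show "integrable lborel (\<lambda>x. (f (u (?S x)) - f (u x)) * \<phi> x)"
    by (simp add: left_diff_distrib)
  have i2: "integrable lborel (\<lambda>x. f (u x) * \<phi> (?S x))"
  proof -
    have "integrable (distr lborel borel ?S) (\<lambda>x. f (u (?S x)) * \<phi> x)"
      using i1(2) by (simp only: lborel_distr_mirror[OF e])
    then show ?thesis by (subst (asm) integrable_distr_eq) (auto simp: e)
  qed
  have eq: "(\<integral>x. f (u x) * \<phi> (?S x) \<partial>lborel) = (\<integral>x. f (u (?S x)) * \<phi> x \<partial>lborel)"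
    using integral_mirror[OF e, of "\<lambda>x. f (u (?S x)) * \<phi> x" l] by (simp add: e)
  have "(\<integral>z. form_integrand \<sigma> p u ?\<psi> z \<partial>lborel2) = (\<integral>x. f (u x) * ?\<psi> x \<partial>lborel)"
  proof (rule weak)
    show "\<bar>?\<psi> x\<bar> \<le> 2 * M" for x using M[of x] M[of "?S x"] by linarith
  qed (use \<psi>supp \<psi>fin in auto)
  also have "\<dots> = (\<integral>x. f (u (?S x)) * \<phi> x \<partial>lborel) - (\<integral>x. f (u x) * \<phi> x \<partial>lborel)"
    using i1 i2 eq by (simp add: right_diff_distrib)
  also have "\<dots> = (\<integral>x. (f (u (?S x)) - f (u x)) * \<phi> x \<partial>lborel)"
    using i1 by (simp add: left_diff_distrib)
  finally show "(\<integral>z. pair_test e l \<phi> z \<partial>lborel2)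
      = 4 * (\<integral>x. (f (u (?S x)) - f (u x)) * \<phi> x \<partial>lborel)"
    unfolding pair_test_def using integral_quad(2)[OF e int, of l] by simp
qed

lemma pair_test_eq:
  assumes e: "norm e = 1" and \<phi>: "\<And>x. \<not> l < x \<bullet> e \<Longrightarrow> \<phi> x = 0"
    and side: "l \<le> x \<bullet> e" "l \<le> y \<bullet> e"
  shows "pair_test e l \<phi> (x, y) =
      (spow p (u (mirror e l x) - u (mirror e l y)) - spow p (u x - u y)) * (\<phi> x - \<phi> y) * kern \<sigma> (x - y)
    + (spow p (u (mirror e l x) - u y) - spow p (u x - u (mirror e l y))) * (\<phi> x + \<phi> y) * kern \<sigma> (x - mirror e l y)"
proof -
  let ?S = "mirror e l"
  have S0: "\<phi> (?S x) = 0" "\<phi> (?S y) = 0" using side by (auto intro!: \<phi> simp: mirror_inner[OF e])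
  have k: "kern \<sigma> (?S x - ?S y) = kern \<sigma> (x - y)" "kern \<sigma> (?S x - y) = kern \<sigma> (x - ?S y)"
    by (rule kern_cong[OF mirror_diff_mirror[OF e]], rule kern_cong[OF norm_diff_mirror[OF e]])
  show ?thesis
    unfolding pair_test_def quad_def form_integrand_def fst_conv snd_conv mirror_mirror[OF e] k S0
    by (simp add: algebra_simps)
qed

section \<open>The maximum principle on sets of small measure\<close>

text \<open>\<open>a, b\<close> and \<open>a', b'\<close> stand for the values of \<open>u\<close> at two points and at their mirror images,
  \<open>K1 \<ge> K2\<close> for the kernel between points on equal and on opposite sides. If both gaps are
  negative, both terms have the favourable sign. If the gaps have opposite signs, lowering \<open>K1\<close> to \<open>K2\<close>
  leaves the sum of the two brackets, and this regroups into differences of \<open>spow p\<close> at arguments that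
  differ by exactly one gap, which strong monotonicity controls.\<close>

lemma reflection_inequality:
  fixes a a' b b' K1 K2 :: real
  assumes r: "a \<in> {0..T}" "a' \<in> {0..T}" "b \<in> {0..T}" "b' \<in> {0..T}" and K: "0 \<le> K2" "K2 \<le> K1"
  defines "\<phi> \<equiv> max (- (a' - a)) 0" and "\<psi> \<equiv> max (- (b' - b)) 0"
  shows "(spow p (a' - b') - spow p (a - b)) * (\<phi> - \<psi>) * K1 + (spow p (a' - b) - spow p (a - b')) * (\<phi> + \<psi>) * K2
    \<le> (if \<psi> = 0 then - c0 * \<phi>\<^sup>2 * (K1 + K2) else 0)"
proof -
  let ?w = "a' - a" and ?z = "b' - b"
  let ?A = "spow p (a' - b') - spow p (a - b)" and ?B = "spow p (a' - b) - spow p (a - b')"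
  note low = spow_diff_lower and mono = spow_mono[OF p]
  have c: "0 < c0" by (rule c0_pos)
  consider "?w < 0" "0 \<le> ?z" | "?w < 0" "?z < 0" | "0 \<le> ?w" "0 \<le> ?z" | "0 \<le> ?w" "?z < 0" by linarith
  then show ?thesis
  proof cases
    case 1
    then have \<phi>: "\<phi> = - ?w" "0 < \<phi>" and \<psi>: "\<psi> = 0" by (auto simp: \<phi>_def \<psi>_def)
    have "c0 * ((a - b) - (a' - b')) \<le> spow p (a - b) - spow p (a' - b')"
      using r 1 by (intro low) auto
    moreover have "c0 * \<phi> \<le> c0 * ((a - b) - (a' - b'))" using c 1 \<phi> by simp
    ultimately have A: "?A \<le> - (c0 * \<phi>)" by linarith
    have "c0 * ((a - b') - (a' - b')) \<le> spow p (a - b') - spow p (a' - b')"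
      "c0 * ((a - b) - (a' - b)) \<le> spow p (a - b) - spow p (a' - b)"
      using r 1 by (intro low; auto)+
    then have AB: "?A + ?B \<le> - (2 * (c0 * \<phi>))" using \<phi> by simp
    have "?A * (K1 - K2) + (?A + ?B) * K2 \<le> - (c0 * \<phi>) * (K1 - K2) + - (2 * (c0 * \<phi>)) * K2"
      using A AB K by (intro add_mono mult_right_mono) auto
    then have "\<phi> * (?A * (K1 - K2) + (?A + ?B) * K2) \<le> \<phi> * (- (c0 * \<phi>) * (K1 - K2) + - (2 * (c0 * \<phi>)) * K2)"
      using \<phi>(2) by (intro mult_left_mono) auto
    then show ?thesis unfolding \<psi> by (simp add: algebra_simps power2_eq_square)
  next
    case 2
    then have \<phi>: "\<phi> = - ?w" "\<psi> = - ?z" "\<psi> \<noteq> 0" by (auto simp: \<phi>_def \<psi>_def)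
    have "?A * (\<phi> - \<psi>) \<le> 0"
    proof (cases "?w \<le> ?z")
      case True
      then have "?A \<le> 0" using mono[of "a' - b'" "a - b"] by simp
      then show ?thesis using True \<phi> by (intro mult_nonpos_nonneg) auto
    next
      case False
      then have "0 \<le> ?A" using mono[of "a - b" "a' - b'"] by simp
      then show ?thesis using False \<phi> by (intro mult_nonneg_nonpos) auto
    qed
    moreover have "?B * (\<phi> + \<psi>) \<le> 0"
      using 2 \<phi> mono[of "a' - b" "a - b'"] by (intro mult_nonpos_nonneg) auto
    ultimately have "?A * (\<phi> - \<psi>) * K1 \<le> 0" "?B * (\<phi> + \<psi>) * K2 \<le> 0"
      using K by (auto intro!: mult_nonpos_nonneg)
    then show ?thesis using \<phi> by simp
  next
    case 3
    then show ?thesis by (simp add: \<phi>_def \<psi>_def)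
  next
    case 4
    then have \<phi>: "\<phi> = 0" "\<psi> = - ?z" "0 < \<psi>" by (auto simp: \<phi>_def \<psi>_def)
    have A: "0 \<le> ?A" using mono[of "a - b" "a' - b'"] 4 by simp
    have AB: "?B \<le> ?A" using mono[of "a' - b" "a' - b'"] mono[of "a - b" "a - b'"] 4 by simp
    have "?B * K2 \<le> ?A * K2" "?A * K2 \<le> ?A * K1" using A AB K by (auto intro: mult_mono)
    then have "\<psi> * (?B * K2) \<le> \<psi> * (?A * K1)" using \<phi>(3) by (intro mult_left_mono) auto
    then show ?thesis using \<phi>(1,3) by (simp add: algebra_simps)
  qed
qed

text \<open>Since the kernel has large mass off a small set, \<open>\<integral> \<phi>\<^sup>2\<close> for the negative part \<open>\<phi>\<close> of the gap is
  controlled by the form with a large constant if \<open>\<phi>\<close> lives on a set of small measure, while the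
  right-hand side is at most \<open>L \<integral> \<phi>\<^sup>2\<close>.\<close>

lemma max_principle_small_set:
  assumes e: "norm e = 1" and l: "0 \<le> l" and m: "0 < m"
    and small: "4 * L < c0 * (mass_const TYPE('a) \<sigma> * m powr (- \<sigma> / DIM('a)))"
    and P: "emeasure lborel {x. l < x \<bullet> e \<and> gap e l x < 0} \<le> ennreal (m / 2)"
  shows "AE x in lborel. l < x \<bullet> e \<longrightarrow> 0 \<le> gap e l x"
proof -
  let ?S = "mirror e l"
  define \<phi> where "\<phi> = (\<lambda>x. if l < x \<bullet> e then max (- gap e l x) 0 else 0)"
  have [measurable]: "\<phi> \<in> borel_measurable borel" unfolding \<phi>_def by measurable
  have \<phi>0: "0 \<le> \<phi> x" for x by (simp add: \<phi>_def)
  have \<phi>T: "\<phi> x \<le> T" for x using abs_gap_le[of e l x] T by (auto simp: \<phi>_def)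
  have \<phi>side: "\<phi> x = 0" if "\<not> l < x \<bullet> e" for x using that by (simp add: \<phi>_def)
  have \<phi>supp: "\<phi> x = 0" if "\<not> (norm x < R \<and> l < x \<bullet> e)" for x
    using that u_outside[of x] u_nonneg[of "?S x"] by (auto simp: \<phi>_def gap_def)
  have \<phi>fin: "energy \<sigma> p \<phi> < \<infinity>" unfolding \<phi>_def
    by (rule energy_half_negative_part[OF e sigma(1) p(1)]) (use e in \<open>auto simp: gap_mirror gap_energy[unfolded infinity_ennreal_def]\<close>)
  have abs\<phi>: "\<bar>\<phi> x\<bar> \<le> T" for x using \<phi>0[of x] \<phi>T[of x] by simp
  note de = difference_equation[OF e l _ abs\<phi> \<phi>supp \<phi>fin]
  define P where "P = {x. \<phi> x \<noteq> 0}"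
  have [measurable]: "P \<in> sets borel" unfolding P_def by measurable
  have Peq: "P = {x. l < x \<bullet> e \<and> gap e l x < 0}" by (auto simp: P_def \<phi>_def max_def)
  define Q where "Q = {x. \<phi> x \<noteq> 0 \<or> \<phi> (?S x) \<noteq> 0}"
  have [measurable]: "Q \<in> sets borel" unfolding Q_def by measurable
  have "emeasure lborel Q \<le> emeasure lborel P + emeasure lborel (?S -` P)"
  proof -
    have "Q = P \<union> ?S -` P" by (auto simp: Q_def P_def)
    moreover have "?S -` P \<in> sets borel" using measurable_sets[OF mirror_measurable, of P e l] by simp
    ultimately show ?thesis by (simp add: emeasure_subadditive)
  qed
  also have "emeasure lborel (?S -` P) = emeasure (distr lborel borel ?S) P"
    by (subst emeasure_distr) auto
  also have "\<dots> = emeasure lborel P" by (simp only: lborel_distr_mirror[OF e])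
  also have "emeasure lborel P + emeasure lborel P \<le> ennreal (m / 2) + ennreal (m / 2)"
    using P unfolding Peq by (rule add_mono[OF _ P])
  also have "\<dots> = ennreal m" using m by (simp flip: ennreal_plus)
  finally have Q: "emeasure lborel Q \<le> ennreal m" .
  have fold\<phi>: "\<phi> (fold_half e l x) = max (- gap e l (fold_half e l x)) 0" for x
    using fold_half_side[OF e, of l x] mirror_on_plane[of "fold_half e l x" e l]
    by (cases "fold_half e l x \<bullet> e = l") (auto simp: \<phi>_def gap_def)
  have pt: "pair_test e l \<phi> (x, y) \<le> - (c0 * ((\<phi> x)\<^sup>2 * (indicator (- Q) y * kern \<sigma> (x - y))))" for x y
  proof -
    define X Y where "X = fold_half e l x" and "Y = fold_half e l y"
    have side: "l \<le> X \<bullet> e" "l \<le> Y \<bullet> e" unfolding X_def Y_def using fold_half_side[OF e] by auto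
    have XX: "\<phi> X = max (- (u (?S X) - u X)) 0" "\<phi> Y = max (- (u (?S Y) - u Y)) 0"
      unfolding X_def Y_def using fold\<phi> by (auto simp: gap_def)
    have fx: "X = x" if "\<phi> x \<noteq> 0" using that \<phi>side[of x] by (auto simp: X_def fold_half_def)
    have fy: "\<phi> Y = 0" if "y \<notin> Q" using that by (auto simp: Y_def fold_half_def Q_def)
    have rng: "u v \<in> {0..T}" for v using u_nonneg u_le by auto
    have "pair_test e l \<phi> (x, y) = pair_test e l \<phi> (X, Y)"
      unfolding pair_test_def X_def Y_def by (rule quad_fold[OF e, symmetric])
    also have "\<dots> = (spow p (u (?S X) - u (?S Y)) - spow p (u X - u Y)) * (\<phi> X - \<phi> Y) * kern \<sigma> (X - Y)
      + (spow p (u (?S X) - u Y) - spow p (u X - u (?S Y))) * (\<phi> X + \<phi> Y) * kern \<sigma> (X - ?S Y)"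
      by (rule pair_test_eq[OF e \<phi>side side])
    finally have eq: "pair_test e l \<phi> (x, y) = \<dots>" .
    have ineq: "pair_test e l \<phi> (x, y) \<le> (if \<phi> Y = 0 then - c0 * (\<phi> X)\<^sup>2 * (kern \<sigma> (X - Y) + kern \<sigma> (X - ?S Y)) else 0)"
    proof (cases "X = Y")
      case False
      show ?thesis unfolding eq XX
        by (rule reflection_inequality) (use rng False side sigma e in \<open>auto intro: kern_mirror_le\<close>)
    next
      case True
      have "(spow p (u (?S X) - u X) - spow p (u X - u (?S X))) * (\<phi> X + \<phi> X) \<le> 0"
      proof (cases "\<phi> X = 0")
        case False
        then have "u (?S X) \<le> u X" using XX by auto
        then have "spow p (u (?S X) - u X) \<le> spow p (u X - u (?S X))" by (intro spow_mono p) auto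
        then show ?thesis using \<phi>0[of X] by (intro mult_nonpos_nonneg) auto
      qed simp
      then have "(spow p (u (?S X) - u X) - spow p (u X - u (?S X))) * (\<phi> X + \<phi> X) * kern \<sigma> (X - ?S X) \<le> 0"
        by (rule mult_nonpos_nonneg) simp
      then show ?thesis unfolding eq using True by auto
    qed
    show ?thesis
    proof (cases "y \<in> Q \<or> \<phi> x = 0")
      case True
      have "0 \<le> c0 * (\<phi> X)\<^sup>2 * (kern \<sigma> (X - Y) + kern \<sigma> (X - ?S Y))" using c0_pos by simp
      then have "pair_test e l \<phi> (x, y) \<le> 0" using ineq by (auto split: if_splits)
      then show ?thesis using True by auto
    next
      case False
      have "kern \<sigma> (x - y) \<le> kern \<sigma> (X - Y) + kern \<sigma> (X - ?S Y)"
        using kern_fold_cases[OF e, of \<sigma> x y l] unfolding X_def Y_def by auto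
      then have "c0 * (\<phi> x)\<^sup>2 * kern \<sigma> (x - y) \<le> c0 * (\<phi> x)\<^sup>2 * (kern \<sigma> (X - Y) + kern \<sigma> (X - ?S Y))"
        using c0_pos by (intro mult_left_mono) auto
      then show ?thesis using False ineq fy fx by (auto simp: mult.assoc)
    qed
  qed
  let ?k = "mass_const TYPE('a) \<sigma> * m powr (- \<sigma> / DIM('a))"
  have k: "0 \<le> ?k" using mass_const_pos[where 'a='a, of \<sigma>] by simp
  have int2: "integrable lborel (\<lambda>x. (\<phi> x)\<^sup>2)"
    using \<phi>0 \<phi>T \<phi>supp by (intro integrable_bounded_support[where M="T\<^sup>2"]) (auto intro!: power_mono)
  define Y where "Y = (\<integral>x. (\<phi> x)\<^sup>2 \<partial>lborel)"
  have Y: "(\<integral>\<^sup>+x. ennreal ((\<phi> x)\<^sup>2) \<partial>lborel) = ennreal Y" "0 \<le> Y"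
    unfolding Y_def using int2 by (auto intro: nn_integral_eq_integral)
  have "ennreal (c0 * ?k * Y) = (\<integral>\<^sup>+x. ennreal (c0 * (\<phi> x)\<^sup>2) * ennreal ?k \<partial>lborel)"
  proof -
    have "(\<integral>\<^sup>+x. ennreal (c0 * (\<phi> x)\<^sup>2) * ennreal ?k \<partial>lborel) = (\<integral>\<^sup>+x. ennreal (c0 * ?k) * ennreal ((\<phi> x)\<^sup>2) \<partial>lborel)"
      using c0_pos k by (intro nn_integral_cong) (simp only: ennreal_mult'[symmetric] mult_nonneg_nonneg less_imp_le zero_le_power2 mult_ac)
    also have "\<dots> = ennreal (c0 * ?k) * ennreal Y" by (subst nn_integral_cmult) (auto simp: Y)
    also have "\<dots> = ennreal (c0 * ?k * Y)" using c0_pos k by (intro ennreal_mult'[symmetric]) simp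
    finally show ?thesis ..
  qed
  also have "\<dots> \<le> (\<integral>\<^sup>+x. \<integral>\<^sup>+y. ennreal (- pair_test e l \<phi> (x, y)) \<partial>lborel \<partial>lborel)"
  proof (rule nn_integral_mono)
    fix x :: 'a
    have "ennreal (c0 * (\<phi> x)\<^sup>2) * ennreal ?k \<le> ennreal (c0 * (\<phi> x)\<^sup>2) * (\<integral>\<^sup>+y. indicator (- Q) y * ennreal (kern \<sigma> (x - y)) \<partial>lborel)"
      by (intro mult_left_mono kern_mass_off sigma m Q) auto
    also have "\<dots> = (\<integral>\<^sup>+y. ennreal (c0 * (\<phi> x)\<^sup>2) * (indicator (- Q) y * ennreal (kern \<sigma> (x - y))) \<partial>lborel)"
      by (rule nn_integral_cmult[symmetric]) measurable
    also have "\<dots> \<le> (\<integral>\<^sup>+y. ennreal (- pair_test e l \<phi> (x, y)) \<partial>lborel)"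
    proof (rule nn_integral_mono)
      fix y
      have "ennreal (c0 * (\<phi> x)\<^sup>2) * (indicator (- Q) y * ennreal (kern \<sigma> (x - y)))
          = ennreal (c0 * ((\<phi> x)\<^sup>2 * (indicator (- Q) y * kern \<sigma> (x - y))))"
        using c0_pos by (cases "y \<in> Q") (auto simp: ennreal_mult'[symmetric] mult.assoc)
      then show "ennreal (c0 * (\<phi> x)\<^sup>2) * (indicator (- Q) y * ennreal (kern \<sigma> (x - y))) \<le> ennreal (- pair_test e l \<phi> (x, y))"
        using pt[of x y] by (auto intro!: ennreal_leI)
    qed
    finally show "ennreal (c0 * (\<phi> x)\<^sup>2) * ennreal ?k \<le> (\<integral>\<^sup>+y. ennreal (- pair_test e l \<phi> (x, y)) \<partial>lborel)" .
  qed
  also have "\<dots> = (\<integral>\<^sup>+z. ennreal (- pair_test e l \<phi> z) \<partial>lborel2)"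
    using de(1) by (intro lborel.nn_integral_fst[of "\<lambda>z. ennreal (- pair_test e l \<phi> z)"]) auto
  also have "\<dots> = ennreal (\<integral>z. - pair_test e l \<phi> z \<partial>lborel2)"
  proof (rule nn_integral_eq_integral)
    show "AE z in lborel2. 0 \<le> - pair_test e l \<phi> z"
    proof (rule AE_I2)
      fix z :: "'a \<times> 'a"
      have "0 \<le> c0 * ((\<phi> (fst z))\<^sup>2 * (indicator (- Q) (snd z) * kern \<sigma> (fst z - snd z)))"
        using c0_pos by (auto simp: indicator_def)
      then show "0 \<le> - pair_test e l \<phi> z" using pt[of "fst z" "snd z"] by simp
    qed
  qed (use de(1) in auto)
  also have "(\<integral>z. - pair_test e l \<phi> z \<partial>lborel2) = 4 * (\<integral>x. - ((f (u (?S x)) - f (u x)) * \<phi> x) \<partial>lborel)"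
    using de(2) by simp
  also have "ennreal (4 * (\<integral>x. - ((f (u (?S x)) - f (u x)) * \<phi> x) \<partial>lborel)) \<le> ennreal (4 * (\<integral>x. L * (\<phi> x)\<^sup>2 \<partial>lborel))"
  proof (intro ennreal_leI mult_left_mono integral_mono)
    show "- ((f (u (?S x)) - f (u x)) * \<phi> x) \<le> L * (\<phi> x)\<^sup>2" for x
    proof (cases "\<phi> x = 0")
      case False
      then have g: "\<bar>u (?S x) - u x\<bar> = \<phi> x" by (auto simp: \<phi>_def gap_def max_def split: if_splits)
      have "- (f (u (?S x)) - f (u x)) \<le> L * \<phi> x"
        using f_lipschitz[of "u (?S x)" "u x"] u_nonneg u_le unfolding g by (auto simp: abs_le_iff)
      then have "- (f (u (?S x)) - f (u x)) * \<phi> x \<le> L * \<phi> x * \<phi> x" using \<phi>0 by (rule mult_right_mono)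
      then show ?thesis by (simp add: power2_eq_square algebra_simps)
    qed simp
  qed (use de(3) int2 in auto)
  also have "\<dots> = ennreal (4 * L * Y)" by (simp add: Y_def mult.assoc)
  finally have "c0 * ?k * Y \<le> 4 * L * Y" using L Y(2) by (simp add: ennreal_le_iff)
  then have "Y = 0" using small Y(2) by (metis linorder_not_le mult_less_cancel_right_disj order_le_less)
  then have "(\<integral>\<^sup>+x. ennreal ((\<phi> x)\<^sup>2) \<partial>lborel) = 0" using Y(1) by simp
  then have "AE x in lborel. ennreal ((\<phi> x)\<^sup>2) = 0"
    by (subst (asm) nn_integral_0_iff_AE) auto
  then show ?thesis by eventually_elim (auto simp: \<phi>_def max_def split: if_splits)
qed

end

section \<open>The strong maximum principle for the reflected difference\<close>

lemma ennreal_add_le_self: "a + b \<le> a \<Longrightarrow> a < \<infinity> \<Longrightarrow> b = (0 :: ennreal)"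
  using ennreal_add_left_cancel_le[of a b 0] by auto

context bounded_solution
begin

definition cap_cutoff :: "'a \<Rightarrow> real \<Rightarrow> 'a \<Rightarrow> real" where
  "cap_cutoff e l x = max 0 (min (R - norm x) (x \<bullet> e - l))"

lemma cap_cutoff_measurable[measurable]: "cap_cutoff e l \<in> borel_measurable borel"
  unfolding cap_cutoff_def by measurable

lemma cap_cutoff_range:
  assumes "0 \<le> l"
  shows "0 \<le> cap_cutoff e l x" "cap_cutoff e l x \<le> R"
  using R by (auto simp: cap_cutoff_def intro!: min.coboundedI1)

lemma cap_cutoff_zero: "\<not> (norm x < R \<and> l < x \<bullet> e) \<Longrightarrow> cap_cutoff e l x = 0"
  by (auto simp: cap_cutoff_def)

lemma cap_cutoff_pos: "norm x < R \<Longrightarrow> l < x \<bullet> e \<Longrightarrow> 0 < cap_cutoff e l x"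
  by (auto simp: cap_cutoff_def)

lemma cap_cutoff_lipschitz:
  assumes e: "norm e = 1" and l: "0 \<le> l"
  shows "\<bar>cap_cutoff e l x - cap_cutoff e l y\<bar> \<le> max 1 R * min 1 (norm (x - y))"
proof -
  have "\<bar>norm x - norm y\<bar> \<le> norm (x - y)" by (rule norm_triangle_ineq3)
  moreover have "\<bar>x \<bullet> e - y \<bullet> e\<bar> \<le> norm (x - y)"
    using Cauchy_Schwarz_ineq2[of "x - y" e] e by (simp add: inner_diff_left)
  ultimately have 1: "\<bar>cap_cutoff e l x - cap_cutoff e l y\<bar> \<le> norm (x - y)"
    unfolding cap_cutoff_def by (auto simp: max_def min_def abs_le_iff)
  have 2: "\<bar>cap_cutoff e l x - cap_cutoff e l y\<bar> \<le> R"
    using cap_cutoff_range[OF l, of e x] cap_cutoff_range[OF l, of e y] by linarith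
  show ?thesis
  proof (cases "norm (x - y) \<le> 1")
    case True
    have "1 * norm (x - y) \<le> max 1 R * norm (x - y)" by (intro mult_right_mono) auto
    then show ?thesis using 1 True by (simp add: min_def)
  qed (use 2 in simp)
qed

text \<open>On nonnegative arguments this tends to the indicator of \<open>{0}\<close> as \<open>n\<close> grows.\<close>

definition level_cutoff :: "nat \<Rightarrow> real \<Rightarrow> real" where
  "level_cutoff n t = min 1 (max 0 (1 - real (Suc n) * t))"

lemma level_cutoff_measurable[measurable]: "level_cutoff n \<in> borel_measurable borel"
  unfolding level_cutoff_def by measurable

lemma level_cutoff_range: "0 \<le> level_cutoff n t" "level_cutoff n t \<le> 1"
  by (auto simp: level_cutoff_def)

lemma level_cutoff_antimono: "s \<le> t \<Longrightarrow> level_cutoff n t \<le> level_cutoff n s"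
proof -
  assume "s \<le> t"
  then have "real (Suc n) * s \<le> real (Suc n) * t" by (intro mult_left_mono) auto
  moreover have "min 1 (max 0 (1 - b)) \<le> min 1 (max 0 (1 - a))" if "a \<le> b" for a b :: real
    using that by auto
  ultimately show ?thesis unfolding level_cutoff_def by blast
qed

lemma level_cutoff_lipschitz: "\<bar>level_cutoff n s - level_cutoff n t\<bar> \<le> real (Suc n) * \<bar>s - t\<bar>"
proof -
  have "real (Suc n) * \<bar>s - t\<bar> = \<bar>real (Suc n) * s - real (Suc n) * t\<bar>"
    by (simp only: right_diff_distrib[symmetric] abs_mult abs_of_nat)
  then show ?thesis unfolding level_cutoff_def by (auto simp: min_def max_def simp del: of_nat_Suc)
qed

lemma level_cutoff_times_le: "0 \<le> t \<Longrightarrow> t * level_cutoff n t \<le> 1 / real (Suc n)"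
proof (cases "real (Suc n) * t \<le> 1")
  case True
  assume t: "0 \<le> t"
  have "t * level_cutoff n t \<le> t * 1" using t level_cutoff_range by (intro mult_left_mono) auto
  also have "\<dots> \<le> 1 / real (Suc n)" using True by (simp add: field_simps del: of_nat_Suc)
  finally show ?thesis .
next
  case False
  then show ?thesis by (simp add: level_cutoff_def del: of_nat_Suc)
qed

lemma level_cutoff_eventually:
  assumes "0 \<le> t"
  shows "\<forall>\<^sub>F n in sequentially. level_cutoff n t = (if t = 0 then 1 else 0)"
proof (cases "t = 0")
  case False
  then have t: "0 < t" using assms by simp
  obtain n0 :: nat where n0: "1 / t < real n0" using reals_Archimedean2 by blast
  have "level_cutoff n t = 0" if "n0 \<le> n" for n
  proof -
    have "1 / t < real (Suc n)" using n0 that by simp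
    then have "1 < real (Suc n) * t" using t by (simp add: field_simps)
    then show ?thesis by (simp add: level_cutoff_def del: of_nat_Suc)
  qed
  then show ?thesis using False unfolding eventually_sequentially by auto
qed (simp add: level_cutoff_def)

text \<open>Test with the cutoff times \<open>(1 - n w)\<^sup>+\<close>, where \<open>w \<ge> 0\<close> is the gap. The right-hand side is
  \<open>O(1/n)\<close>. In the form, the contributions of the wrong sign come from varying the cutoff only; they
  are dominated because Lipschitz functions have finite energy, and tend to \<open>0\<close> because the
  integrand vanishes between points where \<open>w = 0\<close>. By Fatou's lemma the interaction of
  \<open>{w = 0}\<close> with \<open>{w > 0}\<close> vanishes.\<close>

lemma strong_max_principle:
  assumes e: "norm e = 1" and l: "0 \<le> l"
    and nonneg: "AE x in lborel. l < x \<bullet> e \<longrightarrow> 0 \<le> gap e l x"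
  shows "(AE x in lborel. l < x \<bullet> e \<longrightarrow> gap e l x = 0)
    \<or> (AE x in lborel. l < x \<bullet> e \<and> norm x < R \<longrightarrow> 0 < gap e l x)"
proof -
  let ?S = "mirror e l"
  let ?\<eta> = "cap_cutoff e l"
  define M1 where "M1 = 2 * T powr (p - 1)"
  have M1: "0 \<le> M1" by (simp add: M1_def)
  note \<eta> = cap_cutoff_range[OF l] cap_cutoff_zero cap_cutoff_lipschitz[OF e l]
  define \<phi> where "\<phi> = (\<lambda>n x. ?\<eta> x * level_cutoff n (gap e l x))"
  have [measurable]: "\<phi> n \<in> borel_measurable borel" for n unfolding \<phi>_def by measurable
  have \<eta>supp: "?\<eta> x = 0" if "x \<notin> ball 0 R" for x using that by (intro cap_cutoff_zero) auto
  have \<eta>fin: "energy \<sigma> q ?\<eta> < \<infinity>" if "1 \<le> q" for q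
    by (rule lipschitz_cutoff_energy[OF sigma that _ _ \<eta>(4) \<eta>supp]) auto
  have \<phi>R: "\<bar>\<phi> n x\<bar> \<le> R" for n x
  proof -
    have "?\<eta> x * level_cutoff n (gap e l x) \<le> R * 1"
      using \<eta>(1,2) level_cutoff_range R by (intro mult_mono) auto
    then show ?thesis using \<eta>(1)[of e x] level_cutoff_range[of n] by (simp add: \<phi>_def abs_mult)
  qed
  have \<phi>supp: "\<phi> n x = 0" if "\<not> (norm x < R \<and> l < x \<bullet> e)" for n x using \<eta>(3)[OF that] by (simp add: \<phi>_def)
  have \<phi>fin: "energy \<sigma> p (\<phi> n) < \<infinity>" for n
  proof (rule energy_finite_le[OF p(1), where u="?\<eta>" and v="gap e l" and K="max 1 (R * real (Suc n))"])
    fix x y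
    let ?tx = "level_cutoff n (gap e l x)" and ?ty = "level_cutoff n (gap e l y)"
    have "\<bar>\<phi> n x - \<phi> n y\<bar> = \<bar>(?\<eta> x - ?\<eta> y) * ?tx + ?\<eta> y * (?tx - ?ty)\<bar>"
      by (simp add: \<phi>_def algebra_simps)
    also have "\<dots> \<le> \<bar>?\<eta> x - ?\<eta> y\<bar> * ?tx + ?\<eta> y * \<bar>?tx - ?ty\<bar>"
      using \<eta>(1)[of e y] level_cutoff_range(1)[of n] by (intro order_trans[OF abs_triangle_ineq]) (simp add: abs_mult)
    also have "\<dots> \<le> \<bar>?\<eta> x - ?\<eta> y\<bar> * 1 + R * (real (Suc n) * \<bar>gap e l x - gap e l y\<bar>)"
      using \<eta>(1,2)[of e y] level_cutoff_range[of n] R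
      by (intro add_mono mult_mono level_cutoff_lipschitz) auto
    also have "\<dots> \<le> max 1 (R * real (Suc n)) * \<bar>?\<eta> x - ?\<eta> y\<bar> + max 1 (R * real (Suc n)) * \<bar>gap e l x - gap e l y\<bar>"
    proof (rule add_mono)
      show "\<bar>?\<eta> x - ?\<eta> y\<bar> * 1 \<le> max 1 (R * real (Suc n)) * \<bar>?\<eta> x - ?\<eta> y\<bar>"
        by (subst mult.commute, rule mult_right_mono) auto
      show "R * (real (Suc n) * \<bar>gap e l x - gap e l y\<bar>) \<le> max 1 (R * real (Suc n)) * \<bar>gap e l x - gap e l y\<bar>"
        unfolding mult.assoc[symmetric] by (rule mult_right_mono) auto
    qed
    finally show "\<bar>\<phi> n x - \<phi> n y\<bar> \<le> max 1 (R * real (Suc n)) * (\<bar>?\<eta> x - ?\<eta> y\<bar> + \<bar>gap e l x - gap e l y\<bar>)"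
      by (simp only: distrib_left)
  qed (use p \<eta>fin gap_energy[OF e] in auto)
  note de = difference_equation[OF e l _ \<phi>R \<phi>supp \<phi>fin]
  define E1 where "E1 = (\<lambda>z. \<bar>?\<eta> (fst z) - ?\<eta> (snd z)\<bar> * kern \<sigma> (fst z - snd z))"
  have [measurable]: "E1 \<in> borel_measurable lborel2" unfolding E1_def by measurable
  have E1nn: "0 \<le> E1 z" for z by (simp add: E1_def)
  have E1int: "integrable lborel2 E1"
  proof (rule integrableI_bounded)
    have "(\<integral>\<^sup>+z. ennreal (norm (E1 z)) \<partial>lborel2) = energy \<sigma> 1 ?\<eta>"
      unfolding energy_def by (intro nn_integral_cong) (simp add: E1_def)
    then show "(\<integral>\<^sup>+z. ennreal (norm (E1 z)) \<partial>lborel2) < \<infinity>" using \<eta>fin[of 1] by simp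
  qed simp
  let ?Q = "quad E1 ?S"
  note Qint = integral_quad(1)[OF e E1int, of l]
  have Qm[measurable]: "?Q \<in> borel_measurable lborel2" using Qint by simp
  define q where "q = (\<integral>z. ?Q z \<partial>lborel2)"
  have Qnn: "0 \<le> ?Q z" for z by (simp add: quad_def E1nn)
  have spow1: "\<bar>spow p (u x - u y)\<bar> \<le> T powr (p - 1)" for x y
    using u_diff_range[of x y] by (intro abs_spow_le p) auto
  have \<phi>side: "\<phi> n x = 0" if "\<not> l < x \<bullet> e" for n x using \<phi>supp that by auto
  have fold_pt: "pair_test e l (\<phi> n) (fold_half e l x, fold_half e l y) = pair_test e l (\<phi> n) (x, y)" for n x y
    unfolding pair_test_def by (rule quad_fold[OF e])
  have upper: "pair_test e l (\<phi> n) (x, y) \<le> M1 * ?Q (x, y)" for n x y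
  proof -
    define X Y where "X = fold_half e l x" and "Y = fold_half e l y"
    have side: "l \<le> X \<bullet> e" "l \<le> Y \<bullet> e" unfolding X_def Y_def using fold_half_side[OF e] by auto
    let ?A = "spow p (u (?S X) - u (?S Y)) - spow p (u X - u Y)"
    let ?B = "spow p (u (?S X) - u Y) - spow p (u X - u (?S Y))"
    let ?tX = "level_cutoff n (gap e l X)" and ?tY = "level_cutoff n (gap e l Y)"
    have S0: "?\<eta> (?S X) = 0" "?\<eta> (?S Y) = 0" using side by (auto intro!: \<eta>(3) simp: mirror_inner[OF e])
    have A: "\<bar>?A\<bar> \<le> M1" using spow1[of "?S X" "?S Y"] spow1[of X Y] by (simp add: M1_def)
    have B: "\<bar>?B\<bar> \<le> M1" using spow1[of "?S X" Y] spow1[of X "?S Y"] by (simp add: M1_def)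
    have A\<theta>: "?A * (?tX - ?tY) \<le> 0"
    proof (cases "gap e l X \<le> gap e l Y")
      case True
      then have "?A \<le> 0" using spow_mono[OF p, of "u (?S X) - u (?S Y)" "u X - u Y"] by (simp add: gap_def)
      moreover have "0 \<le> ?tX - ?tY" using level_cutoff_antimono[OF True, of n] by simp
      ultimately show ?thesis by (rule mult_nonpos_nonneg)
    next
      case False
      then have "0 \<le> ?A" using spow_mono[OF p, of "u X - u Y" "u (?S X) - u (?S Y)"] by (simp add: gap_def)
      moreover have "?tX - ?tY \<le> 0" using level_cutoff_antimono[of "gap e l Y" "gap e l X" n] False by simp
      ultimately show ?thesis by (rule mult_nonneg_nonpos)
    qed
    have "?A * (\<phi> n X - \<phi> n Y) = ?\<eta> X * (?A * (?tX - ?tY)) + ?A * (?tY * (?\<eta> X - ?\<eta> Y))"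
      by (simp add: \<phi>_def algebra_simps)
    also have "\<dots> \<le> 0 + M1 * (1 * \<bar>?\<eta> X - ?\<eta> Y\<bar>)"
    proof (rule add_mono)
      show "?\<eta> X * (?A * (?tX - ?tY)) \<le> 0" using \<eta>(1) A\<theta> by (rule mult_nonneg_nonpos)
      have "?A * (?tY * (?\<eta> X - ?\<eta> Y)) \<le> \<bar>?A * (?tY * (?\<eta> X - ?\<eta> Y))\<bar>" by (rule abs_ge_self)
      also have "\<dots> = \<bar>?A\<bar> * (?tY * \<bar>?\<eta> X - ?\<eta> Y\<bar>)"
        by (simp only: abs_mult abs_of_nonneg[OF level_cutoff_range(1)])
      also have "\<dots> \<le> M1 * (1 * \<bar>?\<eta> X - ?\<eta> Y\<bar>)"
        using A level_cutoff_range[of n] M1 by (intro mult_mono) auto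
      finally show "?A * (?tY * (?\<eta> X - ?\<eta> Y)) \<le> M1 * (1 * \<bar>?\<eta> X - ?\<eta> Y\<bar>)" .
    qed
    finally have t1: "?A * (\<phi> n X - \<phi> n Y) * kern \<sigma> (X - Y) \<le> M1 * \<bar>?\<eta> X - ?\<eta> Y\<bar> * kern \<sigma> (X - Y)"
      by (intro mult_right_mono) auto
    have \<phi>\<eta>: "0 \<le> \<phi> n v" "\<phi> n v \<le> ?\<eta> v" for v
      using \<eta>(1)[of e v] level_cutoff_range[of n "gap e l v"] by (auto simp: \<phi>_def intro: mult_left_le)
    have "?B * (\<phi> n X + \<phi> n Y) \<le> M1 * (?\<eta> X + ?\<eta> Y)"
      using B \<phi>\<eta> M1 add_mono[OF \<phi>\<eta>(2) \<phi>\<eta>(2)] by (intro mult_mono) (auto simp: add_nonneg_nonneg)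
    then have t2: "?B * (\<phi> n X + \<phi> n Y) * kern \<sigma> (X - ?S Y) \<le> M1 * (?\<eta> X + ?\<eta> Y) * kern \<sigma> (X - ?S Y)"
      by (intro mult_right_mono) auto
    have k: "kern \<sigma> (?S X - Y) = kern \<sigma> (X - ?S Y)"
      by (rule kern_cong[OF norm_diff_mirror[OF e]])
    have "pair_test e l (\<phi> n) (x, y) = pair_test e l (\<phi> n) (X, Y)"
      unfolding X_def Y_def by (rule fold_pt[symmetric])
    also have "\<dots> = ?A * (\<phi> n X - \<phi> n Y) * kern \<sigma> (X - Y) + ?B * (\<phi> n X + \<phi> n Y) * kern \<sigma> (X - ?S Y)"
      by (rule pair_test_eq[OF e \<phi>side side])
    also have "\<dots> \<le> M1 * \<bar>?\<eta> X - ?\<eta> Y\<bar> * kern \<sigma> (X - Y) + M1 * (?\<eta> X + ?\<eta> Y) * kern \<sigma> (X - ?S Y)"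
      by (rule add_mono[OF t1 t2])
    also have "\<dots> = M1 * (E1 (X, Y) + E1 (X, ?S Y) + E1 (?S X, Y))"
      using \<eta>(1)[of e X] \<eta>(1)[of e Y] by (simp add: E1_def S0 k algebra_simps)
    also have "\<dots> \<le> M1 * ?Q (X, Y)"
      using M1 E1nn by (intro mult_left_mono) (simp_all add: quad_def)
    also have "?Q (X, Y) = ?Q (x, y)" unfolding X_def Y_def by (rule quad_fold[OF e])
    finally show ?thesis .
  qed
  \<comment> \<open>A lower bound for minus the limit of the form: the interaction of \<open>{gap = 0}\<close> with \<open>{gap > 0}\<close>.\<close>
  define W where "W = (\<lambda>z. if l < fst z \<bullet> e \<and> l < snd z \<bullet> e \<and> gap e l (fst z) = 0 \<and> 0 < gap e l (snd z)
      then ?\<eta> (fst z) * (c0 * gap e l (snd z)) * (kern \<sigma> (fst z - snd z) - kern \<sigma> (fst z - ?S (snd z))) else 0)"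
  have [measurable]: "W \<in> borel_measurable lborel2" unfolding W_def by measurable
  have limit: "\<forall>\<^sub>F n in sequentially. pair_test e l (\<phi> n) (x, y) \<le> - W (x, y)"
    if g: "0 \<le> gap e l (fold_half e l x)" "0 \<le> gap e l (fold_half e l y)" for x y
  proof -
    define X Y where "X = fold_half e l x" and "Y = fold_half e l y"
    have side: "l \<le> X \<bullet> e" "l \<le> Y \<bullet> e" unfolding X_def Y_def using fold_half_side[OF e] by auto
    let ?A = "spow p (u (?S X) - u (?S Y)) - spow p (u X - u Y)"
    let ?B = "spow p (u (?S X) - u Y) - spow p (u X - u (?S Y))"
    let ?iX = "if gap e l X = 0 then 1 else 0 :: real" and ?iY = "if gap e l Y = 0 then 1 else 0 :: real"
    have key: "?A * (?\<eta> X * ?iX - ?\<eta> Y * ?iY) * kern \<sigma> (X - Y) + ?B * (?\<eta> X * ?iX + ?\<eta> Y * ?iY) * kern \<sigma> (X - ?S Y)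
      \<le> - W (x, y)"
    proof -
      consider (zz) "gap e l X = 0" "gap e l Y = 0" | (zp) "gap e l X = 0" "0 < gap e l Y"
        | (pz) "0 < gap e l X" "gap e l Y = 0" | (pp) "0 < gap e l X" "0 < gap e l Y"
        using g unfolding X_def Y_def by linarith
      then show ?thesis
      proof cases
        case zz
        have "W (x, y) = 0" using zz by (auto simp: W_def X_def Y_def fold_half_def split: if_splits)
        then show ?thesis using zz by (simp add: gap_def)
      next
        case zp
        then have aX: "u (?S X) = u X" and neq: "X \<noteq> Y" by (auto simp: gap_def)
        have kle: "kern \<sigma> (X - ?S Y) \<le> kern \<sigma> (X - Y)" using side neq sigma e by (intro kern_mirror_le) auto
        have "c0 * ((u X - u Y) - (u X - u (?S Y))) \<le> spow p (u X - u Y) - spow p (u X - u (?S Y))"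
          using u_diff_range zp by (intro spow_diff_lower) (auto simp: gap_def)
        then have A: "?A \<le> - (c0 * gap e l Y)" by (simp add: aX gap_def)
        have "?A * (?\<eta> X * ?iX - ?\<eta> Y * ?iY) * kern \<sigma> (X - Y) + ?B * (?\<eta> X * ?iX + ?\<eta> Y * ?iY) * kern \<sigma> (X - ?S Y)
            = (?\<eta> X * (kern \<sigma> (X - Y) - kern \<sigma> (X - ?S Y))) * ?A"
          using zp by (simp add: aX algebra_simps)
        also have "\<dots> \<le> (?\<eta> X * (kern \<sigma> (X - Y) - kern \<sigma> (X - ?S Y))) * - (c0 * gap e l Y)"
          using A kle \<eta>(1)[of e X] by (intro mult_left_mono) auto
        also have "\<dots> \<le> - W (x, y)"
        proof (cases "l < x \<bullet> e \<and> l < y \<bullet> e")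
          case True
          then have "X = x" "Y = y" by (auto simp: X_def Y_def fold_half_def)
          then show ?thesis using zp True by (simp add: W_def mult_ac)
        next
          case False
          have "0 \<le> (?\<eta> X * (kern \<sigma> (X - Y) - kern \<sigma> (X - ?S Y))) * (c0 * gap e l Y)"
            using kle \<eta>(1)[of e X] c0_pos zp by simp
          moreover have "W (x, y) = 0" using False by (auto simp: W_def)
          ultimately show ?thesis by simp
        qed
        finally show ?thesis .
      next
        case pz
        then have bY: "u (?S Y) = u Y" and neq: "X \<noteq> Y" by (auto simp: gap_def)
        have kle: "kern \<sigma> (X - ?S Y) \<le> kern \<sigma> (X - Y)" using side neq sigma e by (intro kern_mirror_le) auto
        have A: "0 \<le> ?A" using spow_mono[OF p, of "u X - u Y" "u (?S X) - u Y"] pz by (simp add: bY gap_def)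
        have W0: "W (x, y) = 0" using pz by (auto simp: W_def X_def Y_def fold_half_def split: if_splits)
        have "?A * (?\<eta> X * ?iX - ?\<eta> Y * ?iY) * kern \<sigma> (X - Y) + ?B * (?\<eta> X * ?iX + ?\<eta> Y * ?iY) * kern \<sigma> (X - ?S Y)
            = - (?A * ?\<eta> Y * (kern \<sigma> (X - Y) - kern \<sigma> (X - ?S Y)))"
          using pz by (simp add: bY algebra_simps)
        also have "\<dots> \<le> 0" using A kle \<eta>(1)[of e Y] by simp
        finally show ?thesis by (simp add: W0)
      next
        case pp
        have "W (x, y) = 0" using pp by (auto simp: W_def X_def Y_def fold_half_def split: if_splits)
        then show ?thesis using pp by simp
      qed
    qed
    have "\<forall>\<^sub>F n in sequentially. level_cutoff n (gap e l X) = ?iX \<and> level_cutoff n (gap e l Y) = ?iY"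
      using level_cutoff_eventually[of "gap e l X"] level_cutoff_eventually[of "gap e l Y"] g
      by (auto simp: X_def Y_def intro: eventually_conj)
    then show ?thesis
    proof eventually_elim
      case (elim n)
      have "pair_test e l (\<phi> n) (x, y) = pair_test e l (\<phi> n) (X, Y)"
        unfolding X_def Y_def by (rule fold_pt[symmetric])
      also have "\<dots> = ?A * (\<phi> n X - \<phi> n Y) * kern \<sigma> (X - Y) + ?B * (\<phi> n X + \<phi> n Y) * kern \<sigma> (X - ?S Y)"
        by (rule pair_test_eq[OF e \<phi>side side])
      finally show ?case using key elim by (simp only: \<phi>_def)
    qed
  qed
  have Wnn: "0 \<le> W z" for z
  proof -
    have "0 \<le> kern \<sigma> (x - y) - kern \<sigma> (x - ?S y)" if "l < x \<bullet> e" "l < y \<bullet> e" "gap e l x = 0" "0 < gap e l y" for x y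
      using kern_mirror_le[OF e sigma(1), of l x y] that by fastforce
    then show ?thesis using \<eta>(1) c0_pos by (auto simp: W_def)
  qed
  have folded: "AE x in lborel. 0 \<le> gap e l (fold_half e l x)"
  proof -
    have "AE x in lborel. l < ?S x \<bullet> e \<longrightarrow> 0 \<le> gap e l (?S x)"
      by (rule AE_mirror[OF e _ nonneg]) measurable
    with nonneg show ?thesis
    proof eventually_elim
      case (elim x)
      consider "l < x \<bullet> e" | "x \<bullet> e < l" | "x \<bullet> e = l" by linarith
      then show ?case
        using elim by cases (auto simp: fold_half_def mirror_inner[OF e] gap_def mirror_on_plane)
    qed
  qed
  define cst where "cst = 4 * (L * R * measure lborel (ball (0::'a) R))"
  have rhs: "- (cst / real (Suc n)) \<le> (\<integral>z. pair_test e l (\<phi> n) z \<partial>lborel2)" for n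
  proof -
    let ?g = "\<lambda>x. (f (u (?S x)) - f (u x)) * \<phi> n x"
    let ?b = "\<lambda>x. (L * R / real (Suc n)) * indicator (ball (0::'a) R) x :: real"
    have intb: "integrable lborel ?b"
      by (intro integrable_mult_right integrable_real_indicator) (use R in \<open>auto simp: emeasure_ball_pow\<close>)
    have "(\<integral>x. - ?b x \<partial>lborel) \<le> (\<integral>x. ?g x \<partial>lborel)"
    proof (rule integral_mono_AE)
      show "AE x in lborel. - ?b x \<le> ?g x"
        using nonneg
      proof eventually_elim
        case (elim x)
        show ?case
        proof (cases "norm x < R \<and> l < x \<bullet> e")
          case True
          then have g0: "0 \<le> gap e l x" using elim by simp
          have "\<bar>?g x\<bar> = \<bar>f (u (?S x)) - f (u x)\<bar> * \<bar>\<phi> n x\<bar>" by (simp add: abs_mult)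
          also have "\<dots> \<le> (L * gap e l x) * (?\<eta> x * level_cutoff n (gap e l x))"
            using f_lipschitz[of "u (?S x)" "u x"] u_nonneg u_le g0 L \<eta>(1)[of e x] level_cutoff_range(1)[of n "gap e l x"]
            by (intro mult_mono) (auto simp: gap_def \<phi>_def abs_mult)
          also have "\<dots> = L * (?\<eta> x * (gap e l x * level_cutoff n (gap e l x)))" by simp
          also have "\<dots> \<le> L * (R * (1 / real (Suc n)))"
            using L R \<eta>(1,2)[of e x] g0 level_cutoff_range(1)[of n "gap e l x"]
            by (intro mult_left_mono mult_mono level_cutoff_times_le) auto
          finally show ?thesis using True by (simp add: abs_le_iff field_simps)
        next
          case False
          then show ?thesis using \<phi>supp[OF False, of n] L R by (simp add: indicator_def)
        qed
      qed
    qed (use intb de(3) in auto)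
    then have "- (L * R / real (Suc n) * measure lborel (ball (0::'a) R)) \<le> (\<integral>x. ?g x \<partial>lborel)" by simp
    moreover have "(\<integral>z. pair_test e l (\<phi> n) z \<partial>lborel2) = 4 * (\<integral>x. ?g x \<partial>lborel)"
      by (rule de(2)) measurable
    moreover have "cst / real (Suc n) = 4 * (L * R / real (Suc n) * measure lborel (ball (0::'a) R))"
      by (simp add: cst_def)
    ultimately show ?thesis by linarith
  qed
  have "(\<integral>\<^sup>+z. ennreal (M1 * ?Q z + W z) \<partial>lborel2)
    \<le> (\<integral>\<^sup>+z. liminf (\<lambda>n. ennreal (M1 * ?Q z - pair_test e l (\<phi> n) z)) \<partial>lborel2)"
  proof (rule nn_integral_mono_AE)
    have "AE x in lborel. AE y in lborel. 0 \<le> gap e l (fold_half e l x) \<and> 0 \<le> gap e l (fold_half e l y)"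
      using folded by eventually_elim (use folded in simp)
    then have "AE z in lborel2. 0 \<le> gap e l (fold_half e l (fst z)) \<and> 0 \<le> gap e l (fold_half e l (snd z))"
    proof (intro lborel_pair.AE_pair_measure)
      have [measurable]: "fold_half e l \<in> borel \<rightarrow>\<^sub>M borel" unfolding fold_half_def by measurable
      show "{z \<in> space lborel2. 0 \<le> gap e l (fold_half e l (fst z)) \<and> 0 \<le> gap e l (fold_half e l (snd z))}
          \<in> sets lborel2" by measurable
    qed (simp only: fst_conv snd_conv)
    then show "AE z in lborel2. ennreal (M1 * ?Q z + W z)
        \<le> liminf (\<lambda>n. ennreal (M1 * ?Q z - pair_test e l (\<phi> n) z))"
    proof eventually_elim
      case (elim z)
      have "\<forall>\<^sub>F n in sequentially. ennreal (M1 * ?Q z + W z) \<le> ennreal (M1 * ?Q z - pair_test e l (\<phi> n) z)"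
        using limit[of "fst z" "snd z"] elim by (auto elim!: eventually_mono intro!: ennreal_leI)
      then show ?case by (rule Liminf_bounded)
    qed
  qed
  also have "\<dots> \<le> liminf (\<lambda>n. \<integral>\<^sup>+z. ennreal (M1 * ?Q z - pair_test e l (\<phi> n) z) \<partial>lborel2)"
    using de(1) by (intro nn_integral_liminf) auto
  also have "\<dots> \<le> ennreal (M1 * q)"
  proof -
    have "(\<integral>\<^sup>+z. ennreal (M1 * ?Q z - pair_test e l (\<phi> n) z) \<partial>lborel2) \<le> ennreal (M1 * q + cst / real (Suc n))" for n
    proof -
      have "(\<integral>\<^sup>+z. ennreal (M1 * ?Q z - pair_test e l (\<phi> n) z) \<partial>lborel2)
          = ennreal (\<integral>z. M1 * ?Q z - pair_test e l (\<phi> n) z \<partial>lborel2)"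
        using Qint de(1) upper by (intro nn_integral_eq_integral) auto
      also have "\<dots> = ennreal (M1 * q - (\<integral>z. pair_test e l (\<phi> n) z \<partial>lborel2))"
        using Qint de(1) by (simp add: q_def)
      also have "\<dots> \<le> ennreal (M1 * q + cst / real (Suc n))" using rhs[of n] by (intro ennreal_leI) simp
      finally show ?thesis .
    qed
    then have "liminf (\<lambda>n. \<integral>\<^sup>+z. ennreal (M1 * ?Q z - pair_test e l (\<phi> n) z) \<partial>lborel2)
        \<le> liminf (\<lambda>n. ennreal (M1 * q + cst / real (Suc n)))"
      by (intro Liminf_mono always_eventually) auto
    also have "\<dots> = ennreal (M1 * q)"
    proof (rule lim_imp_Liminf[OF trivial_limit_sequentially])
      have "(\<lambda>n. M1 * q + cst / real (Suc n)) \<longlonglongrightarrow> M1 * q + 0"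
        by (intro tendsto_add tendsto_const LIMSEQ_Suc[OF lim_const_over_n])
      then show "(\<lambda>n. ennreal (M1 * q + cst / real (Suc n))) \<longlonglongrightarrow> ennreal (M1 * q)"
        by (intro tendsto_ennrealI) simp
    qed
    finally show ?thesis .
  qed
  also have "ennreal (M1 * q) = (\<integral>\<^sup>+z. ennreal (M1 * ?Q z) \<partial>lborel2)"
    using Qint M1 Qnn by (subst nn_integral_eq_integral) (auto simp: q_def)
  finally have "(\<integral>\<^sup>+z. ennreal (M1 * ?Q z) \<partial>lborel2) + (\<integral>\<^sup>+z. ennreal (W z) \<partial>lborel2)
      \<le> (\<integral>\<^sup>+z. ennreal (M1 * ?Q z) \<partial>lborel2)"
    using M1 Qnn Wnn by (simp add: nn_integral_add)
  moreover have "(\<integral>\<^sup>+z. ennreal (M1 * ?Q z) \<partial>lborel2) < \<infinity>"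
    using Qint M1 Qnn by (subst nn_integral_eq_integral) auto
  ultimately have "(\<integral>\<^sup>+z. ennreal (W z) \<partial>lborel2) = 0"
    by (rule ennreal_add_le_self)
  then have "AE z in lborel2. W z = 0"
    using Wnn by (subst (asm) nn_integral_0_iff_AE) (auto simp: order.antisym)
  then have W0: "AE x in lborel. AE y in lborel. W (x, y) = 0"
    by (rule lborel_pair.AE_pair)
  show ?thesis
  proof (cases "AE x in lborel. l < x \<bullet> e \<and> norm x < R \<longrightarrow> 0 < gap e l x")
    case False
    have "\<exists>x. l < x \<bullet> e \<and> norm x < R \<and> gap e l x = 0 \<and> (AE y in lborel. W (x, y) = 0)"
    proof (rule ccontr)
      assume *: "\<not> ?thesis"
      from W0 nonneg have "AE x in lborel. l < x \<bullet> e \<and> norm x < R \<longrightarrow> 0 < gap e l x"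
        by eventually_elim (use * in fastforce)
      with False show False by simp
    qed
    then obtain x where x: "l < x \<bullet> e" "norm x < R" "gap e l x = 0" and Wx: "AE y in lborel. W (x, y) = 0" by blast
    from Wx nonneg have "AE y in lborel. l < y \<bullet> e \<longrightarrow> gap e l y = 0"
    proof eventually_elim
      case (elim y)
      show ?case
      proof (rule impI, rule ccontr)
        assume y: "l < y \<bullet> e" and "gap e l y \<noteq> 0"
        then have gy: "0 < gap e l y" using elim by simp
        then have "x \<noteq> y" using x by auto
        then have "kern \<sigma> (x - ?S y) < kern \<sigma> (x - y)" using x y sigma e by (intro kern_mirror_less) auto
        then have "0 < W (x, y)" using x y gy cap_cutoff_pos[OF x(2,1)] c0_pos by (simp add: W_def)
        then show False using elim by simp
      qed
    qed
    then show ?thesis by blast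
  qed blast
qed

end

section \<open>The method of moving planes\<close>

lemma AE_notin_open_imp_empty:
  fixes S :: "'a::euclidean_space set"
  assumes "open S" and ae: "AE x in lborel. x \<notin> S"
  shows "S = {}"
proof (rule ccontr)
  assume "S \<noteq> {}"
  then obtain x r where r: "0 < r" "ball x r \<subseteq> S" using \<open>open S\<close> by (meson openE ex_in_conv)
  have "AE y in lborel. y \<notin> ball x r" using ae by eventually_elim (use r in auto)
  then have "emeasure lborel (ball x r) = 0"
    by (subst (asm) AE_iff_measurable[OF _ refl]) (auto simp: ball_def)
  then show False using r unit_vol_pos[where 'a='a] by (simp add: emeasure_ball_pow not_le[symmetric] mult_le_0_iff)
qed

text \<open>Finite energy gives a modulus of continuity for translations in \<open>L\<^sup>p\<close>: compare \<open>u(x + h)\<close> and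
  \<open>u(x)\<close> with \<open>u(y)\<close> for all \<open>y\<close> in the ball of radius \<open>|h|\<close> around \<open>x\<close>.\<close>

lemma translation_estimate:
  fixes u :: "'a::euclidean_space \<Rightarrow> real"
  assumes \<sigma>: "0 < \<sigma>" and p: "1 < p" and [measurable]: "u \<in> borel_measurable borel"
    and fin: "energy \<sigma> p u < \<infinity>"
  obtains C where "0 \<le> C"
    "\<And>h. h \<noteq> 0 \<Longrightarrow> (\<integral>\<^sup>+x. ennreal (\<bar>u (x + h) - u x\<bar> powr p) \<partial>lborel) \<le> ennreal (C * norm h powr \<sigma>)"
proof -
  let ?N = "real DIM('a)" and ?w = "unit_ball_vol (real DIM('a))"
  have w: "0 < ?w" by (rule unit_vol_pos)
  obtain E where E: "energy \<sigma> p u = ennreal E" "0 \<le> E" using fin by (cases "energy \<sigma> p u") auto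
  define C where "C = 2 powr p * 2 powr (?N + \<sigma>) * (2 * E) / ?w"
  have C: "0 \<le> C" using E w by (simp add: C_def)
  define G where "G = (\<lambda>x y. ennreal (\<bar>u x - u y\<bar> powr p * kern \<sigma> (x - y)))"
  have "(\<integral>\<^sup>+x. ennreal (\<bar>u (x + h) - u x\<bar> powr p) \<partial>lborel) \<le> ennreal (C * norm h powr \<sigma>)" if h: "h \<noteq> 0" for h
  proof -
    define d where "d = norm h"
    have d: "0 < d" using h by (simp add: d_def)
    let ?c = "2 powr p * (2 * d) powr (?N + \<sigma>)"
    have near: "\<bar>u v - u y\<bar> powr p \<le> (2 * d) powr (?N + \<sigma>) * (\<bar>u v - u y\<bar> powr p * kern \<sigma> (v - y))"
      if "norm (v - y) \<le> 2 * d" for v y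
    proof (cases "v = y")
      case False
      have "1 = (2 * d) powr (?N + \<sigma>) * (2 * d) powr - (?N + \<sigma>)" using d by (simp add: powr_add[symmetric])
      also have "\<dots> \<le> (2 * d) powr (?N + \<sigma>) * kern \<sigma> (v - y)"
        using False that \<sigma> by (intro mult_left_mono kern_lower) auto
      finally have "1 * \<bar>u v - u y\<bar> powr p \<le> ((2 * d) powr (?N + \<sigma>) * kern \<sigma> (v - y)) * \<bar>u v - u y\<bar> powr p"
        by (rule mult_right_mono) simp
      then show ?thesis by (simp add: mult_ac)
    qed simp
    have pw: "ennreal (\<bar>u (x + h) - u x\<bar> powr p) * indicator (ball x d) y
        \<le> ennreal ?c * (G (x + h) y + G x y)" for x y
    proof (cases "y \<in> ball x d")
      case True
      then have n: "norm (x - y) \<le> 2 * d" "norm (x + h - y) \<le> 2 * d"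
        using norm_triangle_ineq[of "x - y" h] norm_ge_zero[of h]
        by (auto simp: dist_norm d_def algebra_simps simp del: norm_ge_zero)
      have "\<bar>u (x + h) - u x\<bar> powr p \<le> (\<bar>u (x + h) - u y\<bar> + \<bar>u x - u y\<bar>) powr p"
        using p by (intro powr_mono2) auto
      also have "\<dots> \<le> 2 powr p * (\<bar>u (x + h) - u y\<bar> powr p + \<bar>u x - u y\<bar> powr p)"
        using p by (intro powr_add_le) auto
      also have "\<dots> \<le> 2 powr p * ((2 * d) powr (?N + \<sigma>) * (\<bar>u (x + h) - u y\<bar> powr p * kern \<sigma> (x + h - y))
          + (2 * d) powr (?N + \<sigma>) * (\<bar>u x - u y\<bar> powr p * kern \<sigma> (x - y)))"
        using n by (intro mult_left_mono add_mono near) auto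
      also have "\<dots> = ?c * (\<bar>u (x + h) - u y\<bar> powr p * kern \<sigma> (x + h - y) + \<bar>u x - u y\<bar> powr p * kern \<sigma> (x - y))"
        by (simp only: distrib_left mult.assoc)
      finally have "ennreal (\<bar>u (x + h) - u x\<bar> powr p)
          \<le> ennreal (?c * (\<bar>u (x + h) - u y\<bar> powr p * kern \<sigma> (x + h - y) + \<bar>u x - u y\<bar> powr p * kern \<sigma> (x - y)))"
        by (rule ennreal_leI)
      also have "\<dots> = ennreal ?c * (G (x + h) y + G x y)"
        unfolding G_def by (subst ennreal_mult) (auto simp del: ennreal_plus simp: ennreal_plus[symmetric])
      finally show ?thesis using True by simp
    qed simp
    have avg: "ennreal (?w * d ^ DIM('a)) * ennreal (\<bar>u (x + h) - u x\<bar> powr p)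
        \<le> (\<integral>\<^sup>+y. ennreal ?c * (G (x + h) y + G x y) \<partial>lborel)" for x
    proof -
      have "ennreal (?w * d ^ DIM('a)) * ennreal (\<bar>u (x + h) - u x\<bar> powr p)
          = (\<integral>\<^sup>+y. ennreal (\<bar>u (x + h) - u x\<bar> powr p) * indicator (ball x d) y \<partial>lborel)"
        using d by (subst nn_integral_cmult_indicator) (auto simp: emeasure_ball_pow mult.commute)
      also have "\<dots> \<le> (\<integral>\<^sup>+y. ennreal ?c * (G (x + h) y + G x y) \<partial>lborel)"
        by (rule nn_integral_mono) (rule pw)
      finally show ?thesis .
    qed
    define Fg where "Fg = (\<lambda>x. \<integral>\<^sup>+y. G x y \<partial>lborel)"
    have [measurable]: "case_prod G \<in> borel_measurable lborel2" unfolding G_def by measurable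
    have Fm[measurable]: "Fg \<in> borel_measurable borel"
      unfolding Fg_def G_def by measurable
    have FE: "(\<integral>\<^sup>+x. Fg x \<partial>lborel) = ennreal E"
      unfolding Fg_def G_def E(1)[symmetric] by (rule energy_iterated[symmetric]) measurable
    have "ennreal (?w * d ^ DIM('a)) * (\<integral>\<^sup>+x. ennreal (\<bar>u (x + h) - u x\<bar> powr p) \<partial>lborel)
        = (\<integral>\<^sup>+x. ennreal (?w * d ^ DIM('a)) * ennreal (\<bar>u (x + h) - u x\<bar> powr p) \<partial>lborel)"
      by (rule nn_integral_cmult[symmetric]) measurable
    also have "\<dots> \<le> (\<integral>\<^sup>+x. \<integral>\<^sup>+y. ennreal ?c * (G (x + h) y + G x y) \<partial>lborel \<partial>lborel)"
      by (rule nn_integral_mono) (rule avg)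
    also have "\<dots> = (\<integral>\<^sup>+x. ennreal ?c * (Fg (x + h) + Fg x) \<partial>lborel)"
    proof (rule nn_integral_cong)
      fix x
      have [measurable]: "G v \<in> borel_measurable lborel" for v unfolding G_def by measurable
      have "(\<integral>\<^sup>+y. ennreal ?c * (G (x + h) y + G x y) \<partial>lborel) = ennreal ?c * (\<integral>\<^sup>+y. G (x + h) y + G x y \<partial>lborel)"
        by (rule nn_integral_cmult) measurable
      also have "(\<integral>\<^sup>+y. G (x + h) y + G x y \<partial>lborel) = Fg (x + h) + Fg x"
        unfolding Fg_def by (rule nn_integral_add) measurable
      finally show "(\<integral>\<^sup>+y. ennreal ?c * (G (x + h) y + G x y) \<partial>lborel) = ennreal ?c * (Fg (x + h) + Fg x)" .
    qed
    also have "\<dots> = ennreal ?c * ((\<integral>\<^sup>+x. Fg (x + h) \<partial>lborel) + (\<integral>\<^sup>+x. Fg x \<partial>lborel))"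
      by (simp add: nn_integral_cmult nn_integral_add)
    also have "(\<integral>\<^sup>+x. Fg (x + h) \<partial>lborel) = ennreal E"
      using nn_integral_lborel_translate[OF Fm, of h] FE by simp
    also have "ennreal ?c * (ennreal E + (\<integral>\<^sup>+x. Fg x \<partial>lborel)) = ennreal (?c * (E + E))"
      unfolding FE using E(2) by (simp only: ennreal_plus[symmetric] ennreal_mult[symmetric] mult_nonneg_nonneg powr_ge_zero add_nonneg_nonneg)
    also have "?c * (E + E) = (?w * d ^ DIM('a)) * (C * d powr \<sigma>)"
    proof -
      have "(2 * d) powr (?N + \<sigma>) = 2 powr (?N + \<sigma>) * (d powr ?N * d powr \<sigma>)"
        using d by (simp add: powr_mult powr_add)
      also have "d powr ?N = d ^ DIM('a)" using d by (simp add: powr_realpow)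
      finally have "?c * (E + E) = 2 powr p * 2 powr (?N + \<sigma>) * (2 * E) * (d ^ DIM('a) * d powr \<sigma>)"
        by (simp add: mult_ac)
      moreover have "2 powr p * 2 powr (?N + \<sigma>) * (2 * E) = ?w * C"
      proof -
        have "?w \<noteq> 0" using w by linarith
        moreover have "w * (Z / w) = Z" if "w \<noteq> 0" for w Z :: real using that by simp
        ultimately show ?thesis unfolding C_def by metis
      qed
      ultimately have "?c * (E + E) = ?w * C * (d ^ DIM('a) * d powr \<sigma>)" by (simp only:)
      then show ?thesis by (simp only: mult_ac)
    qed
    also have "ennreal ((?w * d ^ DIM('a)) * (C * d powr \<sigma>)) = ennreal (?w * d ^ DIM('a)) * ennreal (C * d powr \<sigma>)"
      using w d by (intro ennreal_mult') simp
    finally have le: "ennreal (?w * d ^ DIM('a)) * (\<integral>\<^sup>+x. ennreal (\<bar>u (x + h) - u x\<bar> powr p) \<partial>lborel)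
        \<le> ennreal (?w * d ^ DIM('a)) * ennreal (C * d powr \<sigma>)" .
    have "0 < ?w * d ^ DIM('a)" using w d by (intro mult_pos_pos) auto
    moreover have "X \<le> Z" if "0 < k" "ennreal k * X \<le> ennreal k * Z" for k X Z
      using that by (subst (asm) ennreal_mult_le_mult_iff) auto
    ultimately show ?thesis using le unfolding d_def[symmetric] by blast
  qed
  then show ?thesis using that C by blast
qed

lemma mirror_shift: "mirror e l' x = mirror e l x + (2 * (l' - l)) *\<^sub>R e"
  by (simp add: mirror_def algebra_simps)

context bounded_solution
begin

lemma mirror_estimate:
  obtains C where "0 \<le> C"
    "\<And>e l l'. norm e = 1 \<Longrightarrow> l \<noteq> l' \<Longrightarrow>
      (\<integral>\<^sup>+x. ennreal (\<bar>gap e l' x - gap e l x\<bar> powr p) \<partial>lborel) \<le> ennreal (C * (2 * \<bar>l' - l\<bar>) powr \<sigma>)"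
proof -
  obtain C where C: "0 \<le> C"
    "\<And>h. h \<noteq> 0 \<Longrightarrow> (\<integral>\<^sup>+x. ennreal (\<bar>u (x + h) - u x\<bar> powr p) \<partial>lborel) \<le> ennreal (C * norm h powr \<sigma>)"
    using translation_estimate[OF sigma(1) p(1) u_measurable u_energy] by blast
  have "(\<integral>\<^sup>+x. ennreal (\<bar>gap e l' x - gap e l x\<bar> powr p) \<partial>lborel) \<le> ennreal (C * (2 * \<bar>l' - l\<bar>) powr \<sigma>)"
    if e: "norm e = 1" and ll: "l \<noteq> l'" for e l l'
  proof -
    let ?h = "(2 * (l' - l)) *\<^sub>R e"
    have h: "?h \<noteq> 0" "norm ?h = 2 * \<bar>l' - l\<bar>"
    proof -
      have "e \<noteq> 0" using e by auto
      then show "?h \<noteq> 0" using ll by simp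
      show "norm ?h = 2 * \<bar>l' - l\<bar>" by (simp only: norm_scaleR e abs_mult abs_numeral mult_1_right)
    qed
    have "(\<integral>\<^sup>+x. ennreal (\<bar>gap e l' x - gap e l x\<bar> powr p) \<partial>lborel)
        = (\<integral>\<^sup>+x. (\<lambda>x. ennreal (\<bar>u (x + ?h) - u x\<bar> powr p)) (mirror e l x) \<partial>lborel)"
      by (simp add: gap_def mirror_shift[of e l' _ l])
    also have "\<dots> = (\<integral>\<^sup>+x. ennreal (\<bar>u (x + ?h) - u x\<bar> powr p) \<partial>lborel)"
      by (rule nn_integral_mirror[OF e]) measurable
    also have "\<dots> \<le> ennreal (C * (2 * \<bar>l' - l\<bar>) powr \<sigma>)" using C(2)[OF h(1)] unfolding h(2) .
    finally show ?thesis .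
  qed
  then show ?thesis using that C(1) by blast
qed

definition good_plane :: "'a \<Rightarrow> real \<Rightarrow> bool" where
  "good_plane e l \<longleftrightarrow> (AE x in lborel. l < x \<bullet> e \<longrightarrow> 0 \<le> gap e l x)"

text \<open>On a fixed half-space the negative part of the gap for \<open>l\<close> is bounded by the change of the gap
  from \<open>l\<close> to \<open>l'\<close>, whose \<open>L\<^sup>p\<close> norm tends to \<open>0\<close>.\<close>

lemma good_plane_closed:
  assumes e: "norm e = 1" and good: "\<And>l'. l < l' \<Longrightarrow> good_plane e l'"
  shows "good_plane e l"
proof -
  obtain C where C: "0 \<le> C" "\<And>e l l'. norm e = 1 \<Longrightarrow> l \<noteq> l' \<Longrightarrow>
      (\<integral>\<^sup>+x. ennreal (\<bar>gap e l' x - gap e l x\<bar> powr p) \<partial>lborel) \<le> ennreal (C * (2 * \<bar>l' - l\<bar>) powr \<sigma>)"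
    using mirror_estimate by blast
  have step: "AE x in lborel. l1 < x \<bullet> e \<longrightarrow> 0 \<le> gap e l x" if l1: "l < l1" for l1
  proof -
    define g where "g = (\<lambda>x. if l1 < x \<bullet> e then max (- gap e l x) 0 else 0)"
    have [measurable]: "g \<in> borel_measurable borel" unfolding g_def by measurable
    let ?v = "\<integral>\<^sup>+x. ennreal (g x powr p) \<partial>lborel"
    have le: "?v \<le> ennreal (C * (2 * \<bar>l' - l\<bar>) powr \<sigma>)" if l': "l < l'" "l' < l1" for l'
    proof -
      have "?v \<le> (\<integral>\<^sup>+x. ennreal (\<bar>gap e l' x - gap e l x\<bar> powr p) \<partial>lborel)"
      proof (rule nn_integral_mono_AE)
        show "AE x in lborel. ennreal (g x powr p) \<le> ennreal (\<bar>gap e l' x - gap e l x\<bar> powr p)"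
          using good[OF l'(1), unfolded good_plane_def]
        proof eventually_elim
          case (elim x)
          have "g x \<le> \<bar>gap e l' x - gap e l x\<bar>" "0 \<le> g x" using elim l' by (auto simp: g_def)
          then show ?case using p by (intro ennreal_leI powr_mono2) auto
        qed
      qed
      also have "\<dots> \<le> ennreal (C * (2 * \<bar>l' - l\<bar>) powr \<sigma>)" using l' by (intro C(2) e) auto
      finally show ?thesis .
    qed
    have "(\<lambda>n. ennreal (C * (2 * ((l1 - l) / real (Suc (Suc n)))) powr \<sigma>)) \<longlonglongrightarrow> ennreal (C * (2 * 0) powr \<sigma>)"
      using sigma l1 by (intro tendsto_ennrealI tendsto_intros tendsto_powr' LIMSEQ_Suc[OF LIMSEQ_Suc[OF lim_const_over_n]])
        (auto intro!: always_eventually)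
    moreover have "?v \<le> ennreal (C * (2 * ((l1 - l) / real (Suc (Suc n)))) powr \<sigma>)" for n
    proof -
      define l' where "l' = l + (l1 - l) / real (Suc (Suc n))"
      have "(l1 - l) / real (Suc (Suc n)) < (l1 - l) / 1" using l1 by (intro divide_strict_left_mono) auto
      then have "l < l'" "l' < l1" using l1 by (auto simp: l'_def)
      then show ?thesis using le[of l'] l1 by (simp add: l'_def)
    qed
    ultimately have "?v \<le> ennreal (C * (2 * 0) powr \<sigma>)" by (intro LIMSEQ_le_const) auto
    then have "?v = 0" by simp
    then have "AE x in lborel. ennreal (g x powr p) = 0" by (subst (asm) nn_integral_0_iff_AE) auto
    then show ?thesis by eventually_elim (auto simp: g_def max_def split: if_splits)
  qed
  have "AE x in lborel. \<forall>n::nat. l + 1 / real (Suc n) < x \<bullet> e \<longrightarrow> 0 \<le> gap e l x"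
    unfolding AE_all_countable by (intro allI step) simp
  then show ?thesis unfolding good_plane_def
  proof eventually_elim
    case (elim x)
    show ?case
    proof
      assume "l < x \<bullet> e"
      then obtain n :: nat where "1 / real (Suc n) < x \<bullet> e - l"
        using nat_approx_posE[of "x \<bullet> e - l"] by auto
      then show "0 \<le> gap e l x" using elim[rule_format, of n] by simp
    qed
  qed
qed

text \<open>Openness: if the gap is strictly positive for one plane, then for slightly lower planes the set
  where it is negative has small measure, because the gap depends continuously on the plane in
  measure.\<close>

lemma bad_set_small:
  assumes e: "norm e = 1" and l: "0 < l" and m: "0 < m"
    and strict: "AE x in lborel. l < x \<bullet> e \<and> norm x < R \<longrightarrow> 0 < gap e l x"
  obtains \<delta> where "0 < \<delta>" "\<And>l'. l - \<delta> < l' \<Longrightarrow> l' < l \<Longrightarrow> 0 \<le> l' \<Longrightarrow>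
    emeasure lborel {x. l' < x \<bullet> e \<and> gap e l' x < 0} \<le> ennreal m"
proof -
  obtain C where C: "0 \<le> C" "\<And>e l l'. norm e = 1 \<Longrightarrow> l \<noteq> l' \<Longrightarrow>
      (\<integral>\<^sup>+x. ennreal (\<bar>gap e l' x - gap e l x\<bar> powr p) \<partial>lborel) \<le> ennreal (C * (2 * \<bar>l' - l\<bar>) powr \<sigma>)"
    using mirror_estimate by blast
  define D where "D = (\<lambda>n::nat. {x. norm x < R \<and> ((l - 1 / real (Suc n) < x \<bullet> e \<and> x \<bullet> e \<le> l)
      \<or> (l < x \<bullet> e \<and> gap e l x < 1 / real (Suc n)))})"
  have Dm: "D n \<in> sets lborel" for n unfolding D_def by measurable
  have "decseq D"
  proof (rule decseq_SucI, rule subsetI)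
    fix n x
    have "1 / real (Suc (Suc n)) \<le> 1 / real (Suc n)" by (intro divide_left_mono) auto
    then show "x \<in> D (Suc n) \<Longrightarrow> x \<in> D n" by (auto simp: D_def simp del: of_nat_Suc)
  qed
  moreover have "emeasure lborel (D n) \<noteq> \<infinity>" for n
  proof -
    have "emeasure lborel (D n) \<le> emeasure lborel (ball (0::'a) R)" by (rule emeasure_mono) (auto simp: D_def)
    also have "\<dots> < \<infinity>" using R by (simp add: emeasure_ball_pow)
    finally show ?thesis by simp
  qed
  ultimately have lim: "(\<lambda>n. emeasure lborel (D n)) \<longlonglongrightarrow> emeasure lborel (\<Inter>n. D n)"
    using Dm by (intro Lim_emeasure_decseq) auto
  have "emeasure lborel (\<Inter>n. D n) = 0"
  proof -
    have "{x. e \<bullet> x = l} \<in> null_sets lborel"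
    proof -
      have "e \<noteq> 0" using e by auto
      then have "negligible {x. e \<bullet> x = l}" by (intro negligible_hyperplane) simp
      then show ?thesis by (simp add: negligible_iff_null_sets null_sets_completion_iff)
    qed
    then have "AE x in lborel. x \<bullet> e \<noteq> l" by (auto dest!: AE_not_in simp: inner_commute)
    with strict have "AE x in lborel. x \<notin> (\<Inter>n. D n)"
    proof eventually_elim
      case (elim x)
      show ?case
      proof
        assume x: "x \<in> (\<Inter>n. D n)"
        then have xD: "x \<in> D n" for n by auto
        have nx: "norm x < R" using xD[of 0] by (simp add: D_def)
        consider "l < x \<bullet> e" | "x \<bullet> e < l" using elim by linarith
        then show False
        proof cases
          case 1
          then have "0 < gap e l x" using elim nx by simp
          then obtain n :: nat where "1 / real (Suc n) < gap e l x" using nat_approx_posE by blast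
          then show False using xD[of n] 1 by (auto simp: D_def)
        next
          case 2
          then obtain n :: nat where "1 / real (Suc n) < l - x \<bullet> e" using nat_approx_posE[of "l - x \<bullet> e"] by auto
          then show False using xD[of n] 2 by (auto simp: D_def)
        qed
      qed
    qed
    then show ?thesis using Dm by (subst (asm) AE_iff_measurable[OF _ refl]) (auto simp: INTER_eq)
  qed
  with lim have "(\<lambda>n. emeasure lborel (D n)) \<longlonglongrightarrow> 0" by simp
  then have "eventually (\<lambda>n. emeasure lborel (D n) < ennreal (m / 2)) sequentially"
    using m by (intro order_tendstoD(2)) auto
  then obtain n where n: "emeasure lborel (D n) < ennreal (m / 2)" unfolding eventually_sequentially by blast
  define \<tau> where "\<tau> = 1 / real (Suc n)"
  have \<tau>: "0 < \<tau>" by (simp add: \<tau>_def)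
  have Dn: "D n = {x. norm x < R \<and> ((l - \<tau> < x \<bullet> e \<and> x \<bullet> e \<le> l) \<or> (l < x \<bullet> e \<and> gap e l x < \<tau>))}"
    by (simp only: D_def \<tau>_def)
  define \<delta>' where "\<delta>' = (m / 2 * \<tau> powr p / (C + 1)) powr (1 / \<sigma>) / 2"
  have \<delta>': "0 < \<delta>'" using m \<tau> C(1) by (simp add: \<delta>'_def)
  show ?thesis
  proof (rule that[of "min \<tau> \<delta>'"])
    show "0 < min \<tau> \<delta>'" using \<tau> \<delta>' by simp
    fix l' assume l': "l - min \<tau> \<delta>' < l'" "l' < l" "0 \<le> l'"
    define Z where "Z = {x. \<tau> < \<bar>gap e l' x - gap e l x\<bar>}"
    have [measurable]: "Z \<in> sets borel" unfolding Z_def by measurable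
    have sub: "{x. l' < x \<bullet> e \<and> gap e l' x < 0} \<subseteq> D n \<union> Z"
    proof
      fix x assume x: "x \<in> {x. l' < x \<bullet> e \<and> gap e l' x < 0}"
      have nx: "norm x < R"
      proof (rule ccontr)
        assume "\<not> norm x < R"
        then have "u x = 0" using u_outside[of x] by simp
        then show False using x u_nonneg[of "mirror e l' x"] by (simp add: gap_def)
      qed
      have "l - \<tau> < l'" using l' by (auto simp: min_def split: if_splits)
      then show "x \<in> D n \<union> Z"
        using x nx l' by (auto simp: Dn Z_def)
    qed
    have "emeasure lborel Z \<le> ennreal ((C * (2 * \<bar>l' - l\<bar>) powr \<sigma>) * \<tau> powr - p)"
      unfolding Z_def
    proof (rule chebyshev_powr)
      have "(\<integral>\<^sup>+y. indicator {y. \<tau> < \<bar>gap e l' y - gap e l y\<bar>} y * ennreal (\<bar>gap e l' y - gap e l y\<bar> powr p) \<partial>lborel)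
          \<le> (\<integral>\<^sup>+y. ennreal (\<bar>gap e l' y - gap e l y\<bar> powr p) \<partial>lborel)"
        by (rule nn_integral_mono) (auto simp: indicator_def)
      also have "\<dots> \<le> ennreal (C * (2 * \<bar>l' - l\<bar>) powr \<sigma>)" using l' by (intro C(2) e) auto
      finally show "(\<integral>\<^sup>+y. indicator {y. \<tau> < \<bar>gap e l' y - gap e l y\<bar>} y * ennreal (\<bar>gap e l' y - gap e l y\<bar> powr p) \<partial>lborel)
          \<le> ennreal (C * (2 * \<bar>l' - l\<bar>) powr \<sigma>)" .
    qed (use \<tau> p in auto)
    also have "\<dots> \<le> ennreal (m / 2)"
    proof (rule ennreal_leI)
      have "(2 * \<bar>l' - l\<bar>) powr \<sigma> \<le> (2 * \<delta>') powr \<sigma>" using l' sigma by (intro powr_mono2) auto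
      also have "\<dots> = m / 2 * \<tau> powr p / (C + 1)" using sigma m \<tau> C(1) by (simp add: \<delta>'_def powr_powr)
      finally have "C * (2 * \<bar>l' - l\<bar>) powr \<sigma> \<le> C * (m / 2 * \<tau> powr p / (C + 1))"
        using C(1) by (rule mult_left_mono)
      also have "\<dots> = (C / (C + 1)) * (m / 2 * \<tau> powr p)" by simp
      also have "\<dots> \<le> 1 * (m / 2 * \<tau> powr p)" using C(1) m by (intro mult_right_mono) auto
      finally have "(C * (2 * \<bar>l' - l\<bar>) powr \<sigma>) * \<tau> powr - p \<le> (1 * (m / 2 * \<tau> powr p)) * \<tau> powr - p"
        by (rule mult_right_mono) simp
      also have "\<dots> = m / 2" using \<tau> by (simp add: mult.assoc powr_add[symmetric])
      finally show "(C * (2 * \<bar>l' - l\<bar>) powr \<sigma>) * \<tau> powr - p \<le> m / 2" .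
    qed
    finally have Z: "emeasure lborel Z \<le> ennreal (m / 2)" .
    have "emeasure lborel {x. l' < x \<bullet> e \<and> gap e l' x < 0} \<le> emeasure lborel (D n \<union> Z)"
      using Dm[of n] by (intro emeasure_mono sub) auto
    also have "\<dots> \<le> emeasure lborel (D n) + emeasure lborel Z"
      using Dm[of n] by (intro emeasure_subadditive) auto
    also have "\<dots> \<le> ennreal (m / 2) + ennreal (m / 2)" using n Z by (intro add_mono) auto
    also have "\<dots> = ennreal m" using m by (simp flip: ennreal_plus)
    finally show "emeasure lborel {x. l' < x \<bullet> e \<and> gap e l' x < 0} \<le> ennreal m" .
  qed
qed

text \<open>The support reaches the boundary in every direction. Otherwise a plane just beyond the support
  would give a gap that is nonnegative and not identically zero, but vanishes on the strip next to the
  plane.\<close>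

lemma support_reaches:
  assumes nontrivial: "\<not> (AE x in lborel. u x = 0)" and e: "norm e = 1" and l: "0 \<le> l" "l < R"
  shows "\<not> (AE x in lborel. l < x \<bullet> e \<longrightarrow> u x = 0)"
proof
  assume zero: "AE x in lborel. l < x \<bullet> e \<longrightarrow> u x = 0"
  define l' where "l' = (l + R) / 2"
  have l': "l < l'" "l' < R" "0 \<le> l'" using l by (auto simp: l'_def)
  let ?S = "mirror e l'"
  have "AE x in lborel. l' < x \<bullet> e \<longrightarrow> 0 \<le> gap e l' x"
    using zero by eventually_elim (use l' u_nonneg in \<open>auto simp: gap_def\<close>)
  from strong_max_principle[OF e l'(3) this] show False
  proof
    assume "AE x in lborel. l' < x \<bullet> e \<longrightarrow> gap e l' x = 0"
    then have "AE x in lborel. l' < ?S x \<bullet> e \<longrightarrow> gap e l' (?S x) = 0"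
      by (intro AE_mirror[OF e, of "\<lambda>x. l' < x \<bullet> e \<longrightarrow> gap e l' x = 0"]) measurable
    moreover have "AE x in lborel. l < ?S x \<bullet> e \<longrightarrow> u (?S x) = 0"
      using zero by (intro AE_mirror[OF e, of "\<lambda>x. l < x \<bullet> e \<longrightarrow> u x = 0"]) measurable
    ultimately have "AE x in lborel. u x = 0" using zero
    proof eventually_elim
      case (elim x)
      show ?case
      proof (cases "l < x \<bullet> e")
        case False
        then have "l' < ?S x \<bullet> e" using l' by (simp add: mirror_inner[OF e])
        then show ?thesis using elim l' e by (simp add: gap_mirror[OF e] gap_def)
      qed (use elim in simp)
    qed
    then show False using nontrivial by simp
  next
    assume pos: "AE x in lborel. l' < x \<bullet> e \<and> norm x < R \<longrightarrow> 0 < gap e l' x"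
    have "AE x in lborel. l < ?S x \<bullet> e \<longrightarrow> u (?S x) = 0"
      using zero by (intro AE_mirror[OF e, of "\<lambda>x. l < x \<bullet> e \<longrightarrow> u x = 0"]) measurable
    with pos zero have "AE x in lborel. x \<notin> {x. l' < x \<bullet> e} \<inter> ball 0 R"
    proof eventually_elim
      case (elim x)
      show ?case
      proof
        assume "x \<in> {x. l' < x \<bullet> e} \<inter> ball 0 R"
        then have x: "l' < x \<bullet> e" "norm x < R" by auto
        have "x \<bullet> e \<le> norm x" using norm_cauchy_schwarz[of x e] e by simp
        moreover have "2 * l' = l + R" by (simp add: l'_def)
        ultimately have "l < ?S x \<bullet> e" using x unfolding mirror_inner[OF e] by linarith
        then have "gap e l' x = 0" using elim x l' by (simp add: gap_def)
        then show False using elim x by simp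
      qed
    qed
    then have "{x. l' < x \<bullet> e} \<inter> ball 0 R = {}"
      using open_halfspace_gt[of l' e] by (intro AE_notin_open_imp_empty open_Int) (simp_all add: inner_commute)
    moreover have "((l' + R) / 2) *\<^sub>R e \<in> {x. l' < x \<bullet> e} \<inter> ball 0 R"
      using e l' R by (simp add: dot_square_norm)
    ultimately show False by blast
  qed
qed

text \<open>An identically vanishing gap would carry the zero values from beyond the ball to the opposite
  cap, so the support would not reach the boundary there.\<close>

lemma good_plane_strict:
  assumes nontrivial: "\<not> (AE x in lborel. u x = 0)" and e: "norm e = 1" and l: "0 < l" "l < R"
    and good: "good_plane e l"
  shows "AE x in lborel. l < x \<bullet> e \<and> norm x < R \<longrightarrow> 0 < gap e l x"
  using strong_max_principle[OF e less_imp_le[OF l(1)] good[unfolded good_plane_def]]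
proof
  let ?S = "mirror e l"
  assume "AE x in lborel. l < x \<bullet> e \<longrightarrow> gap e l x = 0"
  then have "AE x in lborel. l < ?S x \<bullet> e \<longrightarrow> gap e l (?S x) = 0"
    by (intro AE_mirror[OF e, of "\<lambda>x. l < x \<bullet> e \<longrightarrow> gap e l x = 0"]) measurable
  then have "AE x in lborel. max (R - 2 * l) 0 < x \<bullet> (- e) \<longrightarrow> u x = 0"
  proof eventually_elim
    case (elim x)
    show ?case
    proof
      assume x: "max (R - 2 * l) 0 < x \<bullet> (- e)"
      then have R': "R < ?S x \<bullet> e" by (simp add: mirror_inner[OF e])
      moreover have "?S x \<bullet> e \<le> norm (?S x)" using norm_cauchy_schwarz[of "?S x" e] e by simp
      ultimately have "u (?S x) = 0" by (intro u_outside) simp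
      then show "u x = 0" using elim R' l e by (simp add: gap_mirror[OF e] gap_def)
    qed
  qed
  moreover have "norm (- e) = 1" using e by simp
  ultimately have False using support_reaches[OF nontrivial, of "- e" "max (R - 2 * l) 0"] l by auto
  then show ?thesis ..
qed

text \<open>Let \<open>a\<close> be the lowest position down to which all planes are good. It is attained by closedness; if
  it were positive, the gap would be positive there, and planes slightly below would have a small bad
  set and therefore be good as well.\<close>

lemma all_planes_good:
  assumes nontrivial: "\<not> (AE x in lborel. u x = 0)" and e: "norm e = 1" and "0 \<le> l"
  shows "good_plane e l"
proof -
  let ?N = "real DIM('a)" and ?mc = "mass_const TYPE('a) \<sigma>"
  have mc: "0 < c0 * ?mc" using c0_pos mass_const_pos[where 'a='a, of \<sigma>] by simp
  \<comment> \<open>Below this measure the maximum principle on small sets applies.\<close>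
  define m where "m = ((4 * L + 1) / (c0 * ?mc)) powr (- ?N / \<sigma>)"
  have base: "0 < (4 * L + 1) / (c0 * ?mc)" using mc L by simp
  then have m: "0 < m" unfolding m_def by (intro powr_gt_zero[THEN iffD2]) linarith
  have "m powr (- \<sigma> / ?N) = (4 * L + 1) / (c0 * ?mc)"
  proof -
    have "(b powr (- ?N / \<sigma>)) powr (- \<sigma> / ?N) = b" if "0 < b" for b
      using that sigma by (simp add: powr_powr)
    then show ?thesis unfolding m_def using base by blast
  qed
  then have "c0 * (?mc * m powr (- \<sigma> / ?N)) = (c0 * ?mc) * ((4 * L + 1) / (c0 * ?mc))" by (simp only: mult.assoc)
  also have "\<dots> = 4 * L + 1"
  proof -
    have "k * (z / k) = z" if "0 < k" for k z :: real using that by simp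
    then show ?thesis using mc by blast
  qed
  finally have "c0 * (?mc * m powr (- \<sigma> / ?N)) = 4 * L + 1" .
  then have small: "4 * L < c0 * (?mc * m powr (- \<sigma> / ?N))" by simp
  have outer: "good_plane e l'" if "R \<le> l'" for l'
    unfolding good_plane_def
  proof (rule AE_I2, rule impI)
    fix x assume "l' < x \<bullet> e"
    moreover have "x \<bullet> e \<le> norm x" using norm_cauchy_schwarz[of x e] e by simp
    ultimately have "u x = 0" using that by (intro u_outside) simp
    then show "0 \<le> gap e l' x" using u_nonneg by (simp add: gap_def)
  qed
  define A where "A = {a. 0 \<le> a \<and> (\<forall>l'\<ge>a. good_plane e l')}"
  have RA: "R \<in> A" using R outer by (simp add: A_def)
  have bdd: "bdd_below A" by (rule bdd_belowI[of _ 0]) (simp add: A_def)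
  define a where "a = Inf A"
  have a0: "0 \<le> a" unfolding a_def using RA by (intro cInf_greatest) (auto simp: A_def)
  have aR: "a \<le> R" unfolding a_def using RA bdd by (rule cInf_lower)
  have above: "good_plane e l'" if al: "a < l'" for l'
  proof -
    have "A \<noteq> {}" using RA by auto
    then obtain b where "b \<in> A" "b < l'" using al cInf_less_iff[OF _ bdd, of l'] by (auto simp: a_def)
    then show ?thesis by (auto simp: A_def)
  qed
  have ga: "good_plane e a" by (rule good_plane_closed[OF e above])
  have "a = 0"
  proof (rule ccontr)
    assume "a \<noteq> 0"
    then have apos: "0 < a" using a0 by simp
    have "AE x in lborel. a < x \<bullet> e \<and> norm x < R \<longrightarrow> 0 < gap e a x"
    proof (cases "a < R")
      case True then show ?thesis by (intro good_plane_strict nontrivial e apos ga)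
    next
      case False
      have "x \<bullet> e \<le> norm x" for x using norm_cauchy_schwarz[of x e] e by simp
      then show ?thesis using False by (intro AE_I2) (smt (verit))
    qed
    then obtain \<delta> where \<delta>: "0 < \<delta>" "\<And>l'. a - \<delta> < l' \<Longrightarrow> l' < a \<Longrightarrow> 0 \<le> l' \<Longrightarrow>
        emeasure lborel {x. l' < x \<bullet> e \<and> gap e l' x < 0} \<le> ennreal (m / 2)"
      using bad_set_small[OF e apos, of "m / 2"] m by auto
    define b where "b = max (a - \<delta> / 2) (a / 2)"
    have b: "a - \<delta> < b" "b < a" "0 \<le> b" using \<delta>(1) apos by (auto simp: b_def)
    have "good_plane e l'" if "b \<le> l'" for l'
    proof (cases "l' < a")
      case True
      then show ?thesis unfolding good_plane_def using b that m small
        by (intro max_principle_small_set[OF e, of l' m] \<delta>(2)) auto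
    next
      case False then show ?thesis using ga above by (cases "l' = a") auto
    qed
    then have "b \<in> A" using b by (simp add: A_def)
    then have "a \<le> b" unfolding a_def using bdd by (intro cInf_lower)
    then show False using b by simp
  qed
  then show ?thesis using above ga \<open>0 \<le> l\<close> by (cases "l = 0") auto
qed

end

section \<open>The radial representative\<close>

lemma AE_lborel_pair:
  assumes [measurable]: "Measurable.pred borel P" and ae: "AE x in (lborel :: 'a::euclidean_space measure). P x"
  shows "AE z in lborel \<Otimes>\<^sub>M (lborel :: 'a measure). P (fst z) \<and> P (snd z)"
proof (rule lborel_pair.AE_pair_measure)
  show "{z \<in> space (lborel \<Otimes>\<^sub>M (lborel :: 'a measure)). P (fst z) \<and> P (snd z)} \<in> sets lborel2"
    by measurable
  show "AE x in lborel. AE y in lborel. P (fst (x, y)) \<and> P (snd (x, y))"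
    using ae by eventually_elim (use ae in simp)
qed

lemma energy_cong_AE:
  fixes u v :: "'a::euclidean_space \<Rightarrow> real"
  assumes [measurable]: "u \<in> borel_measurable borel" "v \<in> borel_measurable borel"
    and ae: "AE x in lborel. v x = u x"
  shows "energy \<sigma> p v = energy \<sigma> p u"
proof -
  have "AE z in lborel2. v (fst z) = u (fst z) \<and> v (snd z) = u (snd z)"
    by (rule AE_lborel_pair[OF _ ae]) measurable
  then show ?thesis unfolding energy_def by (intro nn_integral_cong_AE) (erule eventually_mono, simp)
qed

lemma form_integral_cong_AE:
  fixes u v \<phi> \<psi> :: "'a::euclidean_space \<Rightarrow> real"
  assumes [measurable]: "u \<in> borel_measurable borel" "v \<in> borel_measurable borel"
      "\<phi> \<in> borel_measurable borel" "\<psi> \<in> borel_measurable borel"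
    and ae: "AE x in lborel. v x = u x" "AE x in lborel. \<psi> x = \<phi> x"
  shows "(\<integral>z. form_integrand \<sigma> p v \<psi> z \<partial>lborel2) = (\<integral>z. form_integrand \<sigma> p u \<phi> z \<partial>lborel2)"
proof -
  have "AE x in lborel. v x = u x \<and> \<psi> x = \<phi> x" using ae by eventually_elim simp
  then have "AE z in lborel2. (v (fst z) = u (fst z) \<and> \<psi> (fst z) = \<phi> (fst z))
      \<and> (v (snd z) = u (snd z) \<and> \<psi> (snd z) = \<phi> (snd z))"
    by (intro AE_lborel_pair[of "\<lambda>x. v x = u x \<and> \<psi> x = \<phi> x"]) measurable
  then have "AE z in lborel2. form_integrand \<sigma> p v \<psi> z = form_integrand \<sigma> p u \<phi> z"
    by (rule eventually_mono) (simp add: form_integrand_def)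
  then show ?thesis by (intro integral_cong_AE) auto
qed

lemma mirror_swap:
  fixes x y :: "'a::euclidean_space"
  assumes "x \<noteq> y"
  defines "e \<equiv> (x - y) /\<^sub>R norm (x - y)" and "l \<equiv> ((norm x)\<^sup>2 - (norm y)\<^sup>2) / (2 * norm (x - y))"
  shows "norm e = 1" "mirror e l x = y" "x \<bullet> e - l = norm (x - y) / 2"
proof -
  have n: "norm (x - y) \<noteq> 0" using assms(1) by simp
  show "norm e = 1" using n by (simp add: e_def)
  have sq: "(norm (x - y))\<^sup>2 = (norm x)\<^sup>2 + (norm y)\<^sup>2 - 2 * (x \<bullet> y)"
    unfolding power2_norm_eq_inner by (simp add: algebra_simps inner_commute)
  have "x \<bullet> e = ((norm x)\<^sup>2 - x \<bullet> y) / norm (x - y)"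
    unfolding e_def power2_norm_eq_inner by (simp add: inner_diff_right divide_inverse mult.commute)
  moreover have "X / n - Z / (2 * n) = (2 * X - Z) / (2 * n)" if "n \<noteq> 0" for X Z n :: real
    using that by (simp add: field_simps)
  ultimately have "x \<bullet> e - l = (2 * ((norm x)\<^sup>2 - x \<bullet> y) - ((norm x)\<^sup>2 - (norm y)\<^sup>2)) / (2 * norm (x - y))"
    unfolding l_def using n by simp
  also have "2 * ((norm x)\<^sup>2 - x \<bullet> y) - ((norm x)\<^sup>2 - (norm y)\<^sup>2) = (norm (x - y))\<^sup>2"
    unfolding sq by simp
  also have "(norm (x - y))\<^sup>2 / (2 * norm (x - y)) = norm (x - y) / 2"
    using n by (simp add: power2_eq_square)
  finally show "x \<bullet> e - l = norm (x - y) / 2" .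
  then have "mirror e l x = x - norm (x - y) *\<^sub>R e" by (simp add: mirror_def)
  also have "\<dots> = y" using n by (simp add: e_def)
  finally show "mirror e l x = y" .
qed

context bounded_solution
begin

lemma cong_AE:
  assumes [measurable]: "v \<in> borel_measurable borel" and v: "\<And>x. 0 \<le> v x" "\<And>x. v x \<le> T"
    and out: "\<And>x. x \<notin> ball 0 R \<Longrightarrow> v x = 0" and ae: "AE x in lborel. v x = u x"
  shows "bounded_solution \<sigma> p R T L f v"
proof
  show "energy \<sigma> p v < \<infinity>" using energy_cong_AE[OF _ _ ae] u_energy by simp
  fix \<phi> :: "'a \<Rightarrow> real" and M
  assume \<phi>[measurable]: "\<phi> \<in> borel_measurable borel" and a: "\<And>x. \<bar>\<phi> x\<bar> \<le> M" "\<And>x. x \<notin> ball 0 R \<Longrightarrow> \<phi> x = 0" "energy \<sigma> p \<phi> < \<infinity>"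
  have "(\<integral>z. form_integrand \<sigma> p v \<phi> z \<partial>lborel2) = (\<integral>z. form_integrand \<sigma> p u \<phi> z \<partial>lborel2)"
    by (rule form_integral_cong_AE[OF _ _ _ _ ae]) auto
  also have "\<dots> = (\<integral>x. f (u x) * \<phi> x \<partial>lborel)" using \<phi> a by (rule weak)
  also have "\<dots> = (\<integral>x. f (v x) * \<phi> x \<partial>lborel)"
    using ae by (intro integral_cong_AE) auto
  finally show "(\<integral>z. form_integrand \<sigma> p v \<phi> z \<partial>lborel2) = (\<integral>x. f (v x) * \<phi> x \<partial>lborel)" .
qed (use sigma p R T L v out f_lipschitz in auto)

definition avg :: "real \<Rightarrow> 'a \<Rightarrow> real" where
  "avg \<epsilon> x = (\<integral>y. indicator {y. norm (x - y) < \<epsilon>} y * u y \<partial>lborel) / (unit_ball_vol DIM('a) * \<epsilon> ^ DIM('a))"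

lemma avg_measurable[measurable]: "avg \<epsilon> \<in> borel_measurable borel"
  unfolding avg_def by measurable

lemma near_set_ball: "{y. norm (x - y) < \<epsilon>} = ball x \<epsilon>"
  by (auto simp: dist_norm)

lemma near_set_emeasure:
  fixes x :: 'a
  shows "0 \<le> \<epsilon> \<Longrightarrow> emeasure lborel {y. norm (x - y) < \<epsilon>} = ennreal (unit_ball_vol DIM('a) * \<epsilon> ^ DIM('a))"
  unfolding near_set_ball by (rule emeasure_ball_pow)

lemma near_set_measurable[measurable]:
  fixes x :: 'a
  shows "{y. norm (x - y) < \<epsilon>} \<in> sets borel"
  unfolding near_set_ball by simp

lemma integrable_near:
  fixes x :: 'a and g :: "'a \<Rightarrow> real"
  assumes \<epsilon>: "0 \<le> \<epsilon>" and [measurable]: "g \<in> borel_measurable borel" and b: "\<And>y. \<bar>g y\<bar> \<le> M"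
  shows "integrable lborel (\<lambda>y. indicator {y. norm (x - y) < \<epsilon>} y * g y)"
proof (rule Bochner_Integration.integrable_bound)
  show "integrable lborel (\<lambda>y. M * indicator {y. norm (x - y) < \<epsilon>} y)"
    using \<epsilon> by (intro integrable_mult_right integrable_real_indicator) (auto simp: near_set_emeasure)
  show "AE y in lborel. norm (indicator {y. norm (x - y) < \<epsilon>} y * g y) \<le> norm (M * indicator {y. norm (x - y) < \<epsilon>} y)"
    using b by (intro AE_I2) (auto simp: indicator_def intro: order_trans[OF _ abs_ge_self])
qed measurable

lemma integral_near_const:
  fixes x :: 'a
  shows "0 \<le> \<epsilon> \<Longrightarrow> (\<integral>y. indicator {y. norm (x - y) < \<epsilon>} y * (c::real) \<partial>lborel) = c * (unit_ball_vol DIM('a) * \<epsilon> ^ DIM('a))"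
  using unit_vol_pos[where 'a='a] by (simp add: measure_def near_set_emeasure less_imp_le)

lemma abs_u_le: "\<bar>u y\<bar> \<le> T"
  using u_nonneg[of y] u_le[of y] by simp

lemma avg_range:
  assumes \<epsilon>: "0 < \<epsilon>"
  shows "0 \<le> avg \<epsilon> x" "avg \<epsilon> x \<le> T"
proof -
  let ?B = "{y. norm (x - y) < \<epsilon>}" and ?v = "unit_ball_vol DIM('a) * \<epsilon> ^ DIM('a)"
  have v: "0 < ?v" using \<epsilon> unit_vol_pos[where 'a='a] by (intro mult_pos_pos) auto
  show "0 \<le> avg \<epsilon> x" unfolding avg_def using v u_nonneg by (intro divide_nonneg_pos integral_nonneg) auto
  have "(\<integral>y. indicator ?B y * u y \<partial>lborel) \<le> (\<integral>y. indicator ?B y * T \<partial>lborel)"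
    using \<epsilon> T u_le abs_u_le by (intro integral_mono integrable_near[where M=T]) (auto intro!: mult_left_mono)
  also have "\<dots> = T * ?v" using \<epsilon> by (intro integral_near_const) simp
  finally show "avg \<epsilon> x \<le> T" unfolding avg_def using v by (simp add: pos_divide_le_eq)
qed

text \<open>A point where the inner integral of the energy is finite is a Lebesgue point, with a rate.\<close>

lemma avg_near_u:
  assumes \<epsilon>: "0 < \<epsilon>"
    and g: "(\<integral>\<^sup>+y. ennreal (\<bar>u x - u y\<bar> powr p * kern \<sigma> (x - y)) \<partial>lborel) = ennreal g" "0 \<le> g"
  shows "\<bar>avg \<epsilon> x - u x\<bar> \<le> (1 + g / unit_ball_vol DIM('a)) * \<epsilon> powr (\<sigma> / p)"
proof -
  let ?N = "real DIM('a)" and ?w = "unit_ball_vol (real DIM('a))"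
  let ?B = "{y. norm (x - y) < \<epsilon>}" and ?v = "?w * \<epsilon> ^ DIM('a)"
  have w: "0 < ?w" by (rule unit_vol_pos)
  have v: "0 < ?v" using \<epsilon> w by (intro mult_pos_pos) auto
  \<comment> \<open>This \<open>d\<close> balances the two terms in \<open>t \<le> d + d\<^sup>1\<^sup>-\<^sup>p t\<^sup>p\<close>, which replaces Jensen's inequality.\<close>
  define d where "d = \<epsilon> powr (\<sigma> / p)"
  have d: "0 < d" using \<epsilon> by (simp add: d_def)
  have pw: "t \<le> d + d powr (1 - p) * t powr p" if "0 \<le> t" for t
  proof (cases "t \<le> d")
    case False
    then have "t = t powr (1 - p) * t powr p" using d by (simp add: powr_add[symmetric])
    also have "\<dots> \<le> d powr (1 - p) * t powr p"
      using False d p by (intro mult_right_mono powr_mono2') auto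
    finally show ?thesis using d by simp
  qed (use that in \<open>simp add: add_increasing2\<close>)
  have kn: "\<bar>u x - u y\<bar> powr p \<le> \<epsilon> powr (?N + \<sigma>) * (\<bar>u x - u y\<bar> powr p * kern \<sigma> (x - y))" if "norm (x - y) < \<epsilon>" for y
  proof (cases "x = y")
    case False
    have "1 = \<epsilon> powr (?N + \<sigma>) * \<epsilon> powr - (?N + \<sigma>)" using \<epsilon> by (simp add: powr_add[symmetric])
    also have "\<dots> \<le> \<epsilon> powr (?N + \<sigma>) * kern \<sigma> (x - y)"
      using False that sigma by (intro mult_left_mono kern_lower) auto
    finally have "1 * \<bar>u x - u y\<bar> powr p \<le> (\<epsilon> powr (?N + \<sigma>) * kern \<sigma> (x - y)) * \<bar>u x - u y\<bar> powr p"
      by (rule mult_right_mono) simp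
    then show ?thesis by (simp add: mult_ac)
  qed simp
  have iu: "integrable lborel (\<lambda>y. indicator ?B y * u y)" "integrable lborel (\<lambda>y. indicator ?B y * u x)"
    by (rule integrable_near[where M=T]; use \<epsilon> abs_u_le in simp)+
  have ib: "integrable lborel (\<lambda>y. indicator ?B y * (u y - u x))"
    using iu by (simp add: right_diff_distrib)
  have "(avg \<epsilon> x - u x) * ?v = (\<integral>y. indicator ?B y * u y \<partial>lborel) - (\<integral>y. indicator ?B y * u x \<partial>lborel)"
  proof -
    have "?v \<noteq> 0" using v by linarith
    moreover have "Z / k * k = Z" if "k \<noteq> 0" for Z k :: real using that by simp
    ultimately have "avg \<epsilon> x * ?v = (\<integral>y. indicator ?B y * u y \<partial>lborel)" unfolding avg_def by blast
    moreover have "(\<integral>y. indicator ?B y * u x \<partial>lborel) = u x * ?v" using \<epsilon> by (intro integral_near_const) simp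
    ultimately show ?thesis by (simp only: left_diff_distrib)
  qed
  also have "\<dots> = (\<integral>y. indicator ?B y * (u y - u x) \<partial>lborel)"
    using iu by (simp add: right_diff_distrib)
  finally have "ennreal (\<bar>avg \<epsilon> x - u x\<bar> * ?v) = ennreal (norm (\<integral>y. indicator ?B y * (u y - u x) \<partial>lborel))"
    using v by (metis abs_mult abs_of_pos real_norm_def)
  also have "\<dots> \<le> (\<integral>\<^sup>+y. ennreal (norm (indicator ?B y * (u y - u x))) \<partial>lborel)"
    by (rule integral_norm_bound_ennreal[OF ib])
  also have "\<dots> \<le> (\<integral>\<^sup>+y. ennreal d * indicator ?B y
      + ennreal (d powr (1 - p) * \<epsilon> powr (?N + \<sigma>)) * ennreal (\<bar>u x - u y\<bar> powr p * kern \<sigma> (x - y)) \<partial>lborel)"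
  proof (rule nn_integral_mono)
    fix y
    show "ennreal (norm (indicator ?B y * (u y - u x))) \<le> ennreal d * indicator ?B y
      + ennreal (d powr (1 - p) * \<epsilon> powr (?N + \<sigma>)) * ennreal (\<bar>u x - u y\<bar> powr p * kern \<sigma> (x - y))"
    proof (cases "norm (x - y) < \<epsilon>")
      case True
      have "\<bar>u y - u x\<bar> \<le> d + d powr (1 - p) * \<bar>u x - u y\<bar> powr p"
        using pw[of "\<bar>u x - u y\<bar>"] by (simp add: abs_minus_commute)
      also have "\<dots> \<le> d + d powr (1 - p) * (\<epsilon> powr (?N + \<sigma>) * (\<bar>u x - u y\<bar> powr p * kern \<sigma> (x - y)))"
        using kn[OF True] by (intro add_left_mono mult_left_mono) auto
      finally have "ennreal \<bar>u y - u x\<bar> \<le> ennreal (d + (d powr (1 - p) * \<epsilon> powr (?N + \<sigma>)) * (\<bar>u x - u y\<bar> powr p * kern \<sigma> (x - y)))"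
        by (intro ennreal_leI) (simp only: mult.assoc)
      also have "\<dots> = ennreal d + ennreal (d powr (1 - p) * \<epsilon> powr (?N + \<sigma>)) * ennreal (\<bar>u x - u y\<bar> powr p * kern \<sigma> (x - y))"
        using d by (subst ennreal_plus) (auto intro: ennreal_mult)
      finally show ?thesis using True by simp
    qed simp
  qed
  also have "\<dots> = ennreal d * ennreal ?v + ennreal (d powr (1 - p) * \<epsilon> powr (?N + \<sigma>)) * ennreal g"
  proof -
    have "(\<integral>\<^sup>+y. ennreal d * indicator ?B y \<partial>lborel) = ennreal d * ennreal ?v"
      using \<epsilon> by (subst nn_integral_cmult_indicator) (auto simp: near_set_emeasure)
    moreover have "(\<integral>\<^sup>+y. ennreal (d powr (1 - p) * \<epsilon> powr (?N + \<sigma>)) * ennreal (\<bar>u x - u y\<bar> powr p * kern \<sigma> (x - y)) \<partial>lborel)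
        = ennreal (d powr (1 - p) * \<epsilon> powr (?N + \<sigma>)) * ennreal g"
      unfolding g(1)[symmetric] by (rule nn_integral_cmult) measurable
    ultimately show ?thesis by (subst nn_integral_add) auto
  qed
  also have "\<dots> = ennreal (d * ?v + d powr (1 - p) * \<epsilon> powr (?N + \<sigma>) * g)"
    using d v g(2) by (simp only: ennreal_plus ennreal_mult mult_nonneg_nonneg powr_ge_zero less_imp_le)
  finally have le: "\<bar>avg \<epsilon> x - u x\<bar> * ?v \<le> d * ?v + d powr (1 - p) * \<epsilon> powr (?N + \<sigma>) * g"
    using d v g(2) by (subst (asm) ennreal_le_iff) auto
  have "d powr (1 - p) * \<epsilon> powr (?N + \<sigma>) = \<epsilon> powr (\<sigma> / p * (1 - p) + (?N + \<sigma>))"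
    by (simp add: d_def powr_powr powr_add)
  also have "\<sigma> / p * (1 - p) + (?N + \<sigma>) = \<sigma> / p + ?N" using p by (simp add: field_simps)
  also have "\<epsilon> powr (\<sigma> / p + ?N) = d * \<epsilon> ^ DIM('a)"
    using \<epsilon> by (simp add: d_def powr_add powr_realpow)
  finally have eq: "d powr (1 - p) * \<epsilon> powr (?N + \<sigma>) = d * \<epsilon> ^ DIM('a)" .
  have "?w \<noteq> 0" using w by linarith
  then have "d powr (1 - p) * \<epsilon> powr (?N + \<sigma>) * g = (g / ?w * d) * ?v" unfolding eq by simp
  with le have "\<bar>avg \<epsilon> x - u x\<bar> * ?v \<le> ((1 + g / ?w) * d) * ?v" by (simp add: distrib_right)
  then show ?thesis using v unfolding d_def by (simp only: mult_le_cancel_right_pos)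
qed

lemma avg_tendsto_AE: "AE x in lborel. (\<lambda>n. avg (1 / real (Suc n)) x) \<longlonglongrightarrow> u x"
proof -
  have "(\<integral>\<^sup>+x. \<integral>\<^sup>+y. ennreal (\<bar>u x - u y\<bar> powr p * kern \<sigma> (x - y)) \<partial>lborel \<partial>lborel) \<noteq> \<infinity>"
    using u_energy unfolding energy_iterated[OF u_measurable] by simp
  then have "AE x in lborel. (\<integral>\<^sup>+y. ennreal (\<bar>u x - u y\<bar> powr p * kern \<sigma> (x - y)) \<partial>lborel) \<noteq> \<infinity>"
    by (intro nn_integral_noteq_infinite) measurable
  then show ?thesis
  proof eventually_elim
    case (elim x)
    then obtain g where g: "(\<integral>\<^sup>+y. ennreal (\<bar>u x - u y\<bar> powr p * kern \<sigma> (x - y)) \<partial>lborel) = ennreal g" "0 \<le> g"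
      by (cases "\<integral>\<^sup>+y. ennreal (\<bar>u x - u y\<bar> powr p * kern \<sigma> (x - y)) \<partial>lborel") auto
    let ?b = "\<lambda>n. (1 + g / unit_ball_vol DIM('a)) * (1 / real (Suc n)) powr (\<sigma> / p)"
    have "?b \<longlonglongrightarrow> (1 + g / unit_ball_vol DIM('a)) * 0 powr (\<sigma> / p)"
      using sigma p by (intro tendsto_intros tendsto_powr' LIMSEQ_Suc[OF lim_const_over_n]) (auto intro!: always_eventually)
    then have b: "?b \<longlonglongrightarrow> 0" by simp
    have "(\<lambda>n. avg (1 / real (Suc n)) x - u x) \<longlonglongrightarrow> 0"
      by (rule Lim_null_comparison[OF _ b]) (auto intro!: always_eventually avg_near_u[OF _ g] simp del: of_nat_Suc)
    then show ?case by (simp add: LIM_zero_iff)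
  qed
qed

text \<open>Averages over small balls inherit the pointwise inequality across the plane that exchanges the
  two centres; in the limit this yields exact monotonicity in the radius, hence radial symmetry.\<close>

lemma avg_antimono:
  assumes nontrivial: "\<not> (AE x in lborel. u x = 0)" and xy: "x \<noteq> y" "norm y \<le> norm x"
    and \<epsilon>: "0 < \<epsilon>" "\<epsilon> \<le> norm (x - y) / 2"
  shows "avg \<epsilon> x \<le> avg \<epsilon> y"
proof -
  define e where "e = (x - y) /\<^sub>R norm (x - y)"
  define l where "l = ((norm x)\<^sup>2 - (norm y)\<^sup>2) / (2 * norm (x - y))"
  have e: "norm e = 1" and Sx: "mirror e l x = y" and side: "x \<bullet> e - l = norm (x - y) / 2"
    using mirror_swap[OF xy(1)] unfolding e_def l_def by auto
  have l: "0 \<le> l" unfolding l_def using xy by (intro divide_nonneg_nonneg) (auto intro: power_mono)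
  let ?S = "mirror e l"
  have Sy: "?S y = x" using Sx e by (metis mirror_mirror)
  have good: "AE z in lborel. l < z \<bullet> e \<longrightarrow> 0 \<le> gap e l z"
    using all_planes_good[OF nontrivial e l] by (simp add: good_plane_def)
  have "(\<integral>z. indicator {z. norm (x - z) < \<epsilon>} z * u z \<partial>lborel) \<le> (\<integral>z. indicator {z. norm (x - z) < \<epsilon>} z * u (?S z) \<partial>lborel)"
  proof (rule integral_mono_AE)
    show "AE z in lborel. indicator {z. norm (x - z) < \<epsilon>} z * u z \<le> indicator {z. norm (x - z) < \<epsilon>} z * u (?S z)"
      using good
    proof eventually_elim
      case (elim z)
      show ?case
      proof (cases "norm (x - z) < \<epsilon>")
        case True
        have "(x - z) \<bullet> e \<le> norm (x - z)" using norm_cauchy_schwarz[of "x - z" e] e by simp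
        then have "l < z \<bullet> e" using side True \<epsilon> by (simp add: inner_diff_left)
        then show ?thesis using elim True by (simp add: gap_def)
      qed simp
    qed
  qed (use \<epsilon> abs_u_le in \<open>auto intro!: integrable_near[where M=T]\<close>)
  also have "\<dots> = (\<integral>z. (\<lambda>z. indicator {z. norm (y - z) < \<epsilon>} z * u z) (?S z) \<partial>lborel)"
  proof (rule Bochner_Integration.integral_cong[OF refl])
    fix z
    have "norm (y - ?S z) = norm (x - z)" using mirror_diff_mirror[OF e, of l x z] Sx by simp
    then show "indicator {z. norm (x - z) < \<epsilon>} z * u (?S z) = (\<lambda>z. indicator {z. norm (y - z) < \<epsilon>} z * u z) (?S z)"
      by (simp add: indicator_def)
  qed
  also have "\<dots> = (\<integral>z. indicator {z. norm (y - z) < \<epsilon>} z * u z \<partial>lborel)"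
    by (rule integral_mirror[OF e]) measurable
  finally show ?thesis unfolding avg_def using \<epsilon> unit_vol_pos[where 'a='a] by (intro divide_right_mono) auto
qed

text \<open>The value at the origin is set to the supremum, so that continuity there follows from monotonicity
  alone.\<close>

lemma radial_representative:
  assumes nontrivial: "\<not> (AE x in lborel. u x = 0)"
  obtains v where "bounded_solution \<sigma> p R T L f v" "AE x in lborel. v x = u x"
    "\<And>x y. norm y \<le> norm x \<Longrightarrow> v x \<le> v y" "v 0 = (SUP x\<in>- {0}. v x)"
proof -
  define V where "V = (\<lambda>x. limsup (\<lambda>n. ennreal (avg (1 / real (Suc n)) x)))"
  have VT: "V x \<le> ennreal T" for x
    unfolding V_def by (rule Limsup_bounded) (auto intro!: always_eventually ennreal_leI avg_range)
  have Vmono: "V x \<le> V y" if "x \<noteq> y" "norm y \<le> norm x" for x y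
    unfolding V_def
  proof (rule Limsup_mono)
    have "0 < norm (x - y) / 2" using that by simp
    then obtain n0 :: nat where n0: "1 / real (Suc n0) < norm (x - y) / 2" using nat_approx_posE by blast
    have "ennreal (avg (1 / real (Suc n)) x) \<le> ennreal (avg (1 / real (Suc n)) y)" if n: "n0 \<le> n" for n
    proof (rule ennreal_leI, rule avg_antimono[OF nontrivial \<open>x \<noteq> y\<close> \<open>norm y \<le> norm x\<close>])
      have "1 / real (Suc n) \<le> 1 / real (Suc n0)" using n by (intro divide_left_mono) auto
      then show "1 / real (Suc n) \<le> norm (x - y) / 2" using n0 by linarith
    qed simp
    then show "\<forall>\<^sub>F n in sequentially. ennreal (avg (1 / real (Suc n)) x) \<le> ennreal (avg (1 / real (Suc n)) y)"
      unfolding eventually_sequentially by blast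
  qed
  define w where "w = (\<lambda>x. if norm x < R then enn2real (V x) else 0)"
  have [measurable]: "w \<in> borel_measurable borel" unfolding w_def V_def by measurable
  have w0: "0 \<le> w x" for x by (simp add: w_def)
  have wT: "w x \<le> T" for x
    using enn2real_mono[OF VT] T by (auto simp: w_def)
  have wmono: "w x \<le> w y" if "norm y \<le> norm x" for x y
  proof (cases "x = y \<or> \<not> norm x < R")
    case True then show ?thesis using w0 by (auto simp: w_def)
  next
    case False
    then have "enn2real (V x) \<le> enn2real (V y)"
      using Vmono that VT[of y] by (intro enn2real_mono) (auto simp: less_top[symmetric] top_unique)
    then show ?thesis using False that by (simp add: w_def)
  qed
  define s where "s = (SUP x\<in>- {0}. w x)"
  have bdd: "bdd_above (w ` (- {0}))" by (intro bdd_aboveI2[of _ _ T] wT)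
  obtain b :: 'a where b: "b \<in> Basis" using nonempty_Basis by blast
  then have ne: "- {0::'a} \<noteq> {}" using nonzero_Basis by blast
  have ws: "w x \<le> s" if "x \<noteq> 0" for x unfolding s_def using that bdd by (intro cSUP_upper) auto
  have sT: "s \<le> T" unfolding s_def using ne wT by (intro cSUP_least) auto
  have s0: "0 \<le> s" using ws[of b] w0[of b] b nonzero_Basis by fastforce
  define v where "v = (\<lambda>x. if x = 0 then s else w x)"
  have [measurable]: "v \<in> borel_measurable borel" unfolding v_def by measurable
  have "AE x in lborel. x \<noteq> (0::'a)" by (rule AE_lborel_singleton)
  then have ae: "AE x in lborel. v x = u x" using avg_tendsto_AE
  proof eventually_elim
    case (elim x)
    show ?case
    proof (cases "norm x < R")
      case True
      have "V x = ennreal (u x)" unfolding V_def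
        by (intro lim_imp_Limsup tendsto_ennrealI elim) simp
      then show ?thesis using True elim u_nonneg by (simp add: v_def w_def)
    next
      case False
      then show ?thesis using elim u_outside by (simp add: v_def w_def)
    qed
  qed
  have "bounded_solution \<sigma> p R T L f v"
    by (rule cong_AE[OF _ _ _ _ ae]) (use s0 sT w0 wT R in \<open>auto simp: v_def w_def\<close>)
  moreover have "v x \<le> v y" if "norm y \<le> norm x" for x y
    using that wmono[OF that] ws by (auto simp: v_def)
  moreover have "v 0 = (SUP x\<in>- {0}. v x)"
    unfolding v_def s_def by (auto intro!: SUP_cong)
  ultimately show ?thesis using that ae by blast
qed

end

section \<open>Continuity and strict monotonicity of the representative\<close>

lemma integral_le_of_nn_integral_le:
  fixes g :: "'b \<Rightarrow> real"
  assumes [measurable]: "g \<in> borel_measurable M" and nn: "\<And>z. 0 \<le> g z" and c: "0 \<le> c"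
    and le: "(\<integral>\<^sup>+z. ennreal (g z) \<partial>M) \<le> ennreal c"
  shows "integrable M g" "(\<integral>z. g z \<partial>M) \<le> c"
proof -
  show int: "integrable M g"
    using nn le by (intro integrableI_nonneg) (auto intro: le_less_trans)
  have "ennreal (\<integral>z. g z \<partial>M) = (\<integral>\<^sup>+z. ennreal (g z) \<partial>M)"
    using int nn by (intro nn_integral_eq_integral[symmetric]) auto
  then have "ennreal (\<integral>z. g z \<partial>M) \<le> ennreal c" using le by (simp only:)
  then show "(\<integral>z. g z \<partial>M) \<le> c" using ennreal_le_iff[OF c] by blast
qed

lemma strip_integral:
  fixes S :: "'a::euclidean_space set"
  assumes [measurable]: "S \<in> sets borel" and S: "emeasure lborel S = ennreal A" "0 \<le> A" and "0 \<le> c"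
    and I: "\<And>x::'a. (\<integral>\<^sup>+y. ennreal (min 1 (norm (x - y) / h) * kern \<sigma> (x - y)) \<partial>lborel) \<le> ennreal c"
    and h: "0 < h"
  defines "g \<equiv> \<lambda>z. (indicator S (fst z) + indicator S (snd z)) * (min 1 (norm (fst z - snd z) / h) * kern \<sigma> (fst z - snd z))"
  shows "integrable lborel2 g" "(\<integral>z. g z \<partial>lborel2) \<le> 2 * (A * c)"
proof -
  let ?k = "\<lambda>x y :: 'a. ennreal (min 1 (norm (x - y) / h) * kern \<sigma> (x - y))"
  have km: "(\<lambda>z. ?k (fst z) (snd z)) \<in> borel_measurable lborel2" by measurable
  have gm: "g \<in> borel_measurable lborel2" unfolding g_def by measurable
  have gnn: "0 \<le> g z" for z unfolding g_def using h by auto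
  have one: "(\<integral>\<^sup>+x. \<integral>\<^sup>+y. indicator S x * ?k x y \<partial>lborel \<partial>lborel) \<le> ennreal (A * c)"
  proof -
    have "(\<integral>\<^sup>+x. \<integral>\<^sup>+y. indicator S x * ?k x y \<partial>lborel \<partial>lborel) \<le> (\<integral>\<^sup>+x. ennreal c * indicator S x \<partial>lborel)"
    proof (rule nn_integral_mono)
      fix x :: 'a
      have "(\<integral>\<^sup>+y. indicator S x * ?k x y \<partial>lborel) = indicator S x * (\<integral>\<^sup>+y. ?k x y \<partial>lborel)"
        by (rule nn_integral_cmult) measurable
      also have "\<dots> \<le> indicator S x * ennreal c" by (rule mult_left_mono[OF I]) simp
      finally show "(\<integral>\<^sup>+y. indicator S x * ?k x y \<partial>lborel) \<le> ennreal c * indicator S x" by (simp add: mult.commute)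
    qed
    also have "\<dots> = ennreal c * ennreal A" by (subst nn_integral_cmult_indicator) (auto simp: S)
    also have "\<dots> = ennreal (A * c)" using S(2) \<open>0 \<le> c\<close> by (simp add: ennreal_mult mult.commute)
    finally show ?thesis .
  qed
  have "(\<integral>\<^sup>+z. ennreal (g z) \<partial>lborel2)
      = (\<integral>\<^sup>+z. indicator S (fst z) * ?k (fst z) (snd z) + indicator S (snd z) * ?k (fst z) (snd z) \<partial>lborel2)"
    using h by (intro nn_integral_cong) (auto simp: g_def indicator_def distrib_right simp flip: ennreal_plus)
  also have "\<dots> = (\<integral>\<^sup>+z. indicator S (fst z) * ?k (fst z) (snd z) \<partial>lborel2)
      + (\<integral>\<^sup>+z. indicator S (snd z) * ?k (fst z) (snd z) \<partial>lborel2)"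
    by (rule nn_integral_add) measurable
  also have "(\<integral>\<^sup>+z. indicator S (fst z) * ?k (fst z) (snd z) \<partial>lborel2) = (\<integral>\<^sup>+x. \<integral>\<^sup>+y. indicator S x * ?k x y \<partial>lborel \<partial>lborel)"
    using lborel.nn_integral_fst[of "\<lambda>z. indicator S (fst z) * ?k (fst z) (snd z)" lborel, symmetric] by simp
  also have "(\<integral>\<^sup>+z. indicator S (snd z) * ?k (fst z) (snd z) \<partial>lborel2) = (\<integral>\<^sup>+y. \<integral>\<^sup>+x. indicator S y * ?k x y \<partial>lborel \<partial>lborel)"
    using lborel_pair.nn_integral_snd[of "\<lambda>z. indicator S (snd z) * ?k (fst z) (snd z)", symmetric] by simp
  also have "\<dots> = (\<integral>\<^sup>+x. \<integral>\<^sup>+y. indicator S x * ?k x y \<partial>lborel \<partial>lborel)"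
    by (intro nn_integral_cong) (simp add: kern_commute[of \<sigma> _ "_ :: 'a"] norm_minus_commute)
  also have "(\<integral>\<^sup>+x. \<integral>\<^sup>+y. indicator S x * ?k x y \<partial>lborel \<partial>lborel) + (\<integral>\<^sup>+x. \<integral>\<^sup>+y. indicator S x * ?k x y \<partial>lborel \<partial>lborel)
      \<le> ennreal (A * c) + ennreal (A * c)" by (intro add_mono one)
  also have "\<dots> = ennreal (2 * (A * c))" using S(2) \<open>0 \<le> c\<close> by (simp flip: ennreal_plus)
  finally have le: "(\<integral>\<^sup>+z. ennreal (g z) \<partial>lborel2) \<le> ennreal (2 * (A * c))" .
  have nn2: "0 \<le> 2 * (A * c)" using S(2) \<open>0 \<le> c\<close> by simp
  show "integrable lborel2 g" "(\<integral>z. g z \<partial>lborel2) \<le> 2 * (A * c)"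
    by (rule integral_le_of_nn_integral_le[OF gm gnn nn2 le])+
qed

lemma emeasure_annulus:
  assumes "0 < h" "h \<le> r"
  shows "emeasure lborel {x :: 'a::euclidean_space. r - h < norm x \<and> norm x < r}
    = ennreal (unit_ball_vol DIM('a) * (r ^ DIM('a) - (r - h) ^ DIM('a)))"
proof -
  let ?w = "unit_ball_vol (real DIM('a))"
  have w: "0 \<le> ?w" using unit_vol_pos[where 'a='a] by simp
  have "{x :: 'a. r - h < norm x \<and> norm x < r} = ball 0 r - cball 0 (r - h)" by auto
  also have "emeasure lborel \<dots> = emeasure lborel (ball (0::'a) r) - emeasure lborel (cball (0::'a) (r - h))"
    using assms by (intro emeasure_Diff) (auto simp: emeasure_cball)
  also have "\<dots> = ennreal (?w * r ^ DIM('a)) - ennreal (?w * (r - h) ^ DIM('a))"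
    using assms by (simp add: emeasure_ball_pow emeasure_cball)
  also have "\<dots> = ennreal (?w * r ^ DIM('a) - ?w * (r - h) ^ DIM('a))"
    using assms w by (intro ennreal_minus) simp
  finally show ?thesis by (simp add: right_diff_distrib)
qed

lemma annulus_volume_compare:
  fixes r h :: real
  assumes "0 < h" "h \<le> r" "0 < n"
  shows "r ^ n - (r - h) ^ n \<le> 2 * real n * (r ^ n - (r - h / 2) ^ n)" "0 < r ^ n - (r - h / 2) ^ n"
proof -
  have r: "0 < r" using assms by simp
  have scale: "(r - t) ^ n = r ^ n * (1 - t / r) ^ n" for t
    using r by (simp add: power_mult_distrib[symmetric] right_diff_distrib)
  have "1 + real n * (- (h / r)) \<le> (1 + - (h / r)) ^ n"
    using assms r by (intro Bernoulli_inequality) simp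
  then have "r ^ n * (1 - (1 - h / r) ^ n) \<le> r ^ n * (real n * (h / r))"
    using r by (intro mult_left_mono) auto
  then have 1: "r ^ n - (r - h) ^ n \<le> r ^ n * (real n * (h / r))"
    unfolding scale by (simp add: right_diff_distrib)
  have "(1 - h / 2 / r) ^ n \<le> (1 - h / 2 / r) ^ 1"
    using assms r by (intro power_decreasing) (auto simp: field_simps)
  then have "r ^ n * (h / 2 / r) \<le> r ^ n * (1 - (1 - h / 2 / r) ^ n)"
    using r by (intro mult_left_mono) auto
  then have 2: "r ^ n * (h / 2 / r) \<le> r ^ n - (r - h / 2) ^ n"
    unfolding scale[of "h / 2"] by (simp add: right_diff_distrib)
  have "r ^ n * (real n * (h / r)) = 2 * real n * (r ^ n * (h / 2 / r))" by simp
  also have "\<dots> \<le> 2 * real n * (r ^ n - (r - h / 2) ^ n)" using 2 by (intro mult_left_mono) auto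
  finally show "r ^ n - (r - h) ^ n \<le> 2 * real n * (r ^ n - (r - h / 2) ^ n)" using 1 by linarith
  have "0 < r ^ n * (h / 2 / r)" using assms r by simp
  then show "0 < r ^ n - (r - h / 2) ^ n" using 2 by linarith
qed

text \<open>A point in the shell of width \<open>h\<close> sees, within distance \<open>3 h\<close>, a whole ball of radius \<open>h\<close>
  outside the sphere.\<close>

lemma kern_mass_outside_ball:
  fixes x :: "'a::euclidean_space"
  assumes \<sigma>: "0 < \<sigma>" and h: "0 < h" "h \<le> r" and x: "r - h < norm x" "norm x < r"
  shows "ennreal (unit_ball_vol DIM('a) * 3 powr - (real DIM('a) + \<sigma>) * h powr - \<sigma>)
    \<le> (\<integral>\<^sup>+y. indicator {y. r < norm y} y * ennreal (kern \<sigma> (x - y)) \<partial>lborel)"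
proof -
  let ?N = "real DIM('a)" and ?w = "unit_ball_vol (real DIM('a))"
  have w: "0 < ?w" by (rule unit_vol_pos)
  have nx: "0 < norm x" using h x by linarith
  define c where "c = x + (2 * h / norm x) *\<^sub>R x"
  have "c = (1 + 2 * h / norm x) *\<^sub>R x" by (simp add: c_def scaleR_left_distrib)
  then have "norm c = \<bar>1 + 2 * h / norm x\<bar> * norm x" by simp
  also have "\<dots> = norm x + 2 * h" using nx h by (simp add: field_simps)
  finally have nc: "norm c = norm x + 2 * h" .
  have xc: "norm (x - c) = 2 * h" using nx h by (simp add: c_def)
  have b: "r < norm y" "norm (x - y) \<le> 3 * h" if "y \<in> ball c h" for y
  proof -
    have cy: "norm (c - y) < h" using that by (simp add: dist_norm)
    show "r < norm y" using norm_triangle_ineq2[of c y] cy nc x by linarith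
    show "norm (x - y) \<le> 3 * h" using norm_triangle_ineq[of "x - c" "c - y"] cy xc by simp
  qed
  have "?w * 3 powr - (?N + \<sigma>) * h powr - \<sigma> = (3 * h) powr - (?N + \<sigma>) * (?w * h ^ DIM('a))"
  proof -
    have "h powr - \<sigma> = h powr (- (?N + \<sigma>) + ?N)" by simp
    also have "\<dots> = h powr - (?N + \<sigma>) * h ^ DIM('a)" using h by (simp only: powr_add powr_realpow)
    finally show ?thesis using h by (simp add: powr_mult)
  qed
  then have "ennreal (?w * 3 powr - (?N + \<sigma>) * h powr - \<sigma>) = ennreal ((3 * h) powr - (?N + \<sigma>)) * emeasure lborel (ball c h)"
    using h by (simp only: emeasure_ball_pow less_imp_le) (rule ennreal_mult', simp)
  also have "\<dots> = (\<integral>\<^sup>+y. ennreal ((3 * h) powr - (?N + \<sigma>)) * indicator (ball c h) y \<partial>lborel)"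
    by (rule nn_integral_cmult_indicator[symmetric]) simp
  also have "\<dots> \<le> (\<integral>\<^sup>+y. indicator {y. r < norm y} y * ennreal (kern \<sigma> (x - y)) \<partial>lborel)"
  proof (rule nn_integral_mono)
    fix y
    show "ennreal ((3 * h) powr - (?N + \<sigma>)) * indicator (ball c h) y \<le> indicator {y. r < norm y} y * ennreal (kern \<sigma> (x - y))"
    proof (cases "y \<in> ball c h")
      case True
      have "x \<noteq> y" using b(1)[OF True] x by auto
      then have "(3 * h) powr - (?N + \<sigma>) \<le> kern \<sigma> (x - y)" using b(2)[OF True] \<sigma> by (intro kern_lower) auto
      then show ?thesis using True b(1)[OF True] by (simp add: ennreal_leI)
    qed simp
  qed
  finally show ?thesis .
qed

context bounded_solution
begin

text \<open>Suppose that \<open>u\<close> drops by \<open>\<delta>\<close> across the sphere of radius \<open>r\<close>. Test with a function that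
  increases linearly from \<open>0\<close> to \<open>1\<close> in the inner shell of width \<open>h\<close> and vanishes beyond the sphere; it
  has finite energy because it is dominated by a Lipschitz cutoff and \<open>u / \<delta>\<close>. Per unit volume of the
  shell the jump contributes \<open>c \<delta>\<^sup>p\<^sup>-\<^sup>1 h\<^sup>-\<^sup>\<sigma>\<close> to the form. The interior contributes at most
  \<open>C \<omega>\<^sup>p\<^sup>-\<^sup>1 h\<^sup>-\<^sup>\<sigma> + C\<^sub>\<omega>\<close>, where \<open>\<omega>\<close> is the oscillation of \<open>u\<close> just inside the sphere, which can be
  made small by monotonicity; the right-hand side is bounded. Let \<open>h \<rightarrow> 0\<close>.\<close>

lemma no_jump:
  assumes mono: "\<And>x y. norm y \<le> norm x \<Longrightarrow> u x \<le> u y" and r: "0 < r" "r \<le> R" and \<delta>: "0 < \<delta>"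
  shows "\<exists>x y. norm x < r \<and> r < norm y \<and> u x - u y < \<delta>"
proof (rule ccontr)
  assume "\<not> ?thesis"
  then have jump: "\<delta> \<le> u x - u y" if "norm x < r" "r < norm y" for x y
    using that by (meson not_less)
  let ?N = "real DIM('a)" and ?w = "unit_ball_vol (real DIM('a))" and ?n = "DIM('a)"
  have w: "0 < ?w" by (rule unit_vol_pos)
  obtain I where I: "0 \<le> I" "\<And>h (x::'a). 0 < h \<Longrightarrow>
      (\<integral>\<^sup>+y. ennreal (min 1 (norm (x - y) / h) * kern \<sigma> (x - y)) \<partial>lborel) \<le> ennreal (I * h powr - \<sigma>)"
    using kern_min_integral[OF sigma] by blast
  define X where "X = \<delta> powr (p - 1) * (?w * 3 powr - (?N + \<sigma>))"
  have X: "0 < X" unfolding X_def using \<delta> w by (intro mult_pos_pos) auto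
  \<comment> \<open>The oscillation allowed inside the sphere: small enough that the interior error is at most half
    of the contribution of the jump.\<close>
  define \<omega> where "\<omega> = (X / (16 * ?N * (I + 1))) powr (1 / (p - 1))"
  have NI: "0 < 16 * ?N * (I + 1)" using I(1) by (intro mult_pos_pos) auto
  have XNI: "0 < X / (16 * ?N * (I + 1))" using X NI by (rule divide_pos_pos)
  then have \<omega>: "0 < \<omega>" unfolding \<omega>_def by (intro powr_gt_zero[THEN iffD2]) linarith
  have \<omega>p: "4 * ?N * I * \<omega> powr (p - 1) \<le> X / 4"
  proof -
    have "\<omega> powr (p - 1) = X / (16 * ?N * (I + 1))"
    proof -
      have "(b powr (1 / (p - 1))) powr (p - 1) = b" if "0 < b" for b using that p by (simp add: powr_powr)
      then show ?thesis unfolding \<omega>_def using XNI by blast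
    qed
    moreover have "4 * N * I * (X / (16 * N * J)) = (I / J) * (X / 4)" if "0 < N" "0 < J" for N J
      using that by (simp add: field_simps)
    moreover have "0 < ?N" "0 < I + 1" using I(1) by auto
    ultimately have "4 * ?N * I * \<omega> powr (p - 1) = (I / (I + 1)) * (X / 4)" by metis
    also have "\<dots> \<le> 1 * (X / 4)" using I(1) X by (intro mult_right_mono) auto
    finally show ?thesis by simp
  qed
  define b where "b = (INF x\<in>ball 0 r. u x)"
  have bb: "bdd_below (u ` ball 0 r)" by (rule bdd_belowI2[of _ 0]) (rule u_nonneg)
  have ne: "ball (0::'a) r \<noteq> {}" using r by simp
  have b_le: "b \<le> u x" if "norm x < r" for x unfolding b_def using that bb by (intro cINF_lower) auto
  have "b < b + \<omega>" using \<omega> by simp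
  then obtain x1 where x1: "norm x1 < r" "u x1 < b + \<omega>"
    unfolding b_def using cINF_less_iff[OF ne bb, of "b + \<omega>"] by (auto simp: b_def)
  have osc: "\<bar>u x - u y\<bar> \<le> \<omega>" if "norm x1 \<le> norm x" "norm x < r" "norm x1 \<le> norm y" "norm y < r" for x y
    using that b_le[of x] b_le[of y] mono[of x1 x] mono[of x1 y] x1 by (auto simp: abs_le_iff)
  define \<rho> where "\<rho> = r - norm x1"
  have \<rho>: "0 < \<rho>" "\<rho> \<le> r" using x1 by (auto simp: \<rho>_def)
  define Fm where "Fm = \<bar>f 0\<bar> + L * T"
  have Fm: "0 \<le> Fm" using L T by (simp add: Fm_def)
  define Y where "Y = T powr (p - 1) * (\<rho> / 2) powr - \<sigma>"
  have Y: "0 \<le> Y" by (simp add: Y_def)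
  have sphere: "AE x in (lborel :: 'a measure). norm x \<noteq> r"
  proof -
    have "sphere (0::'a) r \<in> null_sets lborel"
      using negligible_sphere[of "0::'a" r] by (simp add: negligible_iff_null_sets null_sets_completion_iff)
    then have "AE x in lborel. x \<notin> sphere (0::'a) r" by (rule AE_not_in)
    then show ?thesis by (rule eventually_mono) auto
  qed
  have "AE z in (lborel :: 'a measure) \<Otimes>\<^sub>M (lborel :: 'a measure). norm (fst z) \<noteq> r \<and> norm (snd z) \<noteq> r"
    by (rule AE_lborel_pair[OF _ sphere]) measurable
  note sphere2 = this
  have key: "X * h powr - \<sigma> / 2 \<le> 2 * ?N * (Fm + 2 * I * (\<omega> powr (p - 1) * h powr - \<sigma> + Y))"
    if h: "0 < h" "h < \<rho> / 2" for h
  proof -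
    have hr: "h \<le> r" using h \<rho> by simp
    \<comment> \<open>A tent around the sphere: Lipschitz on the whole space, and linear in the inner shell.\<close>
    define \<zeta> where "\<zeta> = (\<lambda>x::'a. max 0 (min ((norm x - (r - h)) / h) ((r + h - norm x) / h)))"
    have [measurable]: "\<zeta> \<in> borel_measurable borel" unfolding \<zeta>_def by measurable
    have \<zeta>01: "0 \<le> \<zeta> x" "\<zeta> x \<le> 1" for x
    proof -
      show "0 \<le> \<zeta> x" by (simp add: \<zeta>_def)
      have "(norm x - (r - h)) / h \<le> 1 \<or> (r + h - norm x) / h \<le> 1" using h by (auto simp: field_simps)
      then show "\<zeta> x \<le> 1" by (auto simp: \<zeta>_def)
    qed
    have \<zeta>lip: "\<bar>\<zeta> x - \<zeta> y\<bar> \<le> min 1 (norm (x - y) / h)" for x y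
    proof -
      have n: "\<bar>norm x - norm y\<bar> \<le> norm (x - y)" by (rule norm_triangle_ineq3)
      let ?a = "\<lambda>x. (norm x - (r - h)) / h" and ?b = "\<lambda>x. (r + h - norm x) / h"
      have "?a x - ?a y = (norm x - norm y) / h" "?b x - ?b y = (norm y - norm x) / h"
        by (simp_all add: diff_divide_distrib[symmetric])
      moreover have "\<bar>(norm x - norm y) / h\<bar> \<le> norm (x - y) / h" "\<bar>(norm y - norm x) / h\<bar> \<le> norm (x - y) / h"
        using n h by (auto simp: abs_divide divide_right_mono abs_minus_commute)
      ultimately have "\<bar>?a x - ?a y\<bar> \<le> norm (x - y) / h" "\<bar>?b x - ?b y\<bar> \<le> norm (x - y) / h" by simp_all
      moreover have "\<bar>max 0 (min a b) - max 0 (min a' b')\<bar> \<le> d"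
        if "\<bar>a - a'\<bar> \<le> d" "\<bar>b - b'\<bar> \<le> d" for a b a' b' d :: real
        using that by (auto simp: max_def min_def)
      ultimately have "\<bar>\<zeta> x - \<zeta> y\<bar> \<le> norm (x - y) / h" unfolding \<zeta>_def by blast
      moreover have "\<bar>\<zeta> x - \<zeta> y\<bar> \<le> 1" using \<zeta>01[of x] \<zeta>01[of y] by auto
      ultimately show ?thesis by simp
    qed
    have \<zeta>fin: "energy \<sigma> p \<zeta> < \<infinity>"
    proof (rule lipschitz_cutoff_energy[OF sigma, where M="max 1 (1 / h)" and R="r + h"])
      fix x y
      show "\<bar>\<zeta> x - \<zeta> y\<bar> \<le> max 1 (1 / h) * min 1 (norm (x - y))"
      proof (cases "norm (x - y) \<le> 1")
        case True
        have "norm (x - y) / h = 1 / h * norm (x - y)" by simp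
        also have "\<dots> \<le> max 1 (1 / h) * norm (x - y)" by (intro mult_right_mono) auto
        finally show ?thesis using True \<zeta>lip[of x y] by (simp add: min_absorb2)
      next
        case False
        have "\<bar>\<zeta> x - \<zeta> y\<bar> \<le> 1" using \<zeta>lip[of x y] by simp
        then show ?thesis using False by (simp add: le_max_iff_disj)
      qed
      show "\<zeta> x = 0" if "x \<notin> ball 0 (r + h)"
      proof -
        have "(r + h - norm x) / h \<le> 0" using that h by (intro divide_nonpos_pos) auto
        moreover have "max 0 (min a b) = 0" if "b \<le> 0" for a b :: real using that by auto
        ultimately show ?thesis unfolding \<zeta>_def by blast
      qed
    qed (use p h in auto)
    define \<phi> where "\<phi> = (\<lambda>x. if norm x < r then \<zeta> x else 0)"
    have [measurable]: "\<phi> \<in> borel_measurable borel" unfolding \<phi>_def by measurable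
    have \<phi>01: "0 \<le> \<phi> x" "\<phi> x \<le> 1" for x using \<zeta>01[of x] by (auto simp: \<phi>_def)
    have \<phi>in: "\<phi> x = 0" if "norm x \<le> r - h" for x
    proof -
      have "(norm x - (r - h)) / h \<le> 0" using that h by (intro divide_nonpos_pos) auto
      moreover have "max 0 (min a b) = 0" if "a \<le> 0" for a b :: real using that by auto
      ultimately have "\<zeta> x = 0" unfolding \<zeta>_def by blast
      then show ?thesis by (simp add: \<phi>_def)
    qed
    have \<phi>fin: "energy \<sigma> p \<phi> < \<infinity>"
    proof (rule energy_finite_le_AE[OF p(1), where u="\<zeta>" and v=u and K="max 1 (1 / \<delta>)"])
      let ?K = "max 1 (1 / \<delta>)"
      have big: "1 \<le> ?K * \<bar>u x - u y\<bar>" if "\<delta> \<le> \<bar>u x - u y\<bar>" for x y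
      proof -
        have "1 = 1 / \<delta> * \<delta>" using \<delta> by simp
        also have "\<dots> \<le> ?K * \<bar>u x - u y\<bar>" using that \<delta> by (intro mult_mono) auto
        finally show ?thesis .
      qed
      show "AE z in lborel2. \<bar>\<phi> (fst z) - \<phi> (snd z)\<bar>
          \<le> ?K * (\<bar>\<zeta> (fst z) - \<zeta> (snd z)\<bar> + \<bar>u (fst z) - u (snd z)\<bar>)"
        using sphere2
      proof eventually_elim
        case (elim z)
        let ?x = "fst z" and ?y = "snd z"
        have K1: "\<bar>\<zeta> ?x - \<zeta> ?y\<bar> \<le> ?K * \<bar>\<zeta> ?x - \<zeta> ?y\<bar>"
          using mult_right_mono[of 1 ?K "\<bar>\<zeta> ?x - \<zeta> ?y\<bar>"] by simp
        have K2: "0 \<le> ?K * \<bar>u ?x - u ?y\<bar>" by (intro mult_nonneg_nonneg) auto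
        consider "norm ?x < r" "norm ?y < r" | "norm ?x < r" "r < norm ?y" | "r < norm ?x" "norm ?y < r" | "r < norm ?x" "r < norm ?y"
          using elim by linarith
        then have "\<bar>\<phi> ?x - \<phi> ?y\<bar> \<le> ?K * \<bar>\<zeta> ?x - \<zeta> ?y\<bar> + ?K * \<bar>u ?x - u ?y\<bar>"
        proof cases
          case 1
          then have "\<bar>\<phi> ?x - \<phi> ?y\<bar> = \<bar>\<zeta> ?x - \<zeta> ?y\<bar>" by (simp add: \<phi>_def)
          then show ?thesis using K1 K2 by linarith
        next
          case 2
          then have "1 \<le> ?K * \<bar>u ?x - u ?y\<bar>" using jump[of ?x ?y] by (intro big) simp
          moreover have "\<bar>\<phi> ?x - \<phi> ?y\<bar> \<le> 1" using 2 \<zeta>01[of ?x] by (simp add: \<phi>_def)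
          ultimately show ?thesis using K1 by linarith
        next
          case 3
          then have "1 \<le> ?K * \<bar>u ?x - u ?y\<bar>" using jump[of ?y ?x] by (intro big) simp
          moreover have "\<bar>\<phi> ?x - \<phi> ?y\<bar> \<le> 1" using 3 \<zeta>01[of ?y] by (simp add: \<phi>_def)
          ultimately show ?thesis using K1 by linarith
        next
          case 4
          then have "\<bar>\<phi> ?x - \<phi> ?y\<bar> = 0" by (simp add: \<phi>_def)
          then show ?thesis using K1 K2 by linarith
        qed
        then show ?case by (simp only: distrib_left)
      qed
    qed (use \<zeta>fin u_energy in auto)
    have int: "integrable lborel2 (form_integrand \<sigma> p u \<phi>)"
      by (rule form_integrable[OF p(1) _ _ u_energy \<phi>fin]) auto
    define S where "S = {x::'a. r - h < norm x \<and> norm x < r}"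
    define A where "A = ?w * (r ^ ?n - (r - h) ^ ?n)"
    define A' where "A' = ?w * (r ^ ?n - (r - h / 2) ^ ?n)"
    have [measurable]: "S \<in> sets borel" unfolding S_def by measurable
    have SA: "emeasure lborel S = ennreal A" unfolding S_def A_def using h hr by (intro emeasure_annulus)
    have vol: "A \<le> 2 * ?N * A'" "0 < A'"
    proof -
      note c = annulus_volume_compare[OF h(1) hr, of ?n]
      have "A \<le> ?w * (2 * ?N * (r ^ ?n - (r - h / 2) ^ ?n))"
        unfolding A_def using c(1) w by (intro mult_left_mono) auto
      then show "A \<le> 2 * ?N * A'" by (simp add: A'_def mult_ac)
      show "0 < A'" unfolding A'_def using c(2) w by (intro mult_pos_pos) auto
    qed
    have A0: "0 \<le> A" unfolding A_def using w h hr by (intro mult_nonneg_nonneg) (auto intro!: power_mono)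
    have wk: "(\<integral>z. form_integrand \<sigma> p u \<phi> z \<partial>lborel2) = (\<integral>x. f (u x) * \<phi> x \<partial>lborel)"
    proof (rule weak)
      show "\<bar>\<phi> x\<bar> \<le> 1" for x using \<phi>01[of x] by simp
      show "\<phi> x = 0" if "x \<notin> ball 0 R" for x using that r by (simp add: \<phi>_def)
    qed (use \<phi>fin in auto)
    have rhs: "(\<integral>x. f (u x) * \<phi> x \<partial>lborel) \<le> Fm * A"
    proof -
      have "(\<integral>x. f (u x) * \<phi> x \<partial>lborel) \<le> (\<integral>x. Fm * indicator S x \<partial>lborel)"
      proof (rule integral_mono_AE')
        show "integrable lborel (\<lambda>x. Fm * indicator S x)"
          by (intro integrable_mult_right integrable_real_indicator) (auto simp: SA)
        show "AE x in lborel. f (u x) * \<phi> x \<le> Fm * indicator S x"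
        proof (rule AE_I2)
          fix x
          show "f (u x) * \<phi> x \<le> Fm * indicator S x"
          proof (cases "x \<in> S")
            case True
            have "f (u x) * \<phi> x \<le> Fm * 1"
              using f_u_bound[of x] \<phi>01[of x] Fm by (intro mult_mono) (auto simp: Fm_def)
            then show ?thesis using True by simp
          next
            case False
            then have "\<phi> x = 0" using \<phi>in[of x] by (auto simp: S_def \<phi>_def)
            then show ?thesis using False by simp
          qed
        qed
      qed (use Fm in auto)
      also have "\<dots> = Fm * A" using A0 by (simp add: measure_def SA)
      finally show ?thesis .
    qed
    define k where "k = (\<lambda>d z. (indicator S (fst z) + indicator S (snd z)) * (min 1 (norm (fst z - snd z :: 'a) / d) * kern \<sigma> (fst z - snd z)))"
    have kint: "integrable lborel2 (k d)" "(\<integral>z. k d z \<partial>lborel2) \<le> 2 * (A * (I * d powr - \<sigma>))" if "0 < d" for d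
      using strip_integral[OF _ SA A0 _ I(2)[OF that] that] I(1) unfolding k_def by auto
    have k0: "0 \<le> k d z" if "0 < d" for d z using that by (auto simp: k_def)
    define Bd where "Bd = (\<lambda>z. \<omega> powr (p - 1) * k h z + T powr (p - 1) * k (\<rho> / 2) z)"
    have Bdint: "integrable lborel2 Bd"
      unfolding Bd_def using kint(1) h \<rho> by auto
    have Bdle: "(\<integral>z. Bd z \<partial>lborel2) \<le> 2 * A * I * (\<omega> powr (p - 1) * h powr - \<sigma> + Y)"
    proof -
      have "(\<integral>z. Bd z \<partial>lborel2) = \<omega> powr (p - 1) * (\<integral>z. k h z \<partial>lborel2)
          + T powr (p - 1) * (\<integral>z. k (\<rho> / 2) z \<partial>lborel2)"
        unfolding Bd_def using kint(1)[of h] kint(1)[of "\<rho> / 2"] h \<rho> by simp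
      also have "\<dots> \<le> \<omega> powr (p - 1) * (2 * (A * (I * h powr - \<sigma>))) + T powr (p - 1) * (2 * (A * (I * (\<rho> / 2) powr - \<sigma>)))"
        using h \<rho> by (intro add_mono mult_left_mono kint(2)) auto
      also have "\<dots> = 2 * A * I * (\<omega> powr (p - 1) * h powr - \<sigma> + Y)" by (simp add: Y_def algebra_simps)
      finally show ?thesis .
    qed
    define Gd where "Gd = (\<lambda>z. \<delta> powr (p - 1) * (\<phi> (fst z) * (indicator {y. r < norm y} (snd z) * kern \<sigma> (fst z - snd z))))"
    have Gdm[measurable]: "Gd \<in> borel_measurable lborel2" unfolding Gd_def by measurable
    have Gd0: "0 \<le> Gd z" for z unfolding Gd_def using \<phi>01 by auto
    have pointwise: "Gd z \<le> form_integrand \<sigma> p u \<phi> z + Bd z" if s: "norm (fst z) \<noteq> r" "norm (snd z) \<noteq> r" for z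
    proof -
      define x y where "x = fst z" and "y = snd z"
      have Bd0: "0 \<le> Bd z" unfolding Bd_def using k0 h \<rho> by (auto intro!: add_nonneg_nonneg mult_nonneg_nonneg)
      consider "norm x < r" "norm y < r" | "norm x < r" "r < norm y" | "r < norm x" "norm y < r" | "r < norm x" "r < norm y"
        using s unfolding x_def y_def by linarith
      then show ?thesis
      proof cases
        case 1
        have G: "Gd z = 0" using 1 by (simp add: Gd_def y_def)
        have "\<bar>form_integrand \<sigma> p u \<phi> z\<bar> \<le> Bd z"
        proof (cases "x \<in> S \<or> y \<in> S")
          case False
          then have "\<phi> x = 0" "\<phi> y = 0" using 1 \<phi>in[of x] \<phi>in[of y] by (auto simp: S_def)
          then show ?thesis using Bd0 by (simp add: form_integrand_def x_def y_def)
        next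
          case True
          have ind: "1 \<le> indicator S x + (indicator S y :: real)" using True by (auto simp: indicator_def)
          have eq: "\<bar>form_integrand \<sigma> p u \<phi> z\<bar> = \<bar>u x - u y\<bar> powr (p - 1) * \<bar>\<zeta> x - \<zeta> y\<bar> * kern \<sigma> (x - y)"
            using 1 by (simp add: form_integrand_def abs_mult abs_spow \<phi>_def x_def y_def)
          have kge: "min 1 (norm (x - y) / d) * kern \<sigma> (x - y) \<le> k d z" if "0 < d" for d
            unfolding k_def x_def[symmetric] y_def[symmetric]
            using mult_right_mono[OF ind, of "min 1 (norm (x - y) / d) * kern \<sigma> (x - y)"] that by simp
          show ?thesis
          proof (cases "norm x1 \<le> norm x \<and> norm x1 \<le> norm y")
            case True
            have "\<bar>u x - u y\<bar> powr (p - 1) * \<bar>\<zeta> x - \<zeta> y\<bar> * kern \<sigma> (x - y)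
                \<le> \<omega> powr (p - 1) * min 1 (norm (x - y) / h) * kern \<sigma> (x - y)"
              using osc[of x y] True 1 p \<zeta>lip[of x y] by (intro mult_right_mono mult_mono powr_mono2) auto
            also have "\<dots> \<le> \<omega> powr (p - 1) * k h z"
              unfolding mult.assoc by (intro mult_left_mono kge h) simp
            also have "\<dots> \<le> Bd z" unfolding Bd_def using k0[of "\<rho> / 2" z] \<rho> by simp
            finally show ?thesis unfolding eq .
          next
            case False
            have "\<rho> / 2 \<le> norm (x - y)"
              using \<open>x \<in> S \<or> y \<in> S\<close> False h norm_triangle_ineq3[of x y] by (auto simp: S_def \<rho>_def abs_le_iff)
            then have m1: "min 1 (norm (x - y) / (\<rho> / 2)) = 1" using \<rho> by (simp add: field_simps)
            have "\<bar>u x - u y\<bar> \<le> T" using u_diff_range[of x y] by auto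
            then have "\<bar>u x - u y\<bar> powr (p - 1) * \<bar>\<zeta> x - \<zeta> y\<bar> * kern \<sigma> (x - y)
                \<le> T powr (p - 1) * 1 * kern \<sigma> (x - y)"
              using p \<zeta>lip[of x y] by (intro mult_right_mono mult_mono powr_mono2) auto
            also have "\<dots> = T powr (p - 1) * (min 1 (norm (x - y) / (\<rho> / 2)) * kern \<sigma> (x - y))" unfolding m1 by simp
            also have "\<dots> \<le> T powr (p - 1) * k (\<rho> / 2) z"
              using \<rho> by (intro mult_left_mono kge) auto
            also have "\<dots> \<le> Bd z" unfolding Bd_def using k0[of h z] h by simp
            finally show ?thesis unfolding eq .
          qed
        qed
        then show ?thesis using G by simp
      next
        case 2
        have "\<delta> powr (p - 1) \<le> spow p (u x - u y)"
          using jump[OF 2] \<delta> p by (subst spow_pos) (auto intro!: powr_mono2)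
        then have "\<delta> powr (p - 1) * (\<phi> x * kern \<sigma> (x - y)) \<le> spow p (u x - u y) * (\<phi> x * kern \<sigma> (x - y))"
          using \<phi>01[of x] by (intro mult_right_mono) auto
        moreover have "\<phi> y = 0" using 2 by (simp add: \<phi>_def)
        ultimately have "Gd z \<le> form_integrand \<sigma> p u \<phi> z"
          using 2 by (simp add: Gd_def form_integrand_def x_def y_def)
        then show ?thesis using Bd0 by simp
      next
        case 3
        have "0 \<le> spow p (u y - u x)" using jump[OF 3(2,1)] \<delta> by (subst spow_pos) auto
        then have "0 \<le> spow p (u x - u y) * (\<phi> x - \<phi> y)"
          using 3 \<phi>01[of y] by (simp add: spow_swap[of p "u x" "u y"] \<phi>_def)
        then have "0 \<le> form_integrand \<sigma> p u \<phi> z" by (simp add: form_integrand_def x_def y_def)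
        moreover have "Gd z = 0" using 3 by (simp add: Gd_def x_def y_def)
        ultimately show ?thesis using Bd0 by simp
      next
        case 4
        then have "Gd z = 0" "form_integrand \<sigma> p u \<phi> z = 0" by (simp_all add: Gd_def form_integrand_def \<phi>_def x_def y_def)
        then show ?thesis using Bd0 by simp
      qed
    qed
    define S' where "S' = {x::'a. r - h / 2 < norm x \<and> norm x < r}"
    have [measurable]: "S' \<in> sets borel" unfolding S'_def by measurable
    have SA': "emeasure lborel S' = ennreal A'" unfolding S'_def A'_def using h hr by (intro emeasure_annulus) auto
    have "ennreal (X * h powr - \<sigma> / 2 * A') = (\<integral>\<^sup>+x. ennreal (X * h powr - \<sigma> / 2) * indicator S' x \<partial>lborel)"
    proof -
      have "ennreal (X * h powr - \<sigma> / 2 * A') = ennreal (X * h powr - \<sigma> / 2) * ennreal A'"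
        using X by (intro ennreal_mult') simp
      then show ?thesis by (subst nn_integral_cmult_indicator) (simp_all only: SA', measurable)
    qed
    also have "\<dots> \<le> (\<integral>\<^sup>+x. \<integral>\<^sup>+y. ennreal (Gd (x, y)) \<partial>lborel \<partial>lborel)"
    proof (rule nn_integral_mono)
      fix x :: 'a
      show "ennreal (X * h powr - \<sigma> / 2) * indicator S' x \<le> (\<integral>\<^sup>+y. ennreal (Gd (x, y)) \<partial>lborel)"
      proof (cases "x \<in> S'")
        case True
        then have x: "r - h / 2 < norm x" "norm x < r" by (auto simp: S'_def)
        have "1 / 2 \<le> (norm x - (r - h)) / h" "1 / 2 \<le> (r + h - norm x) / h"
          using x h by (auto simp: field_simps)
        then have \<phi>2: "1 / 2 \<le> \<phi> x" using x by (simp add: \<phi>_def \<zeta>_def)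
        let ?M = "?w * 3 powr - (?N + \<sigma>) * h powr - \<sigma>"
        have "X * h powr - \<sigma> / 2 = \<delta> powr (p - 1) * (1 / 2) * ?M" by (simp add: X_def)
        also have "\<dots> \<le> \<delta> powr (p - 1) * \<phi> x * ?M"
          using \<phi>2 w by (intro mult_right_mono mult_left_mono) auto
        finally have "ennreal (X * h powr - \<sigma> / 2) \<le> ennreal (\<delta> powr (p - 1) * \<phi> x * ?M)" by (rule ennreal_leI)
        also have "\<dots> = ennreal (\<delta> powr (p - 1) * \<phi> x) * ennreal ?M"
          using \<phi>01[of x] by (intro ennreal_mult') simp
        also have "\<dots> \<le> ennreal (\<delta> powr (p - 1) * \<phi> x) * (\<integral>\<^sup>+y. indicator {y. r < norm y} y * ennreal (kern \<sigma> (x - y)) \<partial>lborel)"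
          using x h hr sigma by (intro mult_left_mono kern_mass_outside_ball) auto
        also have "\<dots> = (\<integral>\<^sup>+y. ennreal (\<delta> powr (p - 1) * \<phi> x) * (indicator {y. r < norm y} y * ennreal (kern \<sigma> (x - y))) \<partial>lborel)"
          by (rule nn_integral_cmult[symmetric]) measurable
        also have "\<dots> = (\<integral>\<^sup>+y. ennreal (Gd (x, y)) \<partial>lborel)"
          using \<phi>01[of x] by (intro nn_integral_cong) (auto simp: Gd_def indicator_def ennreal_mult mult.assoc)
        finally show ?thesis using True by simp
      qed simp
    qed
    also have "\<dots> = (\<integral>\<^sup>+z. ennreal (Gd z) \<partial>lborel2)"
      by (rule lborel.nn_integral_fst[of "\<lambda>z. ennreal (Gd z)"]) measurable
    also have "\<dots> \<le> (\<integral>\<^sup>+z. ennreal (form_integrand \<sigma> p u \<phi> z + Bd z) \<partial>lborel2)"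
      using sphere2 by (intro nn_integral_mono_AE) (erule eventually_mono, auto intro!: ennreal_leI pointwise)
    also have "\<dots> = ennreal (\<integral>z. form_integrand \<sigma> p u \<phi> z + Bd z \<partial>lborel2)"
    proof (rule nn_integral_eq_integral)
      show "AE z in lborel2. 0 \<le> form_integrand \<sigma> p u \<phi> z + Bd z"
        using sphere2 by (rule eventually_mono) (use pointwise Gd0 order_trans in blast)
    qed (use int Bdint in auto)
    also have "(\<integral>z. form_integrand \<sigma> p u \<phi> z + Bd z \<partial>lborel2) = (\<integral>x. f (u x) * \<phi> x \<partial>lborel) + (\<integral>z. Bd z \<partial>lborel2)"
      using int Bdint wk by simp
    also have "ennreal \<dots> \<le> ennreal (Fm * A + 2 * A * I * (\<omega> powr (p - 1) * h powr - \<sigma> + Y))"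
      by (intro ennreal_leI add_mono rhs Bdle)
    also have "Fm * A + 2 * A * I * (\<omega> powr (p - 1) * h powr - \<sigma> + Y) = A * (Fm + 2 * I * (\<omega> powr (p - 1) * h powr - \<sigma> + Y))"
      by (simp add: algebra_simps)
    also have "ennreal \<dots> \<le> ennreal ((2 * ?N * A') * (Fm + 2 * I * (\<omega> powr (p - 1) * h powr - \<sigma> + Y)))"
      using vol(1) Fm I(1) Y by (intro ennreal_leI mult_right_mono) auto
    finally have "X * h powr - \<sigma> / 2 * A' \<le> (2 * ?N * A') * (Fm + 2 * I * (\<omega> powr (p - 1) * h powr - \<sigma> + Y))"
      using vol(2) Fm I(1) Y by (subst (asm) ennreal_le_iff) (auto intro!: mult_nonneg_nonneg add_nonneg_nonneg)
    then have "(X * h powr - \<sigma> / 2) * A' \<le> (2 * ?N * (Fm + 2 * I * (\<omega> powr (p - 1) * h powr - \<sigma> + Y))) * A'"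
      by (simp only: mult_ac)
    then show ?thesis using vol(2) by (simp only: mult_le_cancel_right_pos)
  qed
  define Z where "Z = 2 * ?N * (Fm + 2 * I * Y)"
  have Z: "0 \<le> Z" unfolding Z_def using Fm I(1) Y by auto
  have key2: "X / 4 * h powr - \<sigma> \<le> Z" if h: "0 < h" "h < \<rho> / 2" for h
  proof -
    have "2 * ?N * (Fm + 2 * I * (\<omega> powr (p - 1) * h powr - \<sigma> + Y)) = Z + (4 * ?N * I * \<omega> powr (p - 1)) * h powr - \<sigma>"
      by (simp add: Z_def algebra_simps)
    also have "\<dots> \<le> Z + X / 4 * h powr - \<sigma>" using \<omega>p by (intro add_left_mono mult_right_mono) auto
    finally show ?thesis using key[OF h] by simp
  qed
  define h where "h = min (\<rho> / 4) ((X / (4 * (Z + 1))) powr (1 / \<sigma>))"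
  have q: "0 < X / (4 * (Z + 1))" using X Z by simp
  have h: "0 < h" "h < \<rho> / 2" using \<rho> q by (auto simp: h_def min_less_iff_disj intro!: powr_gt_zero[THEN iffD2])
  have "((X / (4 * (Z + 1))) powr (1 / \<sigma>)) powr - \<sigma> \<le> h powr - \<sigma>"
    using h sigma by (intro powr_mono2') (auto simp: h_def)
  moreover have "(c powr (1 / \<sigma>)) powr - \<sigma> = 1 / c" if "0 < c" for c
    using that sigma by (simp add: powr_powr powr_minus_divide)
  ultimately have "1 / (X / (4 * (Z + 1))) \<le> h powr - \<sigma>" using q by simp
  then have "X / 4 * (1 / (X / (4 * (Z + 1)))) \<le> X / 4 * h powr - \<sigma>" using X by (intro mult_left_mono) auto
  moreover have "X / 4 * (1 / (X / (4 * (Z + 1)))) = Z + 1" using X Z by simp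
  ultimately show False using key2[OF h] by simp
qed

lemma continuous_of_antimono:
  assumes mono: "\<And>x y. norm y \<le> norm x \<Longrightarrow> u x \<le> u y" and zero: "u 0 = (SUP x\<in>- {0}. u x)"
  shows "continuous_on UNIV u"
  unfolding continuous_on_iff
proof (intro ballI allI impI)
  fix x :: 'a and \<epsilon> :: real
  assume \<epsilon>: "0 < \<epsilon>"
  show "\<exists>d>0. \<forall>x'\<in>UNIV. dist x' x < d \<longrightarrow> dist (u x') (u x) < \<epsilon>"
  proof (cases "x = 0")
    case True
    obtain b :: 'a where b: "b \<in> Basis" using nonempty_Basis by blast
    then have ne: "- {0::'a} \<noteq> {}" using nonzero_Basis by blast
    have bdd: "bdd_above (u ` (- {0}))" by (intro bdd_aboveI2[of _ _ T] u_le)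
    have "u 0 - \<epsilon> < (SUP x\<in>- {0}. u x)" using \<epsilon> zero by simp
    then obtain y where y: "y \<noteq> 0" "u 0 - \<epsilon> < u y" using less_cSUP_iff[OF ne bdd] by auto
    show ?thesis
    proof (intro exI[of _ "norm y"] conjI ballI impI)
      fix x' assume "dist x' x < norm y"
      then have "u y \<le> u x'" "u x' \<le> u 0" using True by (auto intro!: mono)
      then show "dist (u x') (u x) < \<epsilon>" using y True by (simp add: dist_real_def)
    qed (use y in simp)
  next
    case False
    then have n: "0 < norm x" by simp
    have n3: "\<bar>norm x' - norm x\<bar> \<le> dist x' x" for x' unfolding dist_norm by (rule norm_triangle_ineq3)
    show ?thesis
    proof (cases "norm x \<le> R")
      case True
      obtain a b where ab: "norm a < norm x" "norm x < norm b" "u a - u b < \<epsilon>"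
        using no_jump[OF mono n True \<epsilon>] by blast
      show ?thesis
      proof (intro exI[of _ "min (norm x - norm a) (norm b - norm x)"] conjI ballI impI)
        fix x' assume d: "dist x' x < min (norm x - norm a) (norm b - norm x)"
        have "norm a \<le> norm x'" "norm x' \<le> norm b" using d n3[of x'] by auto
        then have "u b \<le> u x'" "u x' \<le> u a" "u b \<le> u x" "u x \<le> u a" using ab by (auto intro!: mono)
        then show "dist (u x') (u x) < \<epsilon>" using ab by (simp add: dist_real_def)
      qed (use ab in simp)
    next
      case False
      show ?thesis
      proof (intro exI[of _ "norm x - R"] conjI ballI impI)
        fix x' assume d: "dist x' x < norm x - R"
        have "R \<le> norm x'" using d n3[of x'] by auto
        then have "u x' = 0" "u x = 0" using False by (auto intro!: u_outside)
        then show "dist (u x') (u x) < \<epsilon>" using \<epsilon> by simp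
      qed (use False in simp)
    qed
  qed
qed

text \<open>If \<open>u\<close> were constant on an annulus, the gap for the plane tangent to its middle sphere would vanish
  near the point of tangency.\<close>

lemma strictly_decreasing_of_antimono:
  assumes nontrivial: "\<not> (AE x in lborel. u x = 0)"
    and mono: "\<And>x y. norm y \<le> norm x \<Longrightarrow> u x \<le> u y"
  shows "strictly_radially_decreasing_on (ball 0 R) u"
  unfolding strictly_radially_decreasing_on_def
proof (intro ballI impI, rule ccontr)
  fix x y :: 'a assume xy: "x \<in> ball 0 R" "y \<in> ball 0 R" "norm x < norm y" and "\<not> u y < u x"
  then have eq: "u z = u x" if "norm x \<le> norm z" "norm z \<le> norm y" for z
    using mono[of x z] mono[of z y] that by simp
  have ny: "0 < norm y" using xy norm_ge_zero[of x] by linarith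
  define e where "e = y /\<^sub>R norm y"
  have e: "norm e = 1" using ny by (simp add: e_def)
  define l where "l = (norm x + norm y) / 2"
  have l: "0 < l" "l < R" "norm x < l" "l < norm y" using xy ny norm_ge_zero[of x] by (auto simp: l_def simp del: norm_ge_zero)
  let ?S = "mirror e l"
  have "good_plane e l" using l by (intro all_planes_good[OF nontrivial e]) simp
  then have strict: "AE z in lborel. l < z \<bullet> e \<and> norm z < R \<longrightarrow> 0 < gap e l z"
    by (rule good_plane_strict[OF nontrivial e l(1,2)])
  define W where "W = {z. l < z \<bullet> e} \<inter> {z. norm z < norm y} \<inter> {z. norm x < norm (?S z)} \<inter> {z. norm (?S z) < norm y}"
  have "open W"
    unfolding W_def mirror_def
    by (intro open_Int open_Collect_less continuous_intros)
  moreover have "AE z in lborel. z \<notin> W" using strict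
  proof eventually_elim
    case (elim z)
    show ?case
    proof
      assume z: "z \<in> W"
      have "z \<bullet> e \<le> norm z" using norm_cauchy_schwarz[of z e] e by simp
      then have "u z = u x" "u (?S z) = u x" using z l by (auto simp: W_def intro!: eq)
      then have "gap e l z = 0" by (simp add: gap_def)
      moreover have "0 < gap e l z" using elim z xy by (auto simp: W_def)
      ultimately show False by simp
    qed
  qed
  ultimately have "W = {}" by (rule AE_notin_open_imp_empty)
  moreover have "(l + (norm y - norm x) / 4) *\<^sub>R e \<in> W"
  proof -
    let ?t = "(norm y - norm x) / 4"
    have t: "0 < ?t" "norm x < l - ?t" "l + ?t < norm y" "l - ?t < norm y" using xy(3) by (simp_all add: l_def field_simps)
    have ee: "e \<bullet> e = 1" using e by (simp add: dot_square_norm)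
    have "?S ((l + ?t) *\<^sub>R e) = (l + ?t) *\<^sub>R e - (2 * ?t) *\<^sub>R e" by (simp add: mirror_def ee)
    also have "\<dots> = (l - ?t) *\<^sub>R e" unfolding scaleR_left_diff_distrib[symmetric] by (simp add: field_simps)
    finally have "?S ((l + ?t) *\<^sub>R e) = (l - ?t) *\<^sub>R e" .
    moreover have "norm ((l + ?t) *\<^sub>R e) = l + ?t" "norm ((l - ?t) *\<^sub>R e) = l - ?t"
      using t l e norm_ge_zero[of x] by (simp_all del: norm_ge_zero)
    moreover have "((l + ?t) *\<^sub>R e) \<bullet> e = l + ?t" by (simp add: ee)
    ultimately show ?thesis unfolding W_def using t l by simp
  qed
  ultimately show False by blast
qed

end

section \<open>From weak solutions to bounded Borel solutions\<close>

lemma AE_lebesgue_pair: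
  assumes [measurable]: "Measurable.pred borel P" and ae: "AE x in (lborel :: 'a::euclidean_space measure). P x"
  shows "AE z in (lebesgue :: ('a \<times> 'a) measure). P (fst z) \<and> P (snd z)"
  by (rule AE_completion) (use AE_lborel_pair[OF assms] in \<open>simp only: lborel_prod\<close>)

lemma AE_eq_lebesgue_pair:
  fixes u v :: "'a::euclidean_space \<Rightarrow> real"
  assumes ae: "AE x in lborel. u x = v x"
  shows "AE z in (lebesgue :: ('a \<times> 'a) measure). u (fst z) = v (fst z) \<and> u (snd z) = v (snd z)"
proof -
  obtain N where N: "N \<in> null_sets lborel" "{x. u x \<noteq> v x} \<subseteq> N"
    using ae by (auto simp: eventually_ae_filter)
  have "AE x in lborel. x \<notin> N" using N(1) by (rule AE_not_in)
  moreover have "Measurable.pred borel (\<lambda>x. x \<notin> N)" using N(1) by auto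
  ultimately have "AE z in (lebesgue :: ('a \<times> 'a) measure). fst z \<notin> N \<and> snd z \<notin> N"
    by (intro AE_lebesgue_pair)
  then show ?thesis by (rule eventually_mono) (use N(2) in blast)
qed

lemma gagliardo_energy_eq:
  fixes u v :: "'a::euclidean_space \<Rightarrow> real"
  assumes [measurable]: "v \<in> borel_measurable borel" and ae: "AE x in lborel. u x = v x"
  shows "gagliardo_energy s p u = energy (s * p) p v"
proof -
  have "gagliardo_energy s p u = (\<integral>\<^sup>+z. ennreal (\<bar>v (fst z) - v (snd z)\<bar> powr p * kern (s * p) (fst z - snd z)) \<partial>(lebesgue :: ('a \<times> 'a) measure))"
    unfolding gagliardo_energy_def
  proof (rule nn_integral_cong_AE)
    show "AE z in lebesgue. (case z of (x, y) \<Rightarrow> ennreal (\<bar>u x - u y\<bar> powr p / norm (x - y) powr (real DIM('a) + s * p)))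
        = ennreal (\<bar>v (fst z) - v (snd z)\<bar> powr p * kern (s * p) (fst z - snd z))"
      using AE_eq_lebesgue_pair[OF ae] by (rule eventually_mono) (auto simp: kern_def split: prod.splits)
  qed
  also have "\<dots> = energy (s * p) p v"
    unfolding energy_def by (simp only: nn_integral_completion lborel_prod)
  finally show ?thesis .
qed

lemma frac_p_form_eq:
  fixes u v \<phi> :: "'a::euclidean_space \<Rightarrow> real"
  assumes [measurable]: "v \<in> borel_measurable borel" "\<phi> \<in> borel_measurable borel" and ae: "AE x in lborel. u x = v x"
  shows "frac_p_form s p u \<phi> = (\<integral>z. form_integrand (s * p) p v \<phi> z \<partial>lborel2)"
proof -
  define F where "F = (\<lambda>z. \<bar>u (fst z) - u (snd z)\<bar> powr (p - 2) * (u (fst z) - u (snd z)) * (\<phi> (fst z) - \<phi> (snd z))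
      / norm (fst z - snd z) powr (real DIM('a) + s * p))"
  have ae2: "AE z in (lebesgue :: ('a \<times> 'a) measure). form_integrand (s * p) p v \<phi> z = F z"
    using AE_eq_lebesgue_pair[OF ae] by (rule eventually_mono) (auto simp: form_integrand_def kern_def spow_def F_def)
  have fm: "form_integrand (s * p) p v \<phi> \<in> borel_measurable (lborel :: ('a \<times> 'a) measure)"
    using form_measurable[OF assms(1,2), of "s * p" p] by (simp only: lborel_prod)
  have fm': "form_integrand (s * p) p v \<phi> \<in> borel_measurable (lebesgue :: ('a \<times> 'a) measure)"
    by (rule measurable_completion[OF fm])
  have Fm: "F \<in> borel_measurable (lebesgue :: ('a \<times> 'a) measure)"
    by (rule borel_measurable_AE[OF fm' ae2])
  have "frac_p_form s p u \<phi> = (\<integral>z. F z \<partial>(lebesgue :: ('a \<times> 'a) measure))"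
    unfolding frac_p_form_def F_def by (simp only: case_prod_beta')
  also have "\<dots> = (\<integral>z. form_integrand (s * p) p v \<phi> z \<partial>(lebesgue :: ('a \<times> 'a) measure))"
    using ae2 by (intro integral_cong_AE Fm fm') (auto elim: eventually_mono)
  also have "\<dots> = (\<integral>z. form_integrand (s * p) p v \<phi> z \<partial>lborel2)"
    unfolding lborel_prod by (rule integral_completion) (use fm in simp)
  finally show ?thesis .
qed

lemma Wsp0_borelI:
  fixes \<phi> :: "'a::euclidean_space \<Rightarrow> real"
  assumes [measurable]: "\<phi> \<in> borel_measurable borel" and int: "integrable lborel (\<lambda>x. \<bar>\<phi> x\<bar> powr p)"
    and fin: "energy (s * p) p \<phi> < \<infinity>" and out: "\<And>x. x \<notin> \<Omega> \<Longrightarrow> \<phi> x = 0"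
  shows "\<phi> \<in> Wsp0 s p \<Omega>"
proof -
  have "integrable lebesgue (\<lambda>x. \<bar>\<phi> x\<bar> powr p)" using int by (simp add: integrable_completion)
  then show ?thesis
    using fin gagliardo_energy_eq[of \<phi> \<phi> s p] out by (auto simp: Wsp0_def Wsp_def Lp_space_def measurable_completion)
qed

lemma weak_solution_borel:
  fixes u v \<phi> :: "'a::euclidean_space \<Rightarrow> real"
  assumes sol: "weak_solution s p f (ball 0 R) u" and \<phi>: "\<phi> \<in> Wsp0 s p (ball 0 R)"
    and m[measurable]: "f \<in> borel_measurable borel" "v \<in> borel_measurable borel" "\<phi> \<in> borel_measurable borel"
    and out: "\<And>x. x \<notin> ball 0 R \<Longrightarrow> \<phi> x = 0" and ae: "AE x in lborel. u x = v x"
  shows "integrable lborel (\<lambda>x. f (v x) * \<phi> x)"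
    and "(\<integral>z. form_integrand (s * p) p v \<phi> z \<partial>lborel2) = (\<integral>x. f (v x) * \<phi> x \<partial>lborel)"
proof -
  define G where "G = (\<lambda>x. indicator (ball 0 R) x *\<^sub>R (f (u x) * \<phi> x))"
  have ind: "G x = f (u x) * \<phi> x" for x using out[of x] by (auto simp: indicator_def G_def)
  have ae': "AE x in lebesgue. f (v x) * \<phi> x = G x"
    by (rule AE_completion) (use ae ind in \<open>auto elim!: eventually_mono\<close>)
  have fm: "(\<lambda>x. f (v x) * \<phi> x) \<in> borel_measurable lborel" by measurable
  have fm': "(\<lambda>x. f (v x) * \<phi> x) \<in> borel_measurable lebesgue" by (rule measurable_completion[OF fm])
  have iG: "integrable lebesgue G"
    using sol \<phi> unfolding weak_solution_def in_Wsp0_dual_def set_integrable_def G_def by auto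
  then have Gm: "G \<in> borel_measurable lebesgue" by simp
  have ae'': "AE x in lebesgue. G x = f (v x) * \<phi> x" using ae' by (auto elim: eventually_mono)
  have "integrable lebesgue (\<lambda>x. f (v x) * \<phi> x)"
    by (rule integrable_cong_AE_imp[OF iG fm' ae''])
  then show "integrable lborel (\<lambda>x. f (v x) * \<phi> x)" using integrable_completion[OF fm] by blast
  have "(\<integral>z. form_integrand (s * p) p v \<phi> z \<partial>lborel2) = frac_p_form s p u \<phi>"
    by (rule frac_p_form_eq[OF m(2,3) ae, symmetric])
  also have "\<dots> = (\<integral>x. G x \<partial>lebesgue)"
    using sol \<phi> unfolding weak_solution_def set_lebesgue_integral_def G_def by auto
  also have "\<dots> = (\<integral>x. f (v x) * \<phi> x \<partial>lebesgue)" by (rule integral_cong_AE[OF Gm fm' ae''])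
  also have "\<dots> = (\<integral>x. f (v x) * \<phi> x \<partial>lborel)" by (rule integral_completion[OF fm])
  finally show "(\<integral>z. form_integrand (s * p) p v \<phi> z \<partial>lborel2) = (\<integral>x. f (v x) * \<phi> x \<partial>lborel)" .
qed

lemma locally_lipschitz_interval:
  assumes "locally_lipschitz f"
  obtains L where "0 \<le> L" "\<And>a b. a \<in> {0..T} \<Longrightarrow> b \<in> {0..T} \<Longrightarrow> \<bar>f a - f b\<bar> \<le> L * \<bar>a - b\<bar>"
proof -
  have ll: "local_lipschitz {0::real} {0..T} (\<lambda>_. f)"
    using assms unfolding locally_lipschitz_def by (rule local_lipschitz_subset) auto
  obtain L where "\<And>t. t \<in> {0::real} \<Longrightarrow> L-lipschitz_on {0..T} f"
    using local_lipschitz_compact_implies_lipschitz[OF ll] by auto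
  then have "L-lipschitz_on {0..T} f" by simp
  then show ?thesis
    using that[of L] by (auto simp: lipschitz_on_def dist_real_def)
qed

text \<open>Pass to a Borel version that vanishes off the ball, bound it by testing with \<open>(u - T)\<^sup>+\<close>, and cut it
  off at the bound.\<close>

lemma weak_solution_bounded_representative:
  fixes u :: "'a::euclidean_space \<Rightarrow> real" and s p R C :: real
  assumes s: "0 < s" "s * p < 1" and p: "1 < p" "p < 2" and R: "0 < R"
    and f_lip: "locally_lipschitz f"
    and f_growth: "\<And>t. \<bar>f t\<bar> \<le> C * (1 + \<bar>t\<bar> powr (real DIM('a) * p / (real DIM('a) - s * p) - 1))"
    and sol: "weak_solution s p f (ball 0 R) u"
    and nonneg: "AE x in lebesgue. 0 \<le> u x"
  obtains T L v where "bounded_solution (s * p) p R T L f v" "AE x in lborel. u x = v x"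
proof -
  have \<sigma>: "0 < s * p" using s p by simp
  have N: "s * p < real DIM('a)" using s(2) DIM_positive[where 'a='a] by linarith
  have "continuous_on UNIV f"
    using local_lipschitz_continuous_on[of UNIV UNIV "\<lambda>_. f" 0] f_lip by (simp add: locally_lipschitz_def)
  then have fm[measurable]: "f \<in> borel_measurable borel" by (rule borel_measurable_continuous_onI)
  have uW: "u \<in> Wsp0 s p (ball 0 R)" using sol by (simp add: weak_solution_def)
  then have um: "u \<in> borel_measurable lebesgue" and uLp: "integrable lebesgue (\<lambda>x. \<bar>u x\<bar> powr p)"
    and ufin: "gagliardo_energy s p u < \<infinity>" and uout: "AE x in lebesgue. x \<notin> ball 0 R \<longrightarrow> u x = 0"
    by (auto simp: Wsp0_def Wsp_def Lp_space_def)
  obtain g where gm: "g \<in> borel_measurable lborel" and g: "AE x in lborel. u x = g x"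
    using completion_ex_borel_measurable_real[OF um] by blast
  have [measurable]: "g \<in> borel_measurable borel" using gm by simp
  define u0 where "u0 = (\<lambda>x. if norm x < R then max 0 (g x) else 0)"
  have u0m[measurable]: "u0 \<in> borel_measurable borel" unfolding u0_def by measurable
  have u0nn: "0 \<le> u0 x" for x by (simp add: u0_def)
  have u0out: "u0 x = 0" if "x \<notin> ball 0 R" for x using that by (simp add: u0_def)
  have ae0: "AE x in lborel. u x = u0 x"
    using g nonneg[unfolded AE_completion_iff] uout[unfolded AE_completion_iff]
    by eventually_elim (auto simp: u0_def)
  have fin0: "energy (s * p) p u0 < \<infinity>" using gagliardo_energy_eq[OF u0m ae0, of s p] ufin by simp
  have Lp0: "integrable lborel (\<lambda>x. \<bar>u0 x\<bar> powr p)"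
  proof -
    have m: "(\<lambda>x. \<bar>u0 x\<bar> powr p) \<in> borel_measurable lborel" by measurable
    have "integrable lebesgue (\<lambda>x. \<bar>u0 x\<bar> powr p)"
    proof (rule integrable_cong_AE_imp[OF uLp measurable_completion[OF m]])
      show "AE x in lebesgue. \<bar>u x\<bar> powr p = \<bar>u0 x\<bar> powr p"
        by (rule AE_completion) (use ae0 in \<open>auto elim!: eventually_mono\<close>)
    qed
    then show ?thesis using integrable_completion[OF m] by blast
  qed
  have uq: "(\<integral>\<^sup>+x. ennreal (u0 x powr (real DIM('a) * p / (DIM('a) - s * p))) \<partial>lborel) < \<infinity>"
    by (rule sobolev[OF \<sigma> N p(1) u0m u0nn u0out fin0])
  have test: "max (u0 x - T) 0 \<le> u0 x" if "0 \<le> T" for T x using that u0nn[of x] by simp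
  have testW: "(\<lambda>x. max (u0 x - T) 0) \<in> Wsp0 s p (ball 0 R)" if T: "1 \<le> T" for T
  proof (rule Wsp0_borelI)
    show "integrable lborel (\<lambda>x. \<bar>max (u0 x - T) 0\<bar> powr p)"
      by (rule Bochner_Integration.integrable_bound[OF Lp0])
        (use test[of T] T p u0nn in \<open>auto intro!: AE_I2 powr_mono2\<close>)
    show "energy (s * p) p (\<lambda>x. max (u0 x - T) 0) < \<infinity>"
      by (rule le_less_trans[OF energy_mono fin0]) (use p in auto)
    show "max (u0 x - T) 0 = 0" if "x \<notin> ball 0 R" for x using u0out[OF that] T by simp
  qed measurable
  have testout: "max (u0 x - T) 0 = 0" if "1 \<le> T" "x \<notin> ball 0 R" for T x using u0out[OF that(2)] that(1) by simp
  have ti: "integrable lborel (\<lambda>x. f (u0 x) * max (u0 x - T) 0)"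
    and tf: "(\<integral>z. form_integrand (s * p) p u0 (\<lambda>x. max (u0 x - T) 0) z \<partial>lborel2)
      = (\<integral>x. f (u0 x) * max (u0 x - T) 0 \<partial>lborel)" if "1 \<le> T" for T
    by (rule weak_solution_borel[OF sol testW[OF that] fm u0m _ testout[OF that] ae0]; simp)+
  obtain T where T: "1 \<le> T" "AE x in lborel. u0 x \<le> T"
    using bounded_of_critical_growth[OF \<sigma> N p u0m u0nn uq fin0 f_growth ti tf] by blast
  define v where "v = (\<lambda>x. min (u0 x) T)"
  have vm[measurable]: "v \<in> borel_measurable borel" unfolding v_def by measurable
  have ae: "AE x in lborel. u x = v x" using ae0 T(2) by eventually_elim (simp add: v_def)
  obtain L where L: "0 \<le> L" "\<And>a b. a \<in> {0..T} \<Longrightarrow> b \<in> {0..T} \<Longrightarrow> \<bar>f a - f b\<bar> \<le> L * \<bar>a - b\<bar>"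
    using locally_lipschitz_interval[OF f_lip] by blast
  have "bounded_solution (s * p) p R T L f v"
  proof
    show "energy (s * p) p v < \<infinity>"
      by (rule le_less_trans[OF energy_mono fin0]) (use p in \<open>auto simp: v_def\<close>)
    fix \<phi> :: "'a \<Rightarrow> real" and M
    assume \<phi>[measurable]: "\<phi> \<in> borel_measurable borel" and M: "\<And>x. \<bar>\<phi> x\<bar> \<le> M"
      and out: "\<And>x. x \<notin> ball 0 R \<Longrightarrow> \<phi> x = 0" and fin: "energy (s * p) p \<phi> < \<infinity>"
    have "\<phi> \<in> Wsp0 s p (ball 0 R)"
    proof (rule Wsp0_borelI[OF \<phi> _ fin out])
      show "integrable lborel (\<lambda>x. \<bar>\<phi> x\<bar> powr p)"
      proof (rule Bochner_Integration.integrable_bound)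
        show "integrable lborel (\<lambda>x. M powr p * indicator (ball (0::'a) R) x)"
          by (intro integrable_mult_right integrable_real_indicator) (use R in \<open>auto simp: emeasure_ball_pow\<close>)
        show "AE x in lborel. norm (\<bar>\<phi> x\<bar> powr p) \<le> norm (M powr p * indicator (ball 0 R) x)"
          using M out p by (intro AE_I2) (auto simp: indicator_def intro!: powr_mono2)
      qed measurable
    qed
    then show "(\<integral>z. form_integrand (s * p) p v \<phi> z \<partial>lborel2) = (\<integral>x. f (v x) * \<phi> x \<partial>lborel)"
      by (rule weak_solution_borel(2)[OF sol _ fm vm \<phi> out ae])
  qed (use \<sigma> s p R T L u0nn u0out in \<open>auto simp: v_def\<close>)
  then show ?thesis using that ae by blast
qed

theorem corollary1p6:
  fixes u :: "'a::euclidean_space \<Rightarrow> real"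
    and f :: "real \<Rightarrow> real"
    and s p R C :: real
  assumes s: "0 < s" "s < 1 / 2"
    and p: "1 / (1 - s) < p" "p < 2"
    and R: "0 < R"
    and f_lip: "locally_lipschitz f"
    and f_growth: "\<And>t. \<bar>f t\<bar> \<le> C * (1 + \<bar>t\<bar> powr (real DIM('a) * p / (real DIM('a) - s * p) - 1))"
    and sol: "weak_solution s p f (ball 0 R) u"
    and nonneg: "AE x in lebesgue. 0 \<le> u x"
    and nontrivial: "\<not> (AE x in lebesgue. u x = 0)"
  shows "\<exists>v. continuous_on UNIV v \<and> (AE x in lebesgue. v x = u x) \<and>
           (\<forall>x\<in>ball 0 R. 0 < v x) \<and>
           radially_symmetric v \<and>
           strictly_radially_decreasing_on (ball 0 R) v"
proof -
  have "1 < 1 / (1 - s)" using s by simp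
  then have p1: "1 < p" using p by linarith
  have "s * p < 1 / 2 * 2" using s p p1 by (intro mult_strict_mono) auto
  then have sp: "s * p < 1" by simp
  obtain T L u1 where b1: "bounded_solution (s * p) p R T L f u1" and ae1: "AE x in lborel. u x = u1 x"
    using weak_solution_bounded_representative[OF s(1) sp p1 p(2) R f_lip f_growth sol nonneg] by blast
  have nt1: "\<not> (AE x in lborel. u1 x = 0)"
  proof
    assume "AE x in lborel. u1 x = 0"
    with ae1 have "AE x in lborel. u x = 0" by eventually_elim simp
    then show False using nontrivial by (simp add: AE_completion_iff)
  qed
  obtain v where bv: "bounded_solution (s * p) p R T L f v" and aev: "AE x in lborel. v x = u1 x"
    and mono: "\<And>x y. norm y \<le> norm x \<Longrightarrow> v x \<le> v y" and zero: "v 0 = (SUP x\<in>- {0}. v x)"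
    using bounded_solution.radial_representative[OF b1 nt1] by blast
  interpret v: bounded_solution "s * p" p R T L f v by (rule bv)
  have ntv: "\<not> (AE x in lborel. v x = 0)"
  proof
    assume "AE x in lborel. v x = 0"
    with aev have "AE x in lborel. u1 x = 0" by eventually_elim simp
    with nt1 show False by simp
  qed
  have dec: "strictly_radially_decreasing_on (ball 0 R) v"
    by (rule v.strictly_decreasing_of_antimono[OF ntv mono])
  have "0 < v x" if x: "x \<in> ball 0 R" for x
  proof -
    obtain b :: 'a where b: "b \<in> Basis" using nonempty_Basis by blast
    define y where "y = ((norm x + R) / 2) *\<^sub>R b"
    have "norm y = (norm x + R) / 2" using R b by (simp add: y_def)
    then have "y \<in> ball 0 R" "norm x < norm y" using x by auto
    then have "v y < v x" using dec x unfolding strictly_radially_decreasing_on_def by blast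
    then show ?thesis using v.u_nonneg[of y] by simp
  qed
  moreover have "continuous_on UNIV v" by (rule v.continuous_of_antimono[OF mono zero])
  moreover have "AE x in lebesgue. v x = u x"
    by (rule AE_completion) (use ae1 aev in eventually_elim, simp)
  moreover have "radially_symmetric v"
    unfolding radially_symmetric_def using mono by (metis order.antisym order_refl)
  ultimately show ?thesis using dec by blast
qed

end
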